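(* Let $A$, $F$, $\sigma$, $L$, $N$, $P$, $Q$ and the noise be as in the context, and assume that the spectral gap condition $$\lambda_{N+1}-\lambda_N\ \ge\ \frac{2L}{\mu}\Big(\lambda_N^\sigma+\sigma^\sigma\Gamma(1-\sigma)(\lambda_{N+1}-\lambda_N)^\sigma+\lambda_{N+1}^\sigma\Big)$$ holds for some $\mu\in(0,1)$. Let $\psi^\alpha$ and $\psi$ be the maps defined in the context, so that $\{\xi+e^{z(\omega_{\ell^\alpha})}\psi^\alpha(\omega_{\ell^\alpha},e^{-z(\omega_{\ell^\alpha})}\xi):\xi\in PD(A^\sigma)\}$ and $\{\xi+e^{z(\omega)}\psi(\omega,e^{-z(\omega)}\xi):\xi\in PD(A^\sigma)\}$ are the inertial manifolds of $\frac{dv^\alpha}{dt}+Av^\alpha=F(v^\alpha)+v^\alpha\diamond\dot W_{S^\alpha_t}$ and of $\frac{dv}{dt}+Av=F(v)+v\circ\dot W_t$, respectively. Then for every $\xi\in PD(A^\sigma)$, $$\big\|e^{z(\omega_{\ell^\alpha})}\psi^\alpha(\omega_{\ell^\alpha},e^{-z(\omega_{\ell^\alpha})}\xi)-e^{z(\omega)}\psi(\omega,e^{-z(\omega)}\xi)\big\|_\sigma\to0$$ in probability as $\alpha\to2$. Furthermore, if $F\in C^1$, then for every $\xi\in PD(A^\sigma)$, $$\big\|D_\xi\big(e^{z(\omega_{\ell^\alpha})}\psi^\alpha(\omega_{\ell^\alpha},e^{-z(\omega_{\ell^\alpha})}\xi)\big)-D_\xi\big(e^{z(\omega)}\psi(\omega,e^{-z(\omega)}\xi)\big)\big\|\to0$$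 in probability as $\alpha\to2$, where the norm is the operator norm of bounded linear maps $PD(A^\sigma)\to QD(A^\sigma)$.
   Context: **Operator and nonlinearity.** $H$ is a separable Hilbert space with norm $\|\cdot\|$. There is an orthonormal basis $\{e_k\}$ of $H$ with $Ae_k=\lambda_ke_k$, $0<\lambda_1\le\lambda_2\le\cdots$, $\lambda_k\to+\infty$. $D(A^\sigma)$ carries the norm $\|u\|_\sigma=\|A^\sigma u\|$. $0\le\sigma<1$, and $F:D(A^\sigma)\to H$ satisfies $F(0)=0$ and $\|F(u_1)-F(u_2)\|\le L\|u_1-u_2\|_\sigma$ for all $u_1,u_2\in D(A^\sigma)$, with $L>0$. $F\in C^1$ means $C^1$ from $D(A^\sigma)$ to $H$. $N\ge1$ is a fixed integer with $\lambda_N<\lambda_{N+1}$, $P$ is the orthogonal projector onto $\mathrm{span}\{e_1,\dots,e_N\}$, $Q=I-P$. When $\sigma=0$, $\sigma^\sigma=1$. **Noise.** $\alpha\in(1,2)$ and $\alpha\to2$ means $\alpha\uparrow2$. $W$ is a two-sided standard one-dimensional Brownian motion with path $\omega\in\mathbb W$ (continuous functions $\mathbb R\to\mathbb R$ vanishing at $0$, Wiener measure $\mu_{\mathbb W}$). $S^\alpha$ is a two-sided $\frac\alpha2$-stable subordinator independent of $W$ with path $\ell^\alpha\in\mathbb S$ (increasing càdlàg functions $\mathbb R\to\mathbb R$ with limit $0$ at $0$, law $\mu_{\mathbb S}$), no drift, and Lévy measure $C(\alpha)x^{-1-\alpha/2}dx$ on $(0,\infty)$, where $C(\alpha)>0$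 and $\lim_{\alpha\to2}\frac{2C(\alpha)}{2-\alpha}=1$. $\Omega=\mathbb W\times\mathbb S$, $\mathbb P=\mu_{\mathbb W}\times\mu_{\mathbb S}$; $(\omega,\ell^\alpha)$ is written $\omega_{\ell^\alpha}$, $W_{S^\alpha_t}=\omega_{\ell^\alpha_t}$, and the same $\omega$ drives both equations. The shifts are $\theta_t(\omega_{\ell^\alpha_s})=\omega_{\ell^\alpha_{t+s}}-\omega_{\ell^\alpha_t}$ and $\theta_t\omega=\omega_{t+\cdot}-\omega_t$. Let $z(\omega_{\ell^\alpha})=-\int_{-\infty}^0e^s\omega_{\ell^\alpha_s}ds$ and $z(\omega)=-\int_{-\infty}^0e^s\omega_sds$, so $z(\theta_t\omega_{\ell^\alpha})=\omega_{\ell^\alpha_t}-\int_{-\infty}^0e^s\omega_{\ell^\alpha_{t+s}}ds$ and $z(\theta_t\omega)=\omega_t-\int_{-\infty}^0e^s\omega_{t+s}ds$. $\Omega$ is restricted to a shift-invariant set of full measure on which, as $t\to\pm\infty$, $\omega_{\ell^\alpha_t}/t\to0$, $z(\theta_t\omega_{\ell^\alpha})/t\to0$, $\frac1t\int_0^tz(\theta_s\omega_{\ell^\alpha})ds\to0$, and likewise for $\omega$. "In probability as $\alpha\to2$" means that for each $\varepsilon>0$ the $\mathbb P$-probability that the quantity exceeds $\varepsilon$ tends to $0$. $\diamond$ is the Marcus integral and $\circ$ the Stratonovich integral. **The maps $\psi^\alpha,\psi$.** Let $G(\omega_{\ell^\alpha},u)=e^{-z(\omega_{\ell^\alpha})}F(e^{z(\omega_{\ell^\alpha})}u)$,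 $\beta=\lambda_N+\frac2\mu L\lambda_N^\sigma\in(\lambda_N,\lambda_{N+1})$, and let $$\mathcal C_\beta^{\alpha,-}=\Big\{\varphi\in C((-\infty,0],D(A^\sigma)):\ \sup_{t\le0}e^{\beta t-\int_0^tz(\theta_r\omega_{\ell^\alpha})dr}\|\varphi(t)\|_\sigma<\infty\Big\}.$$ Under the gap condition, for each $\xi\in PD(A^\sigma)$ there is a unique $\bar u^\alpha(\cdot,\omega_{\ell^\alpha},\xi)\in\mathcal C_\beta^{\alpha,-}$ with, for $t\le0$, $$u(t)=e^{-At+\int_0^tz(\theta_r\omega_{\ell^\alpha})dr}\xi+\int_0^te^{-A(t-s)+\int_s^tz(\theta_r\omega_{\ell^\alpha})dr}PG(\theta_s\omega_{\ell^\alpha},u(s))ds+\int_{-\infty}^te^{-A(t-s)+\int_s^tz(\theta_r\omega_{\ell^\alpha})dr}QG(\theta_s\omega_{\ell^\alpha},u(s))ds,$$ and $$\psi^\alpha(\omega_{\ell^\alpha},\xi)=Q\bar u^\alpha(0,\omega_{\ell^\alpha},\xi)=\int_{-\infty}^0e^{As+\int_s^0z(\theta_r\omega_{\ell^\alpha})dr}QG(\theta_s\omega_{\ell^\alpha},\bar u^\alpha(s,\omega_{\ell^\alpha},\xi))ds.$$ The map $\psi(\omega,\xi)=Q\bar u(0,\omega,\xi)$ is defined in exactly the same way with $\omega_{\ell^\alpha}$ replaced by $\omega$ everywhere. If $F\in C^1$, both maps are $C^1$ in $\xi$. *)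

theory Defs
  imports "HOL-Probability.Probability"
begin

section \<open>The operator and its fractional powers\<close>

text \<open>
  The operator $A$ is given by its spectral data: an orthonormal basis \<open>e k\<close> and eigenvalues
  \<open>lam k\<close>, where only the indices \<open>k \<ge> 1\<close> are used.  \<open>spec_fun e lam g\<close> is $g(A)$.  For
  $g(A) = e^{-At}$ with $t < 0$ it is meaningful on the span of finitely many \<open>e k\<close>,
  which is the only place where it is used for such \<open>t\<close>.
\<close>

definition spec_fun ::
  "(nat \<Rightarrow> 'a::{real_inner, banach, second_countable_topology}) \<Rightarrow> (nat \<Rightarrow> real)
    \<Rightarrow> (real \<Rightarrow> real) \<Rightarrow> 'a \<Rightarrow> 'a" where
  "spec_fun e lam g u = (\<Sum>\<^sub>\<infinity>k\<in>{1..}. (g (lam k) * (u \<bullet> e k)) *\<^sub>R e k)"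

definition A_pow ::
  "(nat \<Rightarrow> 'a::{real_inner, banach, second_countable_topology}) \<Rightarrow> (nat \<Rightarrow> real)
    \<Rightarrow> real \<Rightarrow> 'a \<Rightarrow> 'a" where
  "A_pow e lam \<sigma> = spec_fun e lam (\<lambda>x. x powr \<sigma>)"

definition dom_A_pow ::
  "(nat \<Rightarrow> 'a::{real_inner, banach, second_countable_topology}) \<Rightarrow> (nat \<Rightarrow> real)
    \<Rightarrow> real \<Rightarrow> 'a set" where
  "dom_A_pow e lam \<sigma> = {u. (\<lambda>k. (lam k powr \<sigma> * (u \<bullet> e k))\<^sup>2) summable_on {1..}}"

definition norm_A ::
  "(nat \<Rightarrow> 'a::{real_inner, banach, second_countable_topology}) \<Rightarrow> (nat \<Rightarrow> real)
    \<Rightarrow> real \<Rightarrow> 'a \<Rightarrow> real" where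
  "norm_A e lam \<sigma> u = norm (A_pow e lam \<sigma> u)"

definition exp_A ::
  "(nat \<Rightarrow> 'a::{real_inner, banach, second_countable_topology}) \<Rightarrow> (nat \<Rightarrow> real)
    \<Rightarrow> real \<Rightarrow> 'a \<Rightarrow> 'a" where
  "exp_A e lam t = spec_fun e lam (\<lambda>x. exp (- x * t))"

definition proj_P ::
  "(nat \<Rightarrow> 'a::{real_inner, banach, second_countable_topology}) \<Rightarrow> nat \<Rightarrow> 'a \<Rightarrow> 'a" where
  "proj_P e N u = (\<Sum>k=1..N. (u \<bullet> e k) *\<^sub>R e k)"

definition proj_Q ::
  "(nat \<Rightarrow> 'a::{real_inner, banach, second_countable_topology}) \<Rightarrow> nat \<Rightarrow> 'a \<Rightarrow> 'a" where
  "proj_Q e N u = u - proj_P e N u"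

lemma spec_fun_eigenvector:
  assumes on: "\<And>j k. j \<ge> 1 \<Longrightarrow> k \<ge> 1 \<Longrightarrow> e j \<bullet> e k = (if j = k then 1 else 0)" and "k \<ge> 1"
  shows "spec_fun e lam g (e k) = g (lam k) *\<^sub>R e k"
proof -
  have "spec_fun e lam g (e k) = (\<Sum>\<^sub>\<infinity>j\<in>{k}. (g (lam j) * (e k \<bullet> e j)) *\<^sub>R e j)"
    unfolding spec_fun_def by (rule infsum_cong_neutral) (use assms in auto)
  then show ?thesis
    using assms by simp
qed


section \<open>Frechet derivatives between normed subspaces\<close>

text \<open>
  The spaces $D(A^\sigma)$, $PD(A^\sigma)$, $QD(A^\sigma)$ are linear subspaces \<open>X\<close> of the ambient
  type with a norm \<open>nX\<close> other than the one of the type, so derivatives are defined relative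
  to \<open>X\<close> and \<open>nX\<close>.  A derivative is a function on the whole type of which only the values
  on \<open>X\<close> matter; there it is unique.
\<close>

definition has_deriv_on ::
  "'a::real_vector set \<Rightarrow> ('a \<Rightarrow> real) \<Rightarrow> 'b::real_vector set \<Rightarrow> ('b \<Rightarrow> real)
    \<Rightarrow> ('a \<Rightarrow> 'b) \<Rightarrow> ('a \<Rightarrow> 'b) \<Rightarrow> 'a \<Rightarrow> bool" where
  "has_deriv_on X nX Y nY f D x \<longleftrightarrow>
     f ` X \<subseteq> Y \<and> D ` X \<subseteq> Y \<and>
     (\<forall>h\<in>X. \<forall>k\<in>X. \<forall>a b. D (a *\<^sub>R h + b *\<^sub>R k) = a *\<^sub>R D h + b *\<^sub>R D k) \<and>
     (\<exists>K. \<forall>h\<in>X. nY (D h) \<le> K * nX h) \<and>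
     (\<forall>\<epsilon>>0. \<exists>\<delta>>0. \<forall>h\<in>X. nX h < \<delta> \<longrightarrow> nY (f (x + h) - f x - D h) \<le> \<epsilon> * nX h)"

definition deriv_on ::
  "'a::real_vector set \<Rightarrow> ('a \<Rightarrow> real) \<Rightarrow> 'b::real_vector set \<Rightarrow> ('b \<Rightarrow> real)
    \<Rightarrow> ('a \<Rightarrow> 'b) \<Rightarrow> 'a \<Rightarrow> 'a \<Rightarrow> 'b" where
  "deriv_on X nX Y nY f x = (SOME D. has_deriv_on X nX Y nY f D x)"

definition op_norm_on ::
  "'a set \<Rightarrow> ('a \<Rightarrow> real) \<Rightarrow> ('b \<Rightarrow> real) \<Rightarrow> ('a \<Rightarrow> 'b) \<Rightarrow> real" where
  "op_norm_on X nX nY T = (SUP h\<in>{h\<in>X. nX h \<le> 1}. nY (T h))"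

definition C1_map_on ::
  "'a::real_vector set \<Rightarrow> ('a \<Rightarrow> real) \<Rightarrow> 'b::real_vector set \<Rightarrow> ('b \<Rightarrow> real)
    \<Rightarrow> ('a \<Rightarrow> 'b) \<Rightarrow> bool" where
  "C1_map_on X nX Y nY f \<longleftrightarrow>
     (\<exists>D. (\<forall>u\<in>X. has_deriv_on X nX Y nY f (D u) u) \<and>
          (\<forall>u\<in>X. \<forall>\<epsilon>>0. \<exists>\<delta>>0. \<forall>v\<in>X. nX (v - u) < \<delta> \<longrightarrow>
              op_norm_on X nX nY (\<lambda>h. D v h - D u h) < \<epsilon>))"


section \<open>The noise\<close>

definition wiener_paths :: "(real \<Rightarrow> real) set" where
  "wiener_paths = {w. continuous_on UNIV w \<and> w 0 = 0}"

definition subordinator_paths :: "(real \<Rightarrow> real) set" where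
  "subordinator_paths =
     {l. mono l \<and> (\<forall>t. (l \<longlongrightarrow> l t) (at_right t)) \<and> (\<forall>t. \<exists>y. (l \<longlongrightarrow> y) (at_left t)) \<and>
         (l \<longlongrightarrow> 0) (at 0)}"

text \<open>A set of paths with the \<open>\<sigma>\<close>-algebra generated by the coordinate evaluations.\<close>

definition path_algebra :: "(real \<Rightarrow> real) set \<Rightarrow> (real \<Rightarrow> real) measure" where
  "path_algebra X = restrict_space (\<Pi>\<^sub>M t\<in>UNIV. borel) X"

definition independent_increments :: "(real \<Rightarrow> real) measure \<Rightarrow> bool" where
  "independent_increments M \<longleftrightarrow>
     (\<forall>(t::nat \<Rightarrow> real) n. mono t \<longrightarrow>
        prob_space.indep_vars M (\<lambda>_. borel) (\<lambda>i x. x (t (Suc i)) - x (t i)) {..<n})"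

definition wiener_measure :: "(real \<Rightarrow> real) measure \<Rightarrow> bool" where
  "wiener_measure M \<longleftrightarrow>
     prob_space M \<and> sets M = sets (path_algebra wiener_paths) \<and>
     independent_increments M \<and>
     (\<forall>s t. s < t \<longrightarrow>
        distributed M lborel (\<lambda>w. w t - w s) (normal_density 0 (sqrt (t - s))))"

text \<open>
  Law of the two-sided \<open>\<alpha>/2\<close>-stable subordinator without drift and with Levy measure
  $c\,x^{-1-\alpha/2}\,dx$ on $(0,\infty)$: the increments are stationary and independent, and their
  Laplace transform is given by the Levy-Khintchine formula for subordinators.
\<close>

definition stable_subordinator_law ::
  "real \<Rightarrow> real \<Rightarrow> (real \<Rightarrow> real) measure \<Rightarrow> bool" where
  "stable_subordinator_law \<alpha> c M \<longleftrightarrow>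
     prob_space M \<and> sets M = sets (path_algebra subordinator_paths) \<and>
     independent_increments M \<and>
     (\<forall>s t q. s < t \<longrightarrow> q \<ge> 0 \<longrightarrow>
        (LINT l|M. exp (- q * (l t - l s))) =
        exp (- (t - s) * (LBINT x:{0<..}. (1 - exp (- q * x)) * (c * x powr (- 1 - \<alpha> / 2)))))"

definition shift :: "real \<Rightarrow> (real \<Rightarrow> real) \<Rightarrow> real \<Rightarrow> real" where
  "shift t x s = x (t + s) - x t"

definition zeta :: "(real \<Rightarrow> real) \<Rightarrow> real" where
  "zeta x = - (LBINT s=-\<infinity>..0. exp s * x s)"

definition zeta_int :: "(real \<Rightarrow> real) \<Rightarrow> real \<Rightarrow> real \<Rightarrow> real" where
  "zeta_int x s t = (LBINT r=ereal s..ereal t. zeta (shift r x))"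

definition tempered_path :: "(real \<Rightarrow> real) \<Rightarrow> bool" where
  "tempered_path x \<longleftrightarrow>
     (\<forall>\<F>\<in>{at_top, at_bot}.
        ((\<lambda>t. x t / t) \<longlongrightarrow> 0) \<F> \<and>
        ((\<lambda>t. zeta (shift t x) / t) \<longlongrightarrow> 0) \<F> \<and>
        ((\<lambda>t. zeta_int x 0 t / t) \<longlongrightarrow> 0) \<F>)"

text \<open>
  The largest set of pairs \<open>(w, l)\<close> with the required growth properties.  The time-changed path
  is \<open>w \<circ> l\<close>.
\<close>

definition good_paths :: "((real \<Rightarrow> real) \<times> (real \<Rightarrow> real)) set" where
  "good_paths = {(w, l). w \<in> wiener_paths \<and> l \<in> subordinator_paths \<and>
                         tempered_path w \<and> tempered_path (w \<circ> l)}"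


section \<open>The inertial manifold maps\<close>

text \<open>
  Everything is defined for an arbitrary driving path \<open>x\<close>; the maps $\psi^\alpha$ and $\psi$ are
  obtained with \<open>x = w \<circ> l\<close> and \<open>x = w\<close>.
\<close>

definition G_map :: "('a::real_vector \<Rightarrow> 'a) \<Rightarrow> (real \<Rightarrow> real) \<Rightarrow> 'a \<Rightarrow> 'a" where
  "G_map F x u = exp (- zeta x) *\<^sub>R F (exp (zeta x) *\<^sub>R u)"

definition weighted_space ::
  "(nat \<Rightarrow> 'a::{real_inner, banach, second_countable_topology}) \<Rightarrow> (nat \<Rightarrow> real) \<Rightarrow> real
    \<Rightarrow> real \<Rightarrow> (real \<Rightarrow> real) \<Rightarrow> (real \<Rightarrow> 'a) set" where
  "weighted_space e lam \<sigma> \<beta> x =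
     {\<phi>. (\<forall>t\<le>0. \<phi> t \<in> dom_A_pow e lam \<sigma>) \<and>
          (\<forall>t\<le>0. ((\<lambda>s. norm_A e lam \<sigma> (\<phi> s - \<phi> t)) \<longlongrightarrow> 0) (at t within {..0})) \<and>
          bdd_above ((\<lambda>t. exp (\<beta> * t - zeta_int x 0 t) * norm_A e lam \<sigma> (\<phi> t)) ` {..0})}"

definition manifold_orbit ::
  "(nat \<Rightarrow> 'a::{real_inner, banach, second_countable_topology}) \<Rightarrow> (nat \<Rightarrow> real) \<Rightarrow> real
    \<Rightarrow> ('a \<Rightarrow> 'a) \<Rightarrow> nat \<Rightarrow> real \<Rightarrow> (real \<Rightarrow> real) \<Rightarrow> 'a \<Rightarrow> (real \<Rightarrow> 'a) \<Rightarrow> bool" where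
  "manifold_orbit e lam \<sigma> F N \<beta> x \<xi> u \<longleftrightarrow>
     u \<in> weighted_space e lam \<sigma> \<beta> x \<and>
     (\<forall>t\<le>0. u t =
        exp (zeta_int x 0 t) *\<^sub>R exp_A e lam t \<xi>
        + (LBINT s=0..ereal t. exp (zeta_int x s t) *\<^sub>R
             exp_A e lam (t - s) (proj_P e N (G_map F (shift s x) (u s))))
        + (LBINT s=-\<infinity>..ereal t. exp (zeta_int x s t) *\<^sub>R
             exp_A e lam (t - s) (proj_Q e N (G_map F (shift s x) (u s)))))"

text \<open>
  Under the gap condition the orbit is unique on \<open>{..0}\<close>, the only set of times on which
  \<open>manifold_orbit\<close> constrains it.
\<close>

definition ubar ::
  "(nat \<Rightarrow> 'a::{real_inner, banach, second_countable_topology}) \<Rightarrow> (nat \<Rightarrow> real) \<Rightarrow> real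
    \<Rightarrow> ('a \<Rightarrow> 'a) \<Rightarrow> nat \<Rightarrow> real \<Rightarrow> (real \<Rightarrow> real) \<Rightarrow> 'a \<Rightarrow> real \<Rightarrow> 'a" where
  "ubar e lam \<sigma> F N \<beta> x \<xi> = (SOME u. manifold_orbit e lam \<sigma> F N \<beta> x \<xi> u)"

definition psi ::
  "(nat \<Rightarrow> 'a::{real_inner, banach, second_countable_topology}) \<Rightarrow> (nat \<Rightarrow> real) \<Rightarrow> real
    \<Rightarrow> ('a \<Rightarrow> 'a) \<Rightarrow> nat \<Rightarrow> real \<Rightarrow> (real \<Rightarrow> real) \<Rightarrow> 'a \<Rightarrow> 'a" where
  "psi e lam \<sigma> F N \<beta> x \<xi> = proj_Q e N (ubar e lam \<sigma> F N \<beta> x \<xi> 0)"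

text \<open>The map whose graph over $PD(A^\sigma)$ is the inertial manifold of the untransformed equation.\<close>

definition manifold_map ::
  "(nat \<Rightarrow> 'a::{real_inner, banach, second_countable_topology}) \<Rightarrow> (nat \<Rightarrow> real) \<Rightarrow> real
    \<Rightarrow> ('a \<Rightarrow> 'a) \<Rightarrow> nat \<Rightarrow> real \<Rightarrow> (real \<Rightarrow> real) \<Rightarrow> 'a \<Rightarrow> 'a" where
  "manifold_map e lam \<sigma> F N \<beta> x \<xi> =
     exp (zeta x) *\<^sub>R psi e lam \<sigma> F N \<beta> x (exp (- zeta x) *\<^sub>R \<xi>)"

definition deriv_manifold_map ::
  "(nat \<Rightarrow> 'a::{real_inner, banach, second_countable_topology}) \<Rightarrow> (nat \<Rightarrow> real) \<Rightarrow> real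
    \<Rightarrow> ('a \<Rightarrow> 'a) \<Rightarrow> nat \<Rightarrow> real \<Rightarrow> (real \<Rightarrow> real) \<Rightarrow> 'a \<Rightarrow> 'a \<Rightarrow> 'a" where
  "deriv_manifold_map e lam \<sigma> F N \<beta> x \<xi> =
     deriv_on (proj_P e N ` dom_A_pow e lam \<sigma>) (norm_A e lam \<sigma>)
              (proj_Q e N ` dom_A_pow e lam \<sigma>) (norm_A e lam \<sigma>)
              (manifold_map e lam \<sigma> F N \<beta> x) \<xi>"


section \<open>Convergence in probability\<close>

text \<open>
  \<open>X \<alpha> \<rightarrow> 0\<close> in probability as \<open>\<alpha>\<close> increases to \<open>2\<close>, where \<open>X \<alpha>\<close> lives on the subset \<open>\<Omega>\<close> of the
  probability space \<open>M \<alpha>\<close>.  On measurable events \<open>outer_measure_of\<close> is the probability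
  (\<open>outer_measure_of_eq\<close>); unlike \<open>measure\<close> it is not \<open>0\<close> by convention on other sets.
\<close>

definition tends_to_0_in_prob ::
  "(real \<Rightarrow> 'w measure) \<Rightarrow> 'w set \<Rightarrow> (real \<Rightarrow> 'w \<Rightarrow> real) \<Rightarrow> bool" where
  "tends_to_0_in_prob M \<Omega> X \<longleftrightarrow>
     (\<forall>\<epsilon>>0. ((\<lambda>\<alpha>. outer_measure_of (M \<alpha>) {p\<in>\<Omega>. X \<alpha> p > \<epsilon>}) \<longlongrightarrow> 0) (at_left 2))"

end

theory Submission
  imports Defs "HOL-Library.Diagonal_Subsequence"
begin

text \<open>
  Let $y(t) = \int_{-\infty}^0 e^r x(t+r)\,dr$ for a driving path $x$.  Then $z(\theta_t x) = x(t) - y(t) = y'(t)$,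
  and $u(t) = e^{y(t) - \beta t} A^{-\sigma} \varphi(t)$ turns the equation of the orbit on the manifold into
  \[ \varphi(t) = e^{(\beta - A) t} A^\sigma \xi + \int_{-\infty}^0 S(t-s)\, \Phi_s(\varphi(s))\, ds, \qquad
     \Phi_s(v) = c^{-1} F(A^{-\sigma} c v), \quad c = e^{x(s) - \beta s}, \]
  with $S(\tau) = A^\sigma e^{(\beta - A)\tau} Q$ for $\tau > 0$ and $S(\tau) = - A^\sigma e^{(\beta - A)\tau} P$ for
  $\tau \le 0$.  The kernel and the Lipschitz constant of $\Phi_s$ do not depend on $x$, so the contraction bound
  is uniform in $x$, no growth estimate for the noise is needed, and $\varphi$ depends continuously on $x$ under
  mere pointwise convergence.  The same holds for the linearized equation, whose solution is the derivative.
  Since the manifold is obtained from $\varphi(0)$, it remains to see that $\ell^\alpha$ converges to the identity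
  in probability, which follows from Laplace transforms at rational times and monotonicity, and to restrict
  $\omega$ to an equicontinuous set of paths.
\<close>

section \<open>Diagonal operators\<close>

text \<open>There is one law for each \<open>\<alpha>\<close>, no coupling of these laws is given,
  and the maps to be compared are not known to be measurable in the path, so passing to an almost
  surely convergent subsequence is not at hand. The claim is instead reduced to a deterministic one
  about arbitrary sequences of pairs of paths: compactness produces a continuous limit path, and the
  outer measure is controlled by covering with measurable rectangles. The limit path need not be
  tempered. Hence the manifold is rebuilt as \<open>graph_map\<close>, meaningful for every path
  with countably many discontinuities, and identified with the given map only on good paths. What
  permits this is a cancellation: the factors \<open>exp (zeta x)\<close> of the graph, the weight
  of the solution space and the factors of \<open>G_map\<close> combine so that only x(s) - \<beta>
  s, a local quantity of the path, is left. The constant \<mu> is the contraction factor: \<beta> is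
  placed so that the modes below the gap use exactly half of it, and the gap condition leaves at
  most the other half to the modes above.\<close>

locale orthonormal_basis =
  fixes e :: "nat \<Rightarrow> 'a::{real_inner, banach, second_countable_topology}"
  assumes orthonormal: "\<And>j k. j \<ge> 1 \<Longrightarrow> k \<ge> 1 \<Longrightarrow> e j \<bullet> e k = (if j = k then 1 else 0)"
    and basis: "closure (span (e ` {1..})) = UNIV"
begin

text \<open>The vectors orthogonal to \<open>u - v\<close> form a closed subspace, which contains
  the basis and hence everything. Operator identities below are checked through this, one
  eigenvector at a time.\<close>

lemma coeff_ext:
  assumes "\<And>k. k \<ge> 1 \<Longrightarrow> u \<bullet> e k = v \<bullet> e k"
  shows "u = v"
proof -
  define w where "w = u - v"
  have "span (e ` {1..}) \<subseteq> {z. w \<bullet> z = 0}"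
    by (rule span_minimal) (auto simp: w_def assms inner_diff_left subspace_def inner_add_right)
  then have "closure (span (e ` {1..})) \<subseteq> {z. w \<bullet> z = 0}"
    by (rule closure_minimal) (intro closed_Collect_eq continuous_intros)
  then have "w \<bullet> w = 0" using basis by blast
  then show ?thesis by (simp add: w_def)
qed

lemma norm_sum_square:
  assumes "finite A" "A \<subseteq> {1..}"
  shows "(norm (\<Sum>k\<in>A. c k *\<^sub>R e k))\<^sup>2 = (\<Sum>k\<in>A. (c k)\<^sup>2)"
proof -
  have "(norm (\<Sum>k\<in>A. c k *\<^sub>R e k))\<^sup>2 = (\<Sum>k\<in>A. \<Sum>j\<in>A. (if j = k then c k * c j else 0))"
    unfolding power2_norm_eq_inner inner_sum_left inner_sum_right
    by (intro sum.cong refl) (use assms in \<open>auto simp: orthonormal subset_iff\<close>)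
  also have "\<dots> = (\<Sum>k\<in>A. (c k)\<^sup>2)"
    using assms by (simp add: power2_eq_square)
  finally show ?thesis .
qed

lemma bessel:
  assumes "finite A" "A \<subseteq> {1..}"
  shows "(\<Sum>k\<in>A. (u \<bullet> e k)\<^sup>2) \<le> (norm u)\<^sup>2"
proof -
  define v where "v = (\<Sum>k\<in>A. (u \<bullet> e k) *\<^sub>R e k)"
  have "u \<bullet> v = (\<Sum>k\<in>A. (u \<bullet> e k)\<^sup>2)"
    by (simp add: v_def inner_sum_right power2_eq_square)
  moreover have "v \<bullet> v = (\<Sum>k\<in>A. (u \<bullet> e k)\<^sup>2)"
    using norm_sum_square[OF assms, of "\<lambda>k. u \<bullet> e k"] by (simp add: v_def power2_norm_eq_inner)
  moreover have "0 \<le> (u - v) \<bullet> (u - v)" by simp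
  ultimately show ?thesis
    by (simp add: inner_diff_left inner_diff_right power2_norm_eq_inner inner_commute)
qed

lemma coeff_square_summable: "(\<lambda>k. (u \<bullet> e k)\<^sup>2) summable_on {1..}"
  by (rule nonneg_bounded_partial_sums_imp_summable_on[where C="(norm u)\<^sup>2"])
     (auto intro!: eventually_finite_subsets_at_top_weakI bessel)

text \<open>By orthogonality the squared norm of a block of terms is a block of the scalar series,
  so the Cauchy criterion carries over. The filter of finite subsets appears because
  \<open>infsum\<close> is an unordered sum.\<close>

lemma riesz_fischer:
  assumes "(\<lambda>k. (c k)\<^sup>2) summable_on {1..}"
  shows "(\<lambda>k. c k *\<^sub>R e k) summable_on {1..}"
proof -
  let ?f = "\<lambda>k. c k *\<^sub>R e k"
  let ?A = "{1::nat..}"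
  obtain L where lim: "(sum (\<lambda>k. (c k)\<^sup>2) \<longlongrightarrow> L) (finite_subsets_at_top ?A)"
    using assms unfolding has_sum_def summable_on_def by blast
  have "\<exists>P. eventually P (finite_subsets_at_top ?A) \<and>
              (\<forall>F F'. P F \<and> P F' \<longrightarrow> dist (sum ?f F) (sum ?f F') < r)" if "r > 0" for r
  proof -
    \<comment> \<open>Two sums of squares within \<open>d\<close> of the limit differ by less than
      \<open>2 * d\<close>, which is below the square of \<open>r/2\<close>. The radius
      \<open>r/2\<close> allows passing from \<open>F\<close> to \<open>F'\<close> through
      \<open>F0\<close>.\<close>
    define d where "d = (r/2)\<^sup>2 / 4"
    have d: "d > 0" using that by (simp add: d_def)
    have "eventually (\<lambda>F. dist (sum (\<lambda>k. (c k)\<^sup>2) F) L < d) (finite_subsets_at_top ?A)"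
      using lim d by (auto simp: tendsto_iff)
    then obtain F0 where F0: "finite F0" "F0 \<subseteq> ?A"
      "\<And>F. finite F \<Longrightarrow> F0 \<subseteq> F \<Longrightarrow> F \<subseteq> ?A \<Longrightarrow> dist (sum (\<lambda>k. (c k)\<^sup>2) F) L < d"
      by (auto simp: eventually_finite_subsets_at_top)
    have *: "dist (sum ?f F) (sum ?f F0) < r/2" if "finite F" "F0 \<subseteq> F" "F \<subseteq> ?A" for F
    proof -
      have "(dist (sum ?f F) (sum ?f F0))\<^sup>2 = (norm (sum ?f (F - F0)))\<^sup>2"
        unfolding dist_norm using that by (subst sum_diff) auto
      also have "\<dots> = sum (\<lambda>k. (c k)\<^sup>2) (F - F0)"
        by (rule norm_sum_square) (use that in auto)
      also have "\<dots> = sum (\<lambda>k. (c k)\<^sup>2) F - sum (\<lambda>k. (c k)\<^sup>2) F0"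
        using that by (subst sum_diff) auto
      also have "\<dots> < 2 * d"
        using F0(3)[OF that] F0(3)[OF F0(1) order.refl F0(2)] by (auto simp: dist_real_def)
      also have "\<dots> \<le> (r/2)\<^sup>2" by (simp add: d_def)
      finally show ?thesis by (rule power2_less_imp_less) (use \<open>r > 0\<close> in simp)
    qed
    show ?thesis
    proof (intro exI conjI allI impI)
      show "\<forall>\<^sub>F F in finite_subsets_at_top ?A. finite F \<and> F0 \<subseteq> F \<and> F \<subseteq> ?A"
        using F0 by (auto simp: eventually_finite_subsets_at_top)
      fix F F' assume "(finite F \<and> F0 \<subseteq> F \<and> F \<subseteq> ?A) \<and> (finite F' \<and> F0 \<subseteq> F' \<and> F' \<subseteq> ?A)"
      then have "dist (sum ?f F) (sum ?f F0) < r/2" "dist (sum ?f F') (sum ?f F0) < r/2"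
        using * by auto
      then show "dist (sum ?f F) (sum ?f F') < r"
        by (rule dist_triangle_half_l)
    qed
  qed
  then have "cauchy_filter (filtermap (sum ?f) (finite_subsets_at_top ?A))"
    by (simp add: cauchy_filter_metric_filtermap)
  moreover note complete_UNIV[where 'a='a]
  ultimately obtain L' where "(sum ?f \<longlongrightarrow> L') (finite_subsets_at_top ?A)"
    using complete_uniform[where S=UNIV] by (force simp add: filterlim_def)
  then show ?thesis
    using summable_on_def has_sum_def by blast
qed

lemma infsum_coeff:
  assumes "(\<lambda>k. (c k)\<^sup>2) summable_on {1..}" "j \<ge> 1"
  shows "(\<Sum>\<^sub>\<infinity>k\<in>{1..}. c k *\<^sub>R e k) \<bullet> e j = c j"
proof -
  have "((\<lambda>k. c k *\<^sub>R e k) has_sum (\<Sum>\<^sub>\<infinity>k\<in>{1..}. c k *\<^sub>R e k)) {1..}"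
    using riesz_fischer[OF assms(1)] by simp
  then have "((\<lambda>k. (c k *\<^sub>R e k) \<bullet> e j) has_sum (\<Sum>\<^sub>\<infinity>k\<in>{1..}. c k *\<^sub>R e k) \<bullet> e j) {1..}"
    using has_sum_bounded_linear[OF bounded_linear_inner_left] by fastforce
  then have "(\<Sum>\<^sub>\<infinity>k\<in>{1..}. c k *\<^sub>R e k) \<bullet> e j = (\<Sum>\<^sub>\<infinity>k\<in>{1..}. (c k *\<^sub>R e k) \<bullet> e j)"
    by (simp add: infsumI)
  also have "\<dots> = (\<Sum>\<^sub>\<infinity>k\<in>{j}. (c k *\<^sub>R e k) \<bullet> e j)"
    by (rule infsum_cong_neutral) (use assms in \<open>auto simp: orthonormal\<close>)
  finally show ?thesis using assms by (simp add: orthonormal)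
qed

lemma fourier_has_sum: "((\<lambda>k. (u \<bullet> e k) *\<^sub>R e k) has_sum u) {1..}"
proof -
  have "(\<Sum>\<^sub>\<infinity>k\<in>{1..}. (u \<bullet> e k) *\<^sub>R e k) = u"
    by (rule coeff_ext) (rule infsum_coeff[OF coeff_square_summable])
  then show ?thesis
    using riesz_fischer[OF coeff_square_summable, of u] by (metis has_sum_infsum)
qed

lemma parseval: "((\<lambda>k. (u \<bullet> e k)\<^sup>2) has_sum (norm u)\<^sup>2) {1..}"
proof -
  have "((\<lambda>k. u \<bullet> ((u \<bullet> e k) *\<^sub>R e k)) has_sum u \<bullet> u) {1..}"
    using has_sum_bounded_linear[OF bounded_linear_inner_right fourier_has_sum] by fastforce
  then show ?thesis unfolding power2_norm_eq_inner unfolding power2_eq_square by simp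
qed

lemma norm_le_coeff:
  assumes "\<And>k. k \<ge> 1 \<Longrightarrow> \<bar>u \<bullet> e k\<bar> \<le> B * \<bar>v \<bullet> e k\<bar>" "B \<ge> 0"
  shows "norm u \<le> B * norm v"
proof -
  have "(norm u)\<^sup>2 \<le> (B * norm v)\<^sup>2"
  proof (rule has_sum_mono[OF parseval])
    show "((\<lambda>k. (B * (v \<bullet> e k))\<^sup>2) has_sum (B * norm v)\<^sup>2) {1..}"
      unfolding power_mult_distrib by (intro has_sum_cmult_right parseval)
    fix k :: nat assume "k \<in> {1..}"
    then have "\<bar>u \<bullet> e k\<bar> \<le> \<bar>B * (v \<bullet> e k)\<bar>" using assms(1)[of k] assms(2) by (simp add: abs_mult)
    then show "(u \<bullet> e k)\<^sup>2 \<le> (B * (v \<bullet> e k))\<^sup>2" by (rule abs_le_square_iff[THEN iffD1])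
  qed
  then show ?thesis by (rule power2_le_imp_le) (use assms(2) in simp)
qed

text \<open>Unlike in \<open>spec_fun\<close>, the multiplier is a function of the index, so that
  the cut at \<open>N\<close> made by the projections can be part of it.\<close>

definition diag :: "(nat \<Rightarrow> real) \<Rightarrow> 'a \<Rightarrow> 'a" where
  "diag m u = (\<Sum>\<^sub>\<infinity>k\<in>{1..}. (m k * (u \<bullet> e k)) *\<^sub>R e k)"

lemma spec_fun_eq_diag: "spec_fun e lam g = diag (\<lambda>k. g (lam k))"
  by (simp add: fun_eq_iff spec_fun_def diag_def)

lemma diag_coeff_summable:
  assumes "(\<lambda>k. (m k * (u \<bullet> e k))\<^sup>2) summable_on {1..}" "j \<ge> 1"
  shows "diag m u \<bullet> e j = m j * (u \<bullet> e j)"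
  unfolding diag_def by (rule infsum_coeff[OF assms])

text \<open>The bound is relative to the coefficients of this one \<open>u\<close>, which admits
  unbounded multipliers: \<open>exp (- lam k * t)\<close> with \<open>t < 0\<close> grows with
  \<open>k\<close>, but it acts on vectors whose coefficients beyond \<open>N\<close>
  vanish.\<close>

lemma diag_summable:
  assumes "\<And>k. k \<ge> 1 \<Longrightarrow> \<bar>m k * (u \<bullet> e k)\<bar> \<le> B * \<bar>u \<bullet> e k\<bar>"
  shows "(\<lambda>k. (m k * (u \<bullet> e k))\<^sup>2) summable_on {1..}"
proof (rule summable_on_comparison_test)
  show "(\<lambda>k. B\<^sup>2 * (u \<bullet> e k)\<^sup>2) summable_on {1..}"
    by (intro summable_on_cmult_right coeff_square_summable)
  fix k :: nat assume "k \<in> {1..}"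
  then have "\<bar>m k * (u \<bullet> e k)\<bar> \<le> B * \<bar>u \<bullet> e k\<bar>" using assms by auto
  also have "\<dots> \<le> \<bar>B * (u \<bullet> e k)\<bar>" by (simp add: abs_mult mult_right_mono)
  finally have "(m k * (u \<bullet> e k))\<^sup>2 \<le> (B * (u \<bullet> e k))\<^sup>2" by (rule abs_le_square_iff[THEN iffD1])
  then show "(m k * (u \<bullet> e k))\<^sup>2 \<le> B\<^sup>2 * (u \<bullet> e k)\<^sup>2" by (simp add: power_mult_distrib)
qed auto

lemma diag_coeff_bounded:
  assumes "\<And>k. k \<ge> 1 \<Longrightarrow> \<bar>m k\<bar> \<le> B" "j \<ge> 1"
  shows "diag m u \<bullet> e j = m j * (u \<bullet> e j)"
  by (rule diag_coeff_summable[OF diag_summable assms(2)])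
     (auto simp: abs_mult intro!: mult_right_mono assms(1))

lemma diag_norm_le:
  assumes "\<And>k. k \<ge> 1 \<Longrightarrow> \<bar>m k\<bar> \<le> B"
  shows "norm (diag m u) \<le> B * norm u"
proof (rule norm_le_coeff)
  show "\<bar>diag m u \<bullet> e k\<bar> \<le> B * \<bar>u \<bullet> e k\<bar>" if "k \<ge> 1" for k
    using assms[OF that] by (simp add: diag_coeff_bounded[OF assms that] abs_mult mult_right_mono)
  show "B \<ge> 0" using assms[of 1] by simp
qed

lemma diag_bounded_linear:
  assumes "\<And>k. k \<ge> 1 \<Longrightarrow> \<bar>m k\<bar> \<le> B"
  shows "bounded_linear (diag m)"
proof (rule bounded_linear_intro[where K=B])
  show "diag m (x + y) = diag m x + diag m y" for x y
    by (rule coeff_ext) (simp add: diag_coeff_bounded[OF assms] inner_add_left algebra_simps)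
  show "diag m (r *\<^sub>R x) = r *\<^sub>R diag m x" for r x
    by (rule coeff_ext) (simp add: diag_coeff_bounded[OF assms] inner_add_left algebra_simps)
  show "norm (diag m x) \<le> norm x * B" for x
    using diag_norm_le[OF assms] by (simp add: mult.commute)
qed

lemma proj_P_coeff: "k \<ge> 1 \<Longrightarrow> proj_P e N u \<bullet> e k = (if k \<le> N then u \<bullet> e k else 0)"
proof -
  assume k: "k \<ge> 1"
  have "proj_P e N u \<bullet> e k = (\<Sum>j=1..N. if k = j then u \<bullet> e j else 0)"
    unfolding proj_P_def inner_sum_left by (intro sum.cong) (use k in \<open>auto simp: orthonormal\<close>)
  also have "\<dots> = (if k \<le> N then u \<bullet> e k else 0)" using k by (subst sum.delta') auto
  finally show ?thesis .
qed

lemma proj_Q_coeff: "k \<ge> 1 \<Longrightarrow> proj_Q e N u \<bullet> e k = (if k \<le> N then 0 else u \<bullet> e k)"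
  by (simp add: proj_Q_def inner_diff_left proj_P_coeff)

lemma borel_measurable_coeff:
  fixes f :: "'b \<Rightarrow> 'a"
  assumes "\<And>k. k \<ge> 1 \<Longrightarrow> (\<lambda>x. f x \<bullet> e k) \<in> borel_measurable M"
  shows "f \<in> borel_measurable M"
proof (rule borel_measurable_LIMSEQ_metric)
  show "(\<lambda>x. \<Sum>k\<in>{1..n}. (f x \<bullet> e k) *\<^sub>R e k) \<in> borel_measurable M" for n
    by (intro borel_measurable_sum borel_measurable_scaleR borel_measurable_const assms) auto
  show "(\<lambda>n. \<Sum>k\<in>{1..n}. (f x \<bullet> e k) *\<^sub>R e k) \<longlonglongrightarrow> f x" for x
  proof -
    \<comment> \<open>The sets \<open>{1..n}\<close> are cofinal among the finite subsets, so the
      unordered sum is also the limit of a sequence of measurable functions.\<close>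
    have "filterlim (\<lambda>n::nat. {1..n}) (finite_subsets_at_top {1..}) sequentially"
      unfolding filterlim_finite_subsets_at_top
    proof safe
      fix X :: "nat set" assume X: "finite X" "X \<subseteq> {1..}"
      then obtain m where "\<forall>x\<in>X. x \<le> m" by (meson finite_nat_set_iff_bounded_le)
      then have "finite {1..n} \<and> X \<subseteq> {1..n} \<and> {1..n} \<subseteq> {1..}" if "n \<ge> m" for n
        using that X(2) by fastforce
      then show "\<forall>\<^sub>F n in sequentially. finite {1..n} \<and> X \<subseteq> {1..n} \<and> {1..n} \<subseteq> {1..}"
        unfolding eventually_sequentially by blast
    qed
    with fourier_has_sum[of "f x"] show ?thesis
      unfolding has_sum_def by (rule filterlim_compose)
  qed
qed

end

section \<open>The Lyapunov-Perron kernel\<close>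

text \<open>Write the left side as \<open>(a + d) * (a + d) powr (\<sigma> - 1)\<close>: the
  exponent \<open>\<sigma> - 1\<close> is negative, so shrinking its base to \<open>a\<close> or to
  \<open>d\<close> only enlarges each summand. This separates \<open>lam (N + 1)\<close> from the
  excess of a higher eigenvalue.\<close>

lemma powr_add_le_real:
  fixes a d \<sigma> :: real
  assumes "0 < a" "0 \<le> d" "0 \<le> \<sigma>" "\<sigma> < 1"
  shows "(a + d) powr \<sigma> \<le> a powr \<sigma> + d powr \<sigma>"
proof (cases "d = 0")
  case False
  have *: "x * (a + d) powr (\<sigma> - 1) \<le> x powr \<sigma>" if "x = a \<or> x = d" for x
  proof -
    have x: "x > 0" "x \<le> a + d" using that assms False by auto
    have "x * (a + d) powr (\<sigma> - 1) \<le> x * x powr (\<sigma> - 1)"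
      using x assms by (intro mult_left_mono powr_mono2') auto
    also have "\<dots> = x powr \<sigma>" using x by (simp add: powr_diff)
    finally show ?thesis .
  qed
  have "(a + d) powr \<sigma> = a * (a + d) powr (\<sigma> - 1) + d * (a + d) powr (\<sigma> - 1)"
    using assms powr_mult_base[of "a + d" "\<sigma> - 1"] by (simp add: distrib_right)
  then show ?thesis using *[of a] *[of d] by simp
qed (use assms in auto)

text \<open>The factor \<open>\<sigma> powr \<sigma>\<close> of the gap condition originates here,
  from y \<le> exp y at y = \<open>d * \<tau> / \<sigma>\<close>, raised to the power
  \<open>\<sigma>\<close>. As \<open>0 powr 0\<close> is 0 in HOL, the convention for
  \<open>\<sigma> = 0\<close> needs its own branch.\<close>

lemma powr_mult_exp_le:
  fixes d \<tau> \<sigma> :: real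
  assumes "0 \<le> d" "0 < \<tau>" "0 \<le> \<sigma>"
  shows "d powr \<sigma> * exp (- (d * \<tau>)) \<le> (if \<sigma> = 0 then 1 else \<sigma> powr \<sigma>) * \<tau> powr (- \<sigma>)"
proof (cases "\<sigma> = 0 \<or> d = 0")
  case True
  have "d powr 0 * exp (- (d * \<tau>)) \<le> 1 * 1" using assms by (intro mult_mono) auto
  then show ?thesis using True assms by auto
next
  case False
  then have p: "\<sigma> > 0" "d > 0" using assms by auto
  have "d * \<tau> / \<sigma> \<le> exp (d * \<tau> / \<sigma>)" by (smt (verit) exp_ge_add_one_self)
  then have "(d * \<tau> / \<sigma>) powr \<sigma> \<le> exp (d * \<tau> / \<sigma>) powr \<sigma>"
    using p assms by (intro powr_mono2) auto
  also have "\<dots> = exp (d * \<tau>)" using p by (simp add: powr_def)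
  finally have "d powr \<sigma> * \<tau> powr \<sigma> / \<sigma> powr \<sigma> \<le> exp (d * \<tau>)"
    using p assms by (simp add: powr_mult powr_divide)
  then show ?thesis using p assms
    by (simp add: exp_minus powr_minus field_simps)
qed

text \<open>A rescaled Gamma integral. Working with the nonnegative integral makes integrability of
  the kernel bound a consequence of the computation of its mass.\<close>

lemma nn_integral_powr_exp:
  fixes s a :: real
  assumes "s > 0" "a > 0"
  shows "(\<integral>\<^sup>+t. ennreal (indicator {0<..} t * (t powr (s - 1) * exp (- a * t))) \<partial>lborel)
           = ennreal (Gamma s * a powr (- s))"
proof -
  have "ennreal (Gamma s) = (\<integral>\<^sup>+t. ennreal (indicator {0..} t * t powr (s - 1) / exp t) \<partial>lborel)"
    by (rule Gamma_conv_nn_integral_real[OF assms(1)])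
  also have "\<dots> = (\<integral>\<^sup>+t. ennreal (indicator {0<..} t * t powr (s - 1) / exp t) \<partial>lborel)"
    by (rule nn_integral_cong_AE, use AE_lborel_singleton[of 0] in eventually_elim) (auto simp: indicator_def)
  also have "\<dots> = \<bar>a\<bar> * (\<integral>\<^sup>+t. ennreal (indicator {0<..} (0 + a * t) * (0 + a * t) powr (s - 1) / exp (0 + a * t)) \<partial>lborel)"
    by (rule nn_integral_real_affine) (use assms in auto)
  also have "(\<integral>\<^sup>+t. ennreal (indicator {0<..} (0 + a * t) * (0 + a * t) powr (s - 1) / exp (0 + a * t)) \<partial>lborel)
     = (\<integral>\<^sup>+t. ennreal (a powr (s - 1)) * ennreal (indicator {0<..} t * (t powr (s - 1) * exp (- a * t))) \<partial>lborel)"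
    by (intro nn_integral_cong)
       (use assms in \<open>auto simp: indicator_def powr_mult zero_less_mult_iff exp_minus divide_inverse ennreal_mult' mult.assoc\<close>)
  also have "\<bar>a\<bar> * \<dots> = ennreal (a powr s) * (\<integral>\<^sup>+t. ennreal (indicator {0<..} t * (t powr (s - 1) * exp (- a * t))) \<partial>lborel)"
    using assms by (subst nn_integral_cmult) (auto simp: powr_diff mult.assoc[symmetric] ennreal_mult'[symmetric])
  finally have *: "ennreal (Gamma s) = ennreal (a powr s) * (\<integral>\<^sup>+t. ennreal (indicator {0<..} t * (t powr (s - 1) * exp (- a * t))) \<partial>lborel)" .
  have "ennreal (Gamma s * a powr (- s)) = ennreal (a powr (- s)) * ennreal (Gamma s)"
    by (subst mult.commute) (simp add: ennreal_mult')
  also have "\<dots> = ennreal (a powr (- s) * a powr s) * (\<integral>\<^sup>+t. ennreal (indicator {0<..} t * (t powr (s - 1) * exp (- a * t))) \<partial>lborel)"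
    unfolding * by (simp add: ennreal_mult' mult.assoc)
  finally show ?thesis using assms by (simp add: powr_minus)
qed

locale inertial_gap = orthonormal_basis e
  for e :: "nat \<Rightarrow> 'a::{real_inner, banach, second_countable_topology}" +
  fixes lam :: "nat \<Rightarrow> real" and \<sigma> L \<mu> \<beta> :: real and N :: nat
  assumes lam_1: "0 < lam 1"
    and lam_Suc: "\<And>k. k \<ge> 1 \<Longrightarrow> lam k \<le> lam (Suc k)"
    and sigma: "0 \<le> \<sigma>" "\<sigma> < 1"
    and L_pos: "L > 0"
    and N: "N \<ge> 1" "lam N < lam (N + 1)"
    and mu: "0 < \<mu>" "\<mu> < 1"
    and gap: "lam (N + 1) - lam N \<ge>
           2 * L / \<mu> * (lam N powr \<sigma>
             + (if \<sigma> = 0 then 1 else \<sigma> powr \<sigma>) * Gamma (1 - \<sigma>) * (lam (N + 1) - lam N) powr \<sigma>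
             + lam (N + 1) powr \<sigma>)"
    and beta: "\<beta> = lam N + 2 / \<mu> * L * lam N powr \<sigma>"
begin

lemma lam_mono:
  assumes "1 \<le> j" "j \<le> k"
  shows "lam j \<le> lam k"
  using assms(2,1)
proof (induction rule: dec_induct)
  case (step n) then show ?case using lam_Suc[of n] by linarith
qed simp

lemma lam_pos: "1 \<le> k \<Longrightarrow> 0 < lam k"
  using lam_mono[of 1 k] lam_1 by linarith

abbreviation "sig \<equiv> (if \<sigma> = 0 then 1 else \<sigma> powr \<sigma>)"

text \<open>The distances from \<open>\<beta>\<close> to the two ends of the spectral gap. They are
  the exponential rates at which the kernel decays in negative and in positive time.\<close>

definition "gap_lo = \<beta> - lam N"
definition "gap_hi = lam (N + 1) - \<beta>"

text \<open>The second equation is the purpose of the value of \<open>\<beta>\<close>: the modes up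
  to \<open>N\<close> contribute exactly half of \<open>\<mu>\<close> to the contraction
  constant.\<close>

lemma gap_lo: "gap_lo > 0" "L * lam N powr \<sigma> / gap_lo = \<mu> / 2"
proof -
  have "gap_lo = 2 / \<mu> * L * lam N powr \<sigma>"
    unfolding gap_lo_def unfolding beta by simp
  then show "gap_lo > 0" "L * lam N powr \<sigma> / gap_lo = \<mu> / 2"
    using mu L_pos lam_pos[of N] N by simp_all
qed

lemma sig_Gamma_pos: "sig * Gamma (1 - \<sigma>) > 0"
  using sigma by (auto intro!: mult_pos_pos Gamma_real_pos)

text \<open>What the gap condition leaves above \<open>\<beta>\<close> once its term with
  \<open>lam N\<close> has been spent on the position of \<open>\<beta>\<close>.\<close>

lemma gap_hi_ge:
  "gap_hi \<ge> 2 * L / \<mu> * (sig * Gamma (1 - \<sigma>) * (lam (N + 1) - lam N) powr \<sigma> + lam (N + 1) powr \<sigma>)"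
proof -
  have "gap_hi = lam (N + 1) - lam N - 2 / \<mu> * L * lam N powr \<sigma>"
    unfolding gap_hi_def unfolding beta by simp
  then show ?thesis using gap by (simp add: distrib_left)
qed

lemma gap_hi: "gap_hi > 0" "gap_hi \<le> lam (N + 1) - lam N"
proof -
  have "2 * L / \<mu> * (sig * Gamma (1 - \<sigma>) * (lam (N + 1) - lam N) powr \<sigma> + lam (N + 1) powr \<sigma>) > 0"
    using mu L_pos lam_pos[of "N + 1"] N sig_Gamma_pos
    by (intro mult_pos_pos add_nonneg_pos divide_pos_pos mult_nonneg_nonneg[of "_ * _"]) (auto intro: less_imp_le)
  then show "gap_hi > 0" using gap_hi_ge by linarith
  show "gap_hi \<le> lam (N + 1) - lam N" using gap_lo by (simp add: gap_hi_def gap_lo_def)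
qed

text \<open>Symbol of the Green function of d/dt + A - \<beta> on the line, composed with the power
  \<open>\<sigma>\<close> of A. Modes above \<open>\<beta>\<close> are integrated from the past and
  modes below it from the future. These are the two nonzero cases, the future one with a minus sign;
  \<open>\<tau> = 0\<close> counts as future.\<close>

definition green_symb :: "real \<Rightarrow> nat \<Rightarrow> real" where
  "green_symb \<tau> k = (if (0 < \<tau>) = (k \<le> N) then 0
     else (if 0 < \<tau> then 1 else - 1) * (lam k powr \<sigma> * exp (- ((lam k - \<beta>) * \<tau>))))"

definition gbound :: "real \<Rightarrow> real" where
  "gbound \<tau> = (if 0 < \<tau> then (sig * \<tau> powr (- \<sigma>) + lam (N + 1) powr \<sigma>) * exp (- (gap_hi * \<tau>))
            else lam N powr \<sigma> * exp (gap_lo * \<tau>))"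

lemma gbound_nonneg: "0 \<le> gbound \<tau>"
  by (auto simp: gbound_def intro!: mult_nonneg_nonneg add_nonneg_nonneg)

text \<open>For \<open>\<tau> > 0\<close> the exponential of the excess \<open>d\<close> of
  \<open>lam k\<close> over \<open>lam (N + 1)\<close> absorbs the power of \<open>d\<close> at the
  price \<open>\<tau> powr (- \<sigma>)\<close>, which is uniform in \<open>k\<close> and integrable
  at 0 since \<open>\<sigma> < 1\<close>. For \<open>\<tau> \<le> 0\<close> the index
  \<open>N\<close> is the worst one.\<close>

lemma green_symb_le:
  assumes k: "k \<ge> 1"
  shows "\<bar>green_symb \<tau> k\<bar> \<le> gbound \<tau>"
proof (cases "(0 < \<tau>) = (k \<le> N)")
  case True then show ?thesis by (simp add: green_symb_def gbound_nonneg)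
next
  case F: False
  show ?thesis
  proof (cases "0 < \<tau>")
    case True
    then have kN: "N + 1 \<le> k" using F by auto
    define d where "d = lam k - lam (N + 1)"
    have d: "d \<ge> 0" using lam_mono[OF _ kN] by (simp add: d_def)
    have lk: "lam k = lam (N + 1) + d" by (simp add: d_def)
    have "exp (- ((lam k - \<beta>) * \<tau>)) = exp (- (d * \<tau>)) * exp (- (gap_hi * \<tau>))"
      by (simp add: lk gap_hi_def exp_add[symmetric] algebra_simps)
    then have "\<bar>green_symb \<tau> k\<bar> = lam k powr \<sigma> * exp (- (d * \<tau>)) * exp (- (gap_hi * \<tau>))"
      using F True by (simp add: green_symb_def abs_mult)
    also have "\<dots> \<le> (sig * \<tau> powr (- \<sigma>) + lam (N + 1) powr \<sigma>) * exp (- (gap_hi * \<tau>))"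
    proof (rule mult_right_mono)
      have "lam k powr \<sigma> * exp (- (d * \<tau>)) \<le> (lam (N + 1) powr \<sigma> + d powr \<sigma>) * exp (- (d * \<tau>))"
        unfolding lk using sigma d lam_pos[of "N + 1"] by (intro mult_right_mono powr_add_le_real) auto
      also have "\<dots> \<le> lam (N + 1) powr \<sigma> * 1 + d powr \<sigma> * exp (- (d * \<tau>))"
        unfolding distrib_right using d True by (intro add_mono mult_left_mono) auto
      finally show "lam k powr \<sigma> * exp (- (d * \<tau>)) \<le> sig * \<tau> powr (- \<sigma>) + lam (N + 1) powr \<sigma>"
        using powr_mult_exp_le[OF d True sigma(1)] by linarith
    qed auto
    finally show ?thesis using True by (simp add: gbound_def)
  next
    case False
    then have kN: "k \<le> N" using F by auto
    have "\<bar>green_symb \<tau> k\<bar> = lam k powr \<sigma> * exp ((\<beta> - lam k) * \<tau>)"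
      using F False by (auto simp: green_symb_def abs_mult algebra_simps)
    also have "\<dots> \<le> lam N powr \<sigma> * exp (gap_lo * \<tau>)"
      using lam_mono[OF k kN] lam_pos[OF k] sigma False
      by (intro mult_mono powr_mono2) (auto simp: gap_lo_def intro!: mult_right_mono_neg)
    finally show ?thesis using False by (simp add: gbound_def)
  qed
qed

section \<open>Mass of the kernel bound and the contraction constant\<close>

lemma gbound_measurable [measurable]: "gbound \<in> borel_measurable borel"
  unfolding gbound_def[abs_def] by measurable

lemma nn_integral_gbound: "(\<integral>\<^sup>+\<tau>. ennreal (gbound \<tau>) \<partial>lborel) \<le> ennreal (\<mu> / L)"
proof -
  let ?E = "\<lambda>s a t. ennreal (indicator {0<..} t * (t powr (s - 1) * exp (- a * t)))"
  have "(\<integral>\<^sup>+\<tau>. ennreal (gbound \<tau>) \<partial>lborel) =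
     (\<integral>\<^sup>+\<tau>. ennreal sig * ?E (1 - \<sigma>) gap_hi \<tau> + ennreal (lam (N + 1) powr \<sigma>) * ?E 1 gap_hi \<tau>
        + ennreal (lam N powr \<sigma>) * ?E 1 gap_lo (- \<tau>) \<partial>lborel)"
  \<comment> \<open>At \<open>\<tau> = 0\<close> the three indicators vanish while
    \<open>gbound\<close> does not, so this point is discarded as a null set.\<close>
  proof (rule nn_integral_cong_AE, use AE_lborel_singleton[of 0] in eventually_elim)
    case (elim \<tau>)
    then show ?case
      by (auto simp: gbound_def ennreal_mult'[symmetric] ennreal_plus[symmetric] distrib_right mult.assoc
               simp del: ennreal_plus)
  qed
  also have "\<dots> = ennreal sig * (\<integral>\<^sup>+\<tau>. ?E (1 - \<sigma>) gap_hi \<tau> \<partial>lborel)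
      + ennreal (lam (N + 1) powr \<sigma>) * (\<integral>\<^sup>+\<tau>. ?E 1 gap_hi \<tau> \<partial>lborel)
      + ennreal (lam N powr \<sigma>) * (\<integral>\<^sup>+\<tau>. ?E 1 gap_lo (- \<tau>) \<partial>lborel)"
    by (simp add: nn_integral_add nn_integral_cmult)
  also have "(\<integral>\<^sup>+\<tau>. ?E 1 gap_lo (- \<tau>) \<partial>lborel) = (\<integral>\<^sup>+\<tau>. ?E 1 gap_lo \<tau> \<partial>lborel)"
    by (subst (2) nn_integral_real_affine[where c="- 1" and t=0]) auto
  also have "ennreal sig * (\<integral>\<^sup>+\<tau>. ?E (1 - \<sigma>) gap_hi \<tau> \<partial>lborel)
      + ennreal (lam (N + 1) powr \<sigma>) * (\<integral>\<^sup>+\<tau>. ?E 1 gap_hi \<tau> \<partial>lborel)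
      + ennreal (lam N powr \<sigma>) * (\<integral>\<^sup>+\<tau>. ?E 1 gap_lo \<tau> \<partial>lborel)
      = ennreal (sig * (Gamma (1 - \<sigma>) * gap_hi powr (- (1 - \<sigma>))))
       + ennreal (lam (N + 1) powr \<sigma> * (1 / gap_hi))
      + ennreal (lam N powr \<sigma> * (1 / gap_lo))"
    using sigma gap_hi(1) gap_lo(1)
    by (subst (1 2 3) nn_integral_powr_exp) (auto simp: ennreal_mult'[symmetric] powr_minus divide_inverse)
  also have "\<dots> = ennreal (sig * (Gamma (1 - \<sigma>) * gap_hi powr (- (1 - \<sigma>)))
       + lam (N + 1) powr \<sigma> * (1 / gap_hi) + lam N powr \<sigma> * (1 / gap_lo))"
    using sigma gap_hi(1) gap_lo(1) Gamma_real_pos[of "1 - \<sigma>"]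
    by (subst ennreal_plus[symmetric]) (auto intro!: add_nonneg_nonneg mult_nonneg_nonneg simp: ennreal_plus[symmetric] simp del: ennreal_plus)
  also have "\<dots> \<le> ennreal (\<mu> / L)"
  proof (rule ennreal_leI)
    have e1: "lam N powr \<sigma> * (1 / gap_lo) = \<mu> / L / 2"
      using gap_lo L_pos by (simp add: field_simps)
    let ?D = "lam (N + 1) - lam N"
    have "sig * (Gamma (1 - \<sigma>) * gap_hi powr (- (1 - \<sigma>))) + lam (N + 1) powr \<sigma> * (1 / gap_hi)
       = (sig * Gamma (1 - \<sigma>) * gap_hi powr \<sigma> + lam (N + 1) powr \<sigma>) / gap_hi"
      using gap_hi(1) by (simp add: powr_diff field_simps)
    \<comment> \<open>Only the power in the numerator is enlarged from \<open>gap_hi\<close> to the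
      full gap, the form in which it enters the gap condition; the denominator stays
      \<open>gap_hi\<close>.\<close>
    also have "\<dots> \<le> (sig * Gamma (1 - \<sigma>) * ?D powr \<sigma> + lam (N + 1) powr \<sigma>) / gap_hi"
      using gap_hi sigma sig_Gamma_pos
      by (intro divide_right_mono add_right_mono mult_left_mono powr_mono2) auto
    also have "\<dots> \<le> \<mu> / L / 2"
      using gap_hi_ge gap_hi(1) mu L_pos by (simp add: field_simps)
    finally show "sig * (Gamma (1 - \<sigma>) * gap_hi powr (- (1 - \<sigma>)))
       + lam (N + 1) powr \<sigma> * (1 / gap_hi) + lam N powr \<sigma> * (1 / gap_lo) \<le> \<mu> / L"
      using e1 by simp
  qed
  finally show ?thesis .
qed

lemma gbound_integrable: "integrable lborel gbound"
proof (rule integrableI_bounded)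
  have "(\<integral>\<^sup>+\<tau>. ennreal (norm (gbound \<tau>)) \<partial>lborel) \<le> ennreal (\<mu> / L)"
    using nn_integral_gbound gbound_nonneg by simp
  then show "(\<integral>\<^sup>+\<tau>. ennreal (norm (gbound \<tau>)) \<partial>lborel) < \<infinity>"
    by (simp add: order_le_less_trans)
qed simp

text \<open>\<open>L\<close> is the Lipschitz constant of the nonlinearity at each time, so this
  product bounds the Lipschitz constant of the integral operator in the supremum norm.\<close>

lemma integral_gbound: "L * (LBINT \<tau>. gbound \<tau>) \<le> \<mu>"
proof -
  have "ennreal (LBINT \<tau>. gbound \<tau>) \<le> ennreal (\<mu> / L)"
    using nn_integral_gbound nn_integral_eq_integral[OF gbound_integrable] gbound_nonneg by simp
  then have "(LBINT \<tau>. gbound \<tau>) \<le> \<mu> / L"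
    using mu L_pos by (simp add: ennreal_le_iff)
  then show ?thesis using L_pos by (simp add: field_simps)
qed

section \<open>Convolution with the Green function\<close>

definition green :: "real \<Rightarrow> 'a \<Rightarrow> 'a" where "green \<tau> = diag (green_symb \<tau>)"

lemma green_coeff: "k \<ge> 1 \<Longrightarrow> green \<tau> v \<bullet> e k = green_symb \<tau> k * (v \<bullet> e k)"
  unfolding green_def by (rule diag_coeff_bounded[OF green_symb_le])

lemma green_norm: "norm (green \<tau> v) \<le> gbound \<tau> * norm v"
  unfolding green_def by (rule diag_norm_le[OF green_symb_le])

lemma green_linear: "bounded_linear (green \<tau>)"
  unfolding green_def by (rule diag_bounded_linear[OF green_symb_le])

lemma green_measurable:
  assumes [measurable]: "g \<in> borel_measurable borel"
  shows "(\<lambda>\<tau>. green \<tau> (g (t - \<tau>))) \<in> borel_measurable borel"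
proof (rule borel_measurable_coeff)
  fix k :: nat assume k: "k \<ge> 1"
  have "(\<lambda>\<tau>. green_symb \<tau> k) \<in> borel_measurable borel"
    unfolding green_symb_def by measurable
  then show "(\<lambda>\<tau>. green \<tau> (g (t - \<tau>)) \<bullet> e k) \<in> borel_measurable borel"
    using k by (simp add: green_coeff) measurable
qed

text \<open>The time \<open>t\<close> is placed in the argument of \<open>g\<close> and not in the
  kernel. Continuity in \<open>t\<close> then follows by dominated convergence with a multiple of
  \<open>gbound\<close> as the single majorant, although the kernel jumps at 0.\<close>

definition gconv :: "(real \<Rightarrow> 'a) \<Rightarrow> real \<Rightarrow> 'a" where
  "gconv g t = (LBINT \<tau>. green \<tau> (g (t - \<tau>)))"

lemma gbound_mult_integrable:
  fixes f :: "real \<Rightarrow> real"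
  assumes [measurable]: "f \<in> borel_measurable borel" and f: "\<And>s. \<bar>f s\<bar> \<le> B"
  shows "integrable lborel (\<lambda>\<tau>. gbound \<tau> * f (t - \<tau>))"
proof (rule Bochner_Integration.integrable_bound)
  show "integrable lborel (\<lambda>\<tau>. gbound \<tau> * B)" using gbound_integrable by simp
  have "\<bar>f s\<bar> \<le> \<bar>B\<bar>" for s using f[of s] by linarith
  then show "AE \<tau> in lborel. norm (gbound \<tau> * f (t - \<tau>)) \<le> norm (gbound \<tau> * B)"
    by (auto simp: abs_mult intro!: mult_left_mono)
qed measurable

lemma
  assumes g [measurable]: "g \<in> borel_measurable borel" and bdd: "bounded (range g)"
  shows gconv_integrable: "integrable lborel (\<lambda>\<tau>. green \<tau> (g (t - \<tau>)))"
    and gbound_norm_integrable: "integrable lborel (\<lambda>\<tau>. gbound \<tau> * norm (g (t - \<tau>)))"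
    and gconv_norm_le: "norm (gconv g t) \<le> (LBINT \<tau>. gbound \<tau> * norm (g (t - \<tau>)))"
proof -
  obtain B where "\<And>s. norm (g s) \<le> B" using bdd by (auto simp: bounded_iff)
  then show 1: "integrable lborel (\<lambda>\<tau>. gbound \<tau> * norm (g (t - \<tau>)))"
    by (intro gbound_mult_integrable[where B=B]) auto
  show 2: "integrable lborel (\<lambda>\<tau>. green \<tau> (g (t - \<tau>)))"
  proof (rule Bochner_Integration.integrable_bound[OF 1])
    show "AE \<tau> in lborel. norm (green \<tau> (g (t - \<tau>))) \<le> norm (gbound \<tau> * norm (g (t - \<tau>)))"
      using green_norm gbound_nonneg by (simp add: abs_mult)
  qed (use green_measurable[OF g] in simp)
  show "norm (gconv g t) \<le> (LBINT \<tau>. gbound \<tau> * norm (g (t - \<tau>)))"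
    unfolding gconv_def by (rule Bochner_Integration.integral_norm_bound_integral[OF 2 1 green_norm])
qed

lemma isCont_gconv:
  assumes g: "g \<in> borel_measurable borel" "bounded (range g)"
    and D: "countable D" "\<And>s. s \<notin> D \<Longrightarrow> isCont g s"
  shows "isCont (gconv g) t"
proof -
  obtain B where B: "\<And>s. norm (g s) \<le> B" using g(2) by (auto simp: bounded_iff)
  \<comment> \<open>The exceptional set, reflected and translated, is still countable and hence
    null, so the jumps of \<open>g\<close> are averaged out.\<close>
  have ae: "AE \<tau> in lborel. t - \<tau> \<notin> D"
  proof -
    have "countable ((\<lambda>d. t - d) ` D)" using D by simp
    then have "AE \<tau> in lborel. \<tau> \<notin> (\<lambda>d. t - d) ` D"
      by (intro AE_not_in countable_imp_null_set_lborel)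
    then show ?thesis by eventually_elim force
  qed
  show ?thesis unfolding continuous_at_sequentially
  proof (intro allI impI)
    fix X :: "nat \<Rightarrow> real" assume X: "X \<longlonglongrightarrow> t"
    show "(gconv g \<circ> X) \<longlonglongrightarrow> gconv g t"
      unfolding gconv_def comp_def
    proof (rule integral_dominated_convergence[where w="\<lambda>\<tau>. gbound \<tau> * B"])
      show "AE \<tau> in lborel. (\<lambda>i. green \<tau> (g (X i - \<tau>))) \<longlonglongrightarrow> green \<tau> (g (t - \<tau>))"
        using ae
      proof eventually_elim
        case (elim \<tau>)
        have "(\<lambda>i. X i - \<tau>) \<longlonglongrightarrow> t - \<tau>" by (intro tendsto_intros X)
        from isCont_tendsto_compose[OF D(2)[OF elim] this]
        show ?case by (rule bounded_linear.tendsto[OF green_linear])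
      qed
      show "AE \<tau> in lborel. norm (green \<tau> (g (X i - \<tau>))) \<le> gbound \<tau> * B" for i
        using mult_left_mono[OF B gbound_nonneg] green_norm by (meson AE_I2 order_trans)
      show "integrable lborel (\<lambda>\<tau>. gbound \<tau> * B)" using gbound_integrable by simp
    qed (use green_measurable[OF g(1)] in auto)
  qed
qed

end

section \<open>The Lyapunov-Perron equation\<close>

context inertial_gap
begin

text \<open>The contribution of the initial value, with the projection built in. As a finite sum it
  is continuous on the whole line, and for \<open>t \<le> 0\<close> it does not increase the norm
  because \<open>\<beta>\<close> exceeds the eigenvalues involved.\<close>

definition lin_flow :: "real \<Rightarrow> 'a \<Rightarrow> 'a" where
  "lin_flow t \<xi> = (\<Sum>k=1..N. (exp (- ((lam k - \<beta>) * t)) * (\<xi> \<bullet> e k)) *\<^sub>R e k)"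

lemma lin_flow_coeff:
  assumes "k \<ge> 1"
  shows "lin_flow t \<xi> \<bullet> e k = (if k \<le> N then exp (- ((lam k - \<beta>) * t)) * (\<xi> \<bullet> e k) else 0)"
proof -
  have "lin_flow t \<xi> \<bullet> e k = (\<Sum>j=1..N. if k = j then exp (- ((lam j - \<beta>) * t)) * (\<xi> \<bullet> e j) else 0)"
    unfolding lin_flow_def inner_sum_left by (intro sum.cong) (use assms in \<open>auto simp: orthonormal\<close>)
  also have "\<dots> = (if k \<le> N then exp (- ((lam k - \<beta>) * t)) * (\<xi> \<bullet> e k) else 0)"
    using assms by (subst sum.delta') auto
  finally show ?thesis .
qed

lemma lam_less_beta: "1 \<le> k \<Longrightarrow> k \<le> N \<Longrightarrow> lam k < \<beta>"
  using lam_mono[of k N] gap_lo(1) by (simp add: gap_lo_def)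

lemma lin_flow_norm:
  assumes "t \<le> 0"
  shows "norm (lin_flow t \<xi>) \<le> norm \<xi>"
proof -
  have "norm (lin_flow t \<xi>) \<le> 1 * norm \<xi>"
  proof (rule norm_le_coeff)
    fix k :: nat assume k: "k \<ge> 1"
    have "exp (- ((lam k - \<beta>) * t)) * \<bar>\<xi> \<bullet> e k\<bar> \<le> 1 * \<bar>\<xi> \<bullet> e k\<bar>" if "k \<le> N"
      using lam_less_beta[OF k that] assms by (intro mult_right_mono) (auto simp: mult_nonpos_nonpos)
    then show "\<bar>lin_flow t \<xi> \<bullet> e k\<bar> \<le> 1 * \<bar>\<xi> \<bullet> e k\<bar>"
      using k by (simp add: lin_flow_coeff abs_mult)
  qed simp
  then show ?thesis by simp
qed

lemma lin_flow_lincomb: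
  "lin_flow t (a *\<^sub>R \<xi> + b *\<^sub>R \<eta>) = a *\<^sub>R lin_flow t \<xi> + b *\<^sub>R lin_flow t \<eta>"
  by (rule coeff_ext) (simp add: lin_flow_coeff inner_add_left algebra_simps)

lemma lin_flow_diff: "lin_flow t (\<xi> - \<eta>) = lin_flow t \<xi> - lin_flow t \<eta>"
  using lin_flow_lincomb[of t 1 \<xi> "- 1" \<eta>] by simp

lemma continuous_lin_flow: "continuous_on UNIV (\<lambda>t. lin_flow t \<xi>)"
  unfolding lin_flow_def by (intro continuous_intros)

text \<open>An abstract right-hand side, so that the nonlinear equation and its linearization share
  one theory of existence, uniqueness and stability. The countable exceptional set, common to all
  \<open>u\<close>, accommodates the jumps of a time-changed path.\<close>

definition admissible :: "(real \<Rightarrow> 'a \<Rightarrow> 'a) \<Rightarrow> bool" where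
  "admissible \<Phi> \<longleftrightarrow> (\<forall>s u v. norm (\<Phi> s u - \<Phi> s v) \<le> L * norm (u - v)) \<and> (\<forall>s. \<Phi> s 0 = 0) \<and>
     (\<exists>D. countable D \<and> (\<forall>s. s \<notin> D \<longrightarrow> (\<forall>u. isCont (\<lambda>s. \<Phi> s u) s)))"

lemma admissible_lipschitz: "admissible \<Phi> \<Longrightarrow> norm (\<Phi> s u - \<Phi> s v) \<le> L * norm (u - v)"
  and admissible_0: "admissible \<Phi> \<Longrightarrow> \<Phi> s 0 = 0"
  by (auto simp: admissible_def)

lemma admissible_norm: "admissible \<Phi> \<Longrightarrow> norm (\<Phi> s u) \<le> L * norm u"
  using admissible_lipschitz[of \<Phi> s u 0] by (simp add: admissible_0)

text \<open>The cut at 0 lets the integral over the negative half-line be written as a convolution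
  over the line. It may create a jump at 0, which is why 0 joins the exceptional set below.\<close>

definition forcing :: "(real \<Rightarrow> 'a \<Rightarrow> 'a) \<Rightarrow> (real \<Rightarrow> 'a) \<Rightarrow> real \<Rightarrow> 'a" where
  "forcing \<Phi> \<phi> s = (if s \<le> 0 then \<Phi> s (\<phi> s) else 0)"

definition bcont :: "(real \<Rightarrow> 'a) \<Rightarrow> bool" where
  "bcont \<phi> \<longleftrightarrow> continuous_on UNIV \<phi> \<and> bounded (range \<phi>)"

text \<open>Continuity in time at a fixed argument and the Lipschitz bound in the argument, uniform
  in time, combine to continuity along the moving argument \<open>\<phi> s\<close>.\<close>

lemma forcing_isCont:
  assumes \<Phi>: "admissible \<Phi>" and \<phi>: "bcont \<phi>"
  shows "\<exists>D. countable D \<and> (\<forall>s. s \<notin> D \<longrightarrow> isCont (forcing \<Phi> \<phi>) s)"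
proof -
  obtain D where D: "countable D" "\<And>s u. s \<notin> D \<Longrightarrow> isCont (\<lambda>s. \<Phi> s u) s"
    using \<Phi> by (auto simp: admissible_def)
  have "isCont (forcing \<Phi> \<phi>) s" if s: "s \<notin> insert 0 D" for s
  proof -
    have 1: "isCont (\<lambda>s. \<Phi> s (\<phi> s)) s"
      unfolding isCont_def
    proof (rule LIM_zero_cancel, rule Lim_null_comparison)
      have "isCont \<phi> s" using \<phi> by (simp add: bcont_def continuous_on_eq_continuous_at)
      then have "((\<lambda>r. L * norm (\<phi> r - \<phi> s) + norm (\<Phi> r (\<phi> s) - \<Phi> s (\<phi> s)))
          \<longlongrightarrow> L * norm (\<phi> s - \<phi> s) + norm (\<Phi> s (\<phi> s) - \<Phi> s (\<phi> s))) (at s)"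
        using D(2)[of s "\<phi> s"] s by (intro tendsto_intros) (auto simp: isCont_def)
      then show "((\<lambda>r. L * norm (\<phi> r - \<phi> s) + norm (\<Phi> r (\<phi> s) - \<Phi> s (\<phi> s))) \<longlongrightarrow> 0) (at s)" by simp
      show "\<forall>\<^sub>F r in at s. norm (\<Phi> r (\<phi> r) - \<Phi> s (\<phi> s))
          \<le> L * norm (\<phi> r - \<phi> s) + norm (\<Phi> r (\<phi> s) - \<Phi> s (\<phi> s))"
      proof (intro always_eventually allI)
        fix r
        have "norm (\<Phi> r (\<phi> r) - \<Phi> s (\<phi> s)) \<le> norm (\<Phi> r (\<phi> r) - \<Phi> r (\<phi> s)) + norm (\<Phi> r (\<phi> s) - \<Phi> s (\<phi> s))"
          by (rule norm_diff_triangle_le) auto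
        then show "norm (\<Phi> r (\<phi> r) - \<Phi> s (\<phi> s)) \<le> L * norm (\<phi> r - \<phi> s) + norm (\<Phi> r (\<phi> s) - \<Phi> s (\<phi> s))"
          using admissible_lipschitz[OF \<Phi>, of r "\<phi> r" "\<phi> s"] by linarith
      qed
    qed
    show ?thesis
    proof (cases "s < 0")
      case True
      then have "\<forall>\<^sub>F r in nhds s. forcing \<Phi> \<phi> r = \<Phi> r (\<phi> r)"
        using eventually_nhds_in_open[of "{..<0}" s] by (auto elim!: eventually_mono simp: forcing_def)
      then show ?thesis using 1 isCont_cong[of "forcing \<Phi> \<phi>" "\<lambda>r. \<Phi> r (\<phi> r)" s] by simp
    next
      case False
      then have "\<forall>\<^sub>F r in nhds s. forcing \<Phi> \<phi> r = 0"
        using eventually_nhds_in_open[of "{0<..}" s] s by (auto elim!: eventually_mono simp: forcing_def)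
      then show ?thesis using isCont_cong[of "forcing \<Phi> \<phi>" "\<lambda>_. 0" s] by simp
    qed
  qed
  moreover have "countable (insert 0 D)" using D by simp
  ultimately show ?thesis by blast
qed

lemma forcing_measurable:
  assumes "admissible \<Phi>" "bcont \<phi>"
  shows "forcing \<Phi> \<phi> \<in> borel_measurable borel"
proof -
  obtain D where D: "countable D" "\<And>s. s \<notin> D \<Longrightarrow> isCont (forcing \<Phi> \<phi>) s"
    using forcing_isCont[OF assms] by blast
  then show ?thesis
    by (intro borel_measurable_continuous_countable_exceptions[OF D(1)] continuous_at_imp_continuous_on) auto
qed

lemma forcing_bounded:
  assumes "admissible \<Phi>" "bcont \<phi>"
  shows "bounded (range (forcing \<Phi> \<phi>))"
proof -
  obtain B where B: "\<And>s. norm (\<phi> s) \<le> B" using assms(2) by (auto simp: bounded_iff bcont_def)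
  have "norm (forcing \<Phi> \<phi> s) \<le> L * B" for s
    using admissible_norm[OF assms(1), of s "\<phi> s"] mult_left_mono[OF B[of s] less_imp_le[OF L_pos]]
      mult_nonneg_nonneg[OF less_imp_le[OF L_pos] norm_ge_zero[of "\<phi> s"]]
    by (auto simp: forcing_def)
  then show ?thesis by (auto simp: bounded_iff)
qed

lemmas forcing_mb = forcing_measurable forcing_bounded

section \<open>Linearity and norm estimates of the convolution\<close>

lemma gconv_lincomb:
  assumes "f \<in> borel_measurable borel" "bounded (range f)" "g \<in> borel_measurable borel" "bounded (range g)"
  shows "gconv (\<lambda>s. a *\<^sub>R f s + b *\<^sub>R g s) t = a *\<^sub>R gconv f t + b *\<^sub>R gconv g t"
proof -
  have "gconv (\<lambda>s. a *\<^sub>R f s + b *\<^sub>R g s) t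
      = (LBINT \<tau>. a *\<^sub>R green \<tau> (f (t - \<tau>)) + b *\<^sub>R green \<tau> (g (t - \<tau>)))"
    unfolding gconv_def
    by (simp add: bounded_linear.linear[OF green_linear] linear_add linear_scale)
  also have "\<dots> = a *\<^sub>R gconv f t + b *\<^sub>R gconv g t"
    unfolding gconv_def using gconv_integrable[OF assms(1,2), of t] gconv_integrable[OF assms(3,4), of t]
    by simp
  finally show ?thesis .
qed

lemma gconv_diff:
  assumes "f \<in> borel_measurable borel" "bounded (range f)" "g \<in> borel_measurable borel" "bounded (range g)"
  shows "gconv (\<lambda>s. f s - g s) t = gconv f t - gconv g t"
  using gconv_lincomb[OF assms, of 1 "- 1" t] by simp

lemma gconv_bound:
  assumes f: "f \<in> borel_measurable borel" "bounded (range f)" and le: "\<And>s. norm (f s) \<le> L * c"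
  shows "norm (gconv f t) \<le> \<mu> * c"
proof -
  have "0 \<le> L * c" using le[of 0] norm_ge_zero order_trans by blast
  then have c: "c \<ge> 0" using L_pos by (simp add: zero_le_mult_iff)
  have "norm (gconv f t) \<le> (LBINT \<tau>. gbound \<tau> * norm (f (t - \<tau>)))"
    by (rule gconv_norm_le[OF f])
  also have "\<dots> \<le> (LBINT \<tau>. gbound \<tau> * (L * c))"
    using gbound_integrable by (intro integral_mono gbound_norm_integrable[OF f] mult_left_mono le gbound_nonneg) simp
  also have "\<dots> = (L * (LBINT \<tau>. gbound \<tau>)) * c" by simp
  also have "\<dots> \<le> \<mu> * c" using integral_gbound c by (rule mult_right_mono)
  finally show ?thesis .
qed

lemma gconv_lipschitz:
  assumes f: "f \<in> borel_measurable borel" "bounded (range f)"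
    and g: "g \<in> borel_measurable borel" "bounded (range g)"
    and le: "\<And>s. norm (f s - g s) \<le> L * c"
  shows "norm (gconv f t - gconv g t) \<le> \<mu> * c"
proof -
  have "norm (gconv (\<lambda>s. f s - g s) t) \<le> \<mu> * c"
    by (rule gconv_bound[OF borel_measurable_diff[OF f(1) g(1)] bounded_minus_comp[OF f(2) g(2)] le])
  then show ?thesis by (simp only: gconv_diff[OF f g])
qed

lemma gconv_0: "gconv (\<lambda>_. 0) t = 0"
  by (simp add: gconv_def bounded_linear.linear[OF green_linear] linear_0)

text \<open>Solutions are continued to \<open>t > 0\<close> by their value at 0. They then live in
  the complete type of bounded continuous functions on the line, where the fixed point theorem
  applies, and they are unique as functions and not only on the half-line.\<close>

definition lp_sol :: "(real \<Rightarrow> 'a \<Rightarrow> 'a) \<Rightarrow> 'a \<Rightarrow> (real \<Rightarrow> 'a) \<Rightarrow> bool" where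
  "lp_sol \<Phi> \<xi> \<phi> \<longleftrightarrow> bcont \<phi> \<and>
     (\<forall>t. \<phi> t = lin_flow (min t 0) \<xi> + gconv (forcing \<Phi> \<phi>) (min t 0))"

lemma lp_sol_bcont: "lp_sol \<Phi> \<xi> \<phi> \<Longrightarrow> bcont \<phi>"
  by (simp add: lp_sol_def)

lemma forcing_lipschitz:
  assumes "admissible \<Phi>" "norm (\<phi> s - \<phi>' s) \<le> c"
  shows "norm (forcing \<Phi> \<phi> s - forcing \<Phi> \<phi>' s) \<le> L * c"
proof -
  have "0 \<le> L * c" using assms(2) L_pos by (intro mult_nonneg_nonneg) (auto intro: order_trans[OF norm_ge_zero])
  moreover have "norm (\<Phi> s (\<phi> s) - \<Phi> s (\<phi>' s)) \<le> L * c"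
    using admissible_lipschitz[OF assms(1), of s "\<phi> s" "\<phi>' s"] mult_left_mono[OF assms(2), of L] L_pos by linarith
  ultimately show ?thesis by (simp add: forcing_def)
qed

text \<open>The operator \<open>T\<close> preserves bounded continuous functions in spite of the
  jumps of \<open>forcing\<close>, because the convolution smooths them, and it contracts with
  factor \<open>\<mu>\<close>.\<close>

lemma lp_sol_exists:
  assumes \<Phi>: "admissible \<Phi>"
  shows "\<exists>\<phi>. lp_sol \<Phi> \<xi> \<phi>"
proof -
  define T where "T \<phi> t = lin_flow (min t 0) \<xi> + gconv (forcing \<Phi> \<phi>) (min t 0)" for \<phi> t
  have T: "T \<phi> \<in> bcontfun" if \<phi>: "bcont \<phi>" for \<phi>
  proof -
    obtain B where B: "\<And>s. norm (\<phi> s) \<le> B" using \<phi> by (auto simp: bounded_iff bcont_def)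
    obtain D where D: "countable D" "\<And>s. s \<notin> D \<Longrightarrow> isCont (forcing \<Phi> \<phi>) s"
      using forcing_isCont[OF \<Phi> \<phi>] by blast
    have "continuous_on UNIV (gconv (forcing \<Phi> \<phi>))"
      by (intro continuous_at_imp_continuous_on ballI isCont_gconv[OF forcing_mb[OF \<Phi> \<phi>] D])
    then have "continuous_on UNIV (\<lambda>t. gconv (forcing \<Phi> \<phi>) (min t 0))"
      by (rule continuous_on_compose2) (auto intro: continuous_intros)
    moreover have "continuous_on UNIV (\<lambda>t. lin_flow (min t 0) \<xi>)"
      by (rule continuous_on_compose2[OF continuous_lin_flow]) (auto intro: continuous_intros)
    ultimately have c: "continuous_on UNIV (T \<phi>)"
      unfolding T_def[abs_def] by (intro continuous_intros)
    have "norm (T \<phi> t) \<le> norm \<xi> + \<mu> * B" for t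
    proof -
      have "norm (gconv (forcing \<Phi> \<phi>) (min t 0)) \<le> \<mu> * B"
        by (rule gconv_bound[OF forcing_mb[OF \<Phi> \<phi>]])
          (use forcing_lipschitz[OF \<Phi>, of \<phi> _ "\<lambda>_. 0" B] B in \<open>auto simp: forcing_def admissible_0[OF \<Phi>] cong: if_cong\<close>)
      then show ?thesis
        unfolding T_def using lin_flow_norm[of "min t 0" \<xi>] by (intro norm_triangle_le) auto
    qed
    with c show ?thesis by (rule bcontfun_normI)
  qed
  have bc: "bcont (apply_bcontfun f)" for f :: "real \<Rightarrow>\<^sub>C 'a"
    by (simp add: bcont_def)
  define U where "U f = Bcontfun (T (apply_bcontfun f))" for f
  have U: "apply_bcontfun (U f) = T (apply_bcontfun f)" for f
    unfolding U_def using T[OF bc] by (rule Bcontfun_inverse)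
  have "dist (U f) (U g) \<le> \<mu> * dist f g" for f g
  proof (rule dist_bound)
    fix t
    have "norm (gconv (forcing \<Phi> f) (min t 0) - gconv (forcing \<Phi> g) (min t 0)) \<le> \<mu> * dist f g"
      by (intro gconv_lipschitz forcing_mb \<Phi> bc forcing_lipschitz) (simp add: dist_norm[symmetric] dist_bounded)
    then show "dist (U f t) (U g t) \<le> \<mu> * dist f g"
      by (simp add: U T_def dist_norm)
  qed
  then obtain f where "U f = f"
    using banach_fix_type[of \<mu> U] mu by auto
  then have "lp_sol \<Phi> \<xi> f"
    unfolding lp_sol_def using U[of f] bc[of f] by (metis T_def)
  then show ?thesis by blast
qed

lemma lp_sol_lipschitz:
  assumes \<Phi>: "admissible \<Phi>" and s: "lp_sol \<Phi> \<xi> \<phi>" and s': "lp_sol \<Phi> \<xi>' \<phi>'"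
  shows "norm (\<phi> t - \<phi>' t) \<le> norm (\<xi> - \<xi>') / (1 - \<mu>)"
proof -
  note bc = lp_sol_bcont[OF s] lp_sol_bcont[OF s']
  obtain B where B: "\<And>s. norm (\<phi> s) \<le> B" using bc by (auto simp: bounded_iff bcont_def)
  obtain B' where B': "\<And>s. norm (\<phi>' s) \<le> B'" using bc by (auto simp: bounded_iff bcont_def)
  \<comment> \<open>This supremum is finite because both solutions are bounded; only then can
    \<open>\<mu> * c\<close> be absorbed into the left-hand side.\<close>
  define c where "c = (SUP t. norm (\<phi> t - \<phi>' t))"
  have "norm (\<phi> t - \<phi>' t) \<le> B + B'" for t
    using B[of t] B'[of t] by (rule norm_triangle_le_diff[OF add_mono])
  then have bdd: "bdd_above (range (\<lambda>t. norm (\<phi> t - \<phi>' t)))" by (intro bdd_aboveI2)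
  have le_c: "norm (\<phi> t - \<phi>' t) \<le> c" for t
    unfolding c_def by (rule cSUP_upper[OF _ bdd]) simp
  have "norm (\<phi> t - \<phi>' t) \<le> norm (\<xi> - \<xi>') + \<mu> * c" for t
  proof -
    have "\<phi> t - \<phi>' t = lin_flow (min t 0) (\<xi> - \<xi>')
        + (gconv (forcing \<Phi> \<phi>) (min t 0) - gconv (forcing \<Phi> \<phi>') (min t 0))"
      using s s' unfolding lp_sol_def lin_flow_diff by (metis (no_types, opaque_lifting) add_diff_add)
    also have "norm \<dots> \<le> norm (\<xi> - \<xi>') + \<mu> * c"
      by (intro norm_triangle_mono lin_flow_norm gconv_lipschitz forcing_mb \<Phi> bc forcing_lipschitz le_c) simp
    finally show ?thesis .
  qed
  then have "c \<le> norm (\<xi> - \<xi>') + \<mu> * c"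
    unfolding c_def[symmetric] by (subst c_def) (intro cSUP_least, auto)
  then have "c \<le> norm (\<xi> - \<xi>') / (1 - \<mu>)" using mu by (simp add: field_simps)
  with le_c show ?thesis by (rule order_trans)
qed

lemma lp_sol_unique: "admissible \<Phi> \<Longrightarrow> lp_sol \<Phi> \<xi> \<phi> \<Longrightarrow> lp_sol \<Phi> \<xi> \<phi>' \<Longrightarrow> \<phi> = \<phi>'"
  using lp_sol_lipschitz[of \<Phi> \<xi> \<phi> \<xi> \<phi>'] by (auto simp: fun_eq_iff)

lemma lp_sol_lincomb:
  assumes \<Psi>: "admissible \<Psi>" and lin: "\<And>s a b u v. \<Psi> s (a *\<^sub>R u + b *\<^sub>R v) = a *\<^sub>R \<Psi> s u + b *\<^sub>R \<Psi> s v"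
    and s: "lp_sol \<Psi> h \<phi>" and s': "lp_sol \<Psi> h' \<phi>'"
  shows "lp_sol \<Psi> (a *\<^sub>R h + b *\<^sub>R h') (\<lambda>t. a *\<^sub>R \<phi> t + b *\<^sub>R \<phi>' t)"
proof -
  note bc = lp_sol_bcont[OF s] lp_sol_bcont[OF s']
  have "forcing \<Psi> (\<lambda>t. a *\<^sub>R \<phi> t + b *\<^sub>R \<phi>' t) = (\<lambda>t. a *\<^sub>R forcing \<Psi> \<phi> t + b *\<^sub>R forcing \<Psi> \<phi>' t)"
    by (auto simp: forcing_def lin fun_eq_iff)
  then have "gconv (forcing \<Psi> (\<lambda>t. a *\<^sub>R \<phi> t + b *\<^sub>R \<phi>' t)) t
      = a *\<^sub>R gconv (forcing \<Psi> \<phi>) t + b *\<^sub>R gconv (forcing \<Psi> \<phi>') t" for t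
    by (simp add: gconv_lincomb forcing_mb \<Psi> bc)
  moreover have "bcont (\<lambda>t. a *\<^sub>R \<phi> t + b *\<^sub>R \<phi>' t)"
    using bc unfolding bcont_def by (auto intro!: continuous_intros bounded_plus_comp bounded_scaleR_comp)
  moreover have "\<phi> t = lin_flow (min t 0) h + gconv (forcing \<Psi> \<phi>) (min t 0)"
     "\<phi>' t = lin_flow (min t 0) h' + gconv (forcing \<Psi> \<phi>') (min t 0)" for t
    using s s' by (auto simp: lp_sol_def)
  then have "a *\<^sub>R \<phi> t + b *\<^sub>R \<phi>' t = a *\<^sub>R (lin_flow (min t 0) h + gconv (forcing \<Psi> \<phi>) (min t 0))
      + b *\<^sub>R (lin_flow (min t 0) h' + gconv (forcing \<Psi> \<phi>') (min t 0))" for t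
    by metis
  ultimately show ?thesis
    unfolding lp_sol_def by (simp add: lin_flow_lincomb scaleR_add_right)
qed

lemma lp_sol_zero: "admissible \<Phi> \<Longrightarrow> lp_sol \<Phi> 0 (\<lambda>_. 0)"
proof -
  assume "admissible \<Phi>"
  then have "forcing \<Phi> (\<lambda>_. 0) = (\<lambda>_. 0)" by (auto simp: forcing_def admissible_0)
  then show ?thesis by (simp add: lp_sol_def bcont_def lin_flow_def image_constant_conv gconv_0)
qed

lemma lp_sol_bound: "admissible \<Phi> \<Longrightarrow> lp_sol \<Phi> \<xi> \<phi> \<Longrightarrow> norm (\<phi> t) \<le> norm \<xi> / (1 - \<mu>)"
  using lp_sol_lipschitz[OF _ _ lp_sol_zero, of \<Phi> \<xi> \<phi> t] by simp

text \<open>If \<open>limsup norm (d n) \<le> c\<close> pointwise, then dominated convergence in the hypothesis gives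
  \<open>limsup norm (d n) \<le> \<mu> * c\<close> pointwise.\<close>

lemma gconv_inequality_tendsto_0:
  fixes d f :: "nat \<Rightarrow> real \<Rightarrow> 'a" and r :: "nat \<Rightarrow> real \<Rightarrow> real"
  assumes meas [measurable]: "\<And>n. d n \<in> borel_measurable borel" "\<And>n. r n \<in> borel_measurable borel"
    and f: "\<And>n. f n \<in> borel_measurable borel" "\<And>n. bounded (range (f n))"
    and d: "\<And>n s. norm (d n s) \<le> M" and r: "\<And>n s. 0 \<le> r n s" "\<And>n s. r n s \<le> M"
    and r0: "\<And>s. s \<le> 0 \<Longrightarrow> (\<lambda>n. r n s) \<longlonglongrightarrow> 0"
    and le: "\<And>n s. norm (f n s) \<le> (if s \<le> 0 then L * norm (d n s) + r n s else 0)"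
    and eq: "\<And>n t. t \<le> 0 \<Longrightarrow> d n t = gconv (f n) t"
    and t: "t \<le> 0"
  shows "(\<lambda>n. d n t) \<longlonglongrightarrow> 0"
proof -
  have M: "M \<ge> 0" using d[of 0 0] norm_ge_zero order_trans by blast
  \<comment> \<open>Convergence of the positive part of \<open>norm (d n t) - c\<close> to 0
    expresses that the limit superior is at most \<open>c\<close>. All \<open>t\<close> are treated
    at once, because the value at one time depends on the whole half-line.\<close>
  have step: "\<forall>t\<le>0. (\<lambda>n. max (norm (d n t) - \<mu> * c) 0) \<longlonglongrightarrow> 0"
    if c: "c \<ge> 0" and P: "\<forall>t\<le>0. (\<lambda>n. max (norm (d n t) - c) 0) \<longlonglongrightarrow> 0" for c
  proof (intro allI impI)
    fix t :: real assume t: "t \<le> 0"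
    define h where "h n s = (if s \<le> 0 then L * max (norm (d n s) - c) 0 + r n s else 0)" for n s
    have h_nonneg: "0 \<le> h n s" for n s using r(1)[of n s] L_pos by (simp add: h_def)
    have h_le: "h n s \<le> L * M + M" for n s
    proof -
      have "L * max (norm (d n s) - c) 0 + r n s \<le> L * M + M"
        using d[of n s] r(2)[of n s] c M L_pos by (intro add_mono mult_left_mono) auto
      then show ?thesis using M L_pos by (simp add: h_def)
    qed
    have h_meas [measurable]: "h n \<in> borel_measurable borel" for n unfolding h_def[abs_def] by measurable
    have ih: "integrable lborel (\<lambda>\<tau>. gbound \<tau> * h n (t - \<tau>))" for n
      by (rule gbound_mult_integrable[where B="L * M + M"]) (use h_nonneg h_le in auto)
    have "(\<lambda>n. LBINT \<tau>. gbound \<tau> * h n (t - \<tau>)) \<longlonglongrightarrow> (\<integral>\<tau>. 0 \<partial>(lborel::real measure))"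
    proof (rule integral_dominated_convergence)
      show "integrable lborel (\<lambda>\<tau>. gbound \<tau> * (L * M + M))" using gbound_integrable by simp
      have "(\<lambda>n. h n s) \<longlonglongrightarrow> 0" for s
      proof (cases "s \<le> 0")
        case True
        have "(\<lambda>n. L * max (norm (d n s) - c) 0 + r n s) \<longlonglongrightarrow> L * 0 + 0"
          using P r0 True by (intro tendsto_intros) auto
        then show ?thesis using True by (simp add: h_def)
      qed (simp add: h_def)
      then show "AE \<tau> in lborel. (\<lambda>n. gbound \<tau> * h n (t - \<tau>)) \<longlonglongrightarrow> 0"
        by (intro AE_I2 tendsto_mult_right_zero)
      show "AE \<tau> in lborel. norm (gbound \<tau> * h n (t - \<tau>)) \<le> gbound \<tau> * (L * M + M)" for n
        using h_nonneg h_le by (auto simp: abs_mult gbound_nonneg intro!: mult_left_mono)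
    qed simp_all
    then have lim: "(\<lambda>n. LBINT \<tau>. gbound \<tau> * h n (t - \<tau>)) \<longlonglongrightarrow> 0" by simp
    have "max (norm (d n t) - \<mu> * c) 0 \<le> (LBINT \<tau>. gbound \<tau> * h n (t - \<tau>))" for n
    proof -
      have "norm (d n t) \<le> (LBINT \<tau>. gbound \<tau> * norm (f n (t - \<tau>)))"
        unfolding eq[OF t] by (rule gconv_norm_le[OF f])
      also have "\<dots> \<le> (LBINT \<tau>. gbound \<tau> * (L * c) + gbound \<tau> * h n (t - \<tau>))"
      proof (rule integral_mono)
        show "integrable lborel (\<lambda>\<tau>. gbound \<tau> * norm (f n (t - \<tau>)))" by (rule gbound_norm_integrable[OF f])
        show "integrable lborel (\<lambda>\<tau>. gbound \<tau> * (L * c) + gbound \<tau> * h n (t - \<tau>))"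
          using ih gbound_integrable by simp
        have "norm (f n s) \<le> L * c + h n s" for s
        proof -
          have "L * norm (d n s) \<le> L * c + L * max (norm (d n s) - c) 0"
            unfolding distrib_left[symmetric] using L_pos by (intro mult_left_mono) auto
          moreover have "0 \<le> L * c" using c L_pos by simp
          ultimately show ?thesis using le[of n s] by (auto simp: h_def split: if_splits)
        qed
        from mult_left_mono[OF this gbound_nonneg]
        show "gbound \<tau> * norm (f n (t - \<tau>)) \<le> gbound \<tau> * (L * c) + gbound \<tau> * h n (t - \<tau>)" for \<tau>
          by (simp only: distrib_left)
      qed
      also have "\<dots> = L * (LBINT \<tau>. gbound \<tau>) * c + (LBINT \<tau>. gbound \<tau> * h n (t - \<tau>))"
        using ih gbound_integrable by simp
      also have "\<dots> \<le> \<mu> * c + (LBINT \<tau>. gbound \<tau> * h n (t - \<tau>))"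
        using mult_right_mono[OF integral_gbound c] by simp
      finally have "norm (d n t) - \<mu> * c \<le> (LBINT \<tau>. gbound \<tau> * h n (t - \<tau>))" by simp
      moreover have "0 \<le> (LBINT \<tau>. gbound \<tau> * h n (t - \<tau>))"
        by (intro Bochner_Integration.integral_nonneg mult_nonneg_nonneg gbound_nonneg h_nonneg)
      ultimately show ?thesis by simp
    qed
    then show "(\<lambda>n. max (norm (d n t) - \<mu> * c) 0) \<longlonglongrightarrow> 0"
      by (intro tendsto_sandwich[OF _ _ tendsto_const lim]) (auto intro: always_eventually)
  qed
  \<comment> \<open>The uniform bound \<open>M\<close> starts the iteration, and each round
    multiplies it by \<open>\<mu>\<close>.\<close>
  have P: "\<forall>t\<le>0. (\<lambda>n. max (norm (d n t) - \<mu> ^ k * M) 0) \<longlonglongrightarrow> 0" for k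
  proof (induction k)
    case 0
    have "max (norm (d n t) - \<mu> ^ 0 * M) 0 = 0" for n t using d[of n t] by simp
    then show ?case by simp
  next
    case (Suc k)
    have "\<mu> ^ k * M \<ge> 0" using mu M by auto
    from step[OF this Suc] show ?case by (simp add: mult.assoc)
  qed
  show ?thesis
  proof (rule LIMSEQ_I)
    fix \<epsilon> :: real assume \<epsilon>: "0 < \<epsilon>"
    have "(\<lambda>k. \<mu> ^ k * M) \<longlonglongrightarrow> 0 * M" using mu by (intro tendsto_intros LIMSEQ_power_zero) auto
    then have "\<forall>\<^sub>F k in sequentially. \<mu> ^ k * M < \<epsilon> / 2"
      using \<epsilon> by (intro order_tendstoD) auto
    then obtain k where k: "\<mu> ^ k * M < \<epsilon> / 2" by (auto simp: eventually_sequentially)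
    have "\<forall>\<^sub>F n in sequentially. max (norm (d n t) - \<mu> ^ k * M) 0 < \<epsilon> / 2"
      using P[of k] t \<epsilon> by (intro order_tendstoD) auto
    then obtain n0 where n0: "\<And>n. n \<ge> n0 \<Longrightarrow> max (norm (d n t) - \<mu> ^ k * M) 0 < \<epsilon> / 2"
      by (auto simp: eventually_sequentially)
    have "norm (d n t - 0) < \<epsilon>" if "n \<ge> n0" for n
    proof -
      have "norm (d n t) - \<mu> ^ k * M \<le> max (norm (d n t) - \<mu> ^ k * M) 0" by simp
      then show ?thesis using n0[OF that] k unfolding diff_0_right by linarith
    qed
    then show "\<exists>n0. \<forall>n\<ge>n0. norm (d n t - 0) < \<epsilon>" by blast
  qed
qed

lemma bcont_measurable: "bcont \<phi> \<Longrightarrow> \<phi> \<in> borel_measurable borel"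
  by (auto simp: bcont_def intro: borel_measurable_continuous_onI)

lemma bcont_lincomb: "bcont \<phi> \<Longrightarrow> bcont \<phi>' \<Longrightarrow> bcont (\<lambda>t. a *\<^sub>R \<phi> t + b *\<^sub>R \<phi>' t)"
  unfolding bcont_def by (auto intro!: continuous_intros bounded_plus_comp bounded_scaleR_comp)

lemma bcont_diff: "bcont \<phi> \<Longrightarrow> bcont \<phi>' \<Longrightarrow> bcont (\<lambda>t. \<phi> t - \<phi>' t)"
  using bcont_lincomb[of \<phi> \<phi>' 1 "- 1"] by simp

lemma lp_sol_eq: "lp_sol \<Phi> \<xi> \<phi> \<Longrightarrow> t \<le> 0 \<Longrightarrow> \<phi> t = lin_flow t \<xi> + gconv (forcing \<Phi> \<phi>) t"
  unfolding lp_sol_def by (metis min.absorb1)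

lemma lp_sol_const: "lp_sol \<Phi> \<xi> \<phi> \<Longrightarrow> 0 \<le> t \<Longrightarrow> \<phi> t = \<phi> 0"
  unfolding lp_sol_def by (metis min.absorb2 min.idem)

lemma forcing_bound:
  assumes \<Phi>: "admissible \<Phi>" and \<phi>: "norm (\<phi> s) \<le> B"
  shows "norm (forcing \<Phi> \<phi> s) \<le> L * B"
  using forcing_lipschitz[OF \<Phi>, of \<phi> s "\<lambda>_. 0" B] \<phi> by (simp add: forcing_def admissible_0[OF \<Phi>] split: if_splits)

text \<open>The right-hand sides converge only pointwise in time, so a contraction estimate in the
  supremum norm does not yield the claim. The difference of the solutions does satisfy the
  convolution inequality above, with \<open>r\<close> the error made by evaluating the two
  right-hand sides along the fixed limit solution.\<close>

lemma lp_sol_tendsto: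
  assumes \<Phi>n: "\<And>n. admissible (\<Phi>n n)" and \<Phi>: "admissible \<Phi>"
    and sn: "\<And>n. lp_sol (\<Phi>n n) \<xi> (\<phi>n n)" and s: "lp_sol \<Phi> \<xi> \<phi>"
    and lim: "\<And>s. s \<le> 0 \<Longrightarrow> (\<lambda>n. \<Phi>n n s (\<phi> s)) \<longlonglongrightarrow> \<Phi> s (\<phi> s)"
  shows "(\<lambda>n. \<phi>n n t) \<longlonglongrightarrow> \<phi> t"
proof -
  define B where "B = norm \<xi> / (1 - \<mu>)"
  note bc = lp_sol_bcont[OF sn] lp_sol_bcont[OF s]
  define r where "r n s = norm (forcing (\<Phi>n n) \<phi> s - forcing \<Phi> \<phi> s)" for n s
  have B: "norm (\<phi>n n s) \<le> B" "norm (\<phi> s) \<le> B" for n s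
    using lp_sol_bound[OF \<Phi>n sn] lp_sol_bound[OF \<Phi> s] by (auto simp: B_def)
  have B0: "0 \<le> B" "0 \<le> L * B" using mu L_pos by (simp_all add: B_def)
  note [measurable] = forcing_measurable[OF \<Phi>n bc(2)] forcing_measurable[OF \<Phi> bc(2)]
  have main: "(\<lambda>n. \<phi>n n t - \<phi> t) \<longlonglongrightarrow> 0" if "t \<le> 0" for t
  proof (rule gconv_inequality_tendsto_0[where r=r and M="2 * B + 2 * (L * B)" and d="\<lambda>n t. \<phi>n n t - \<phi> t"
        and f="\<lambda>n s. forcing (\<Phi>n n) (\<phi>n n) s - forcing \<Phi> \<phi> s", OF _ _ _ _ _ _ _ _ _ _ that])
    show "(\<lambda>s. \<phi>n n s - \<phi> s) \<in> borel_measurable borel" for n by (intro bcont_measurable bcont_diff bc)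
    show "r n \<in> borel_measurable borel" for n unfolding r_def[abs_def] by measurable
    show "(\<lambda>s. forcing (\<Phi>n n) (\<phi>n n) s - forcing \<Phi> \<phi> s) \<in> borel_measurable borel"
      "bounded (range (\<lambda>s. forcing (\<Phi>n n) (\<phi>n n) s - forcing \<Phi> \<phi> s))" for n
      by (intro borel_measurable_diff bounded_minus_comp forcing_mb \<Phi>n \<Phi> bc)+
    fix n and s :: real
    show "norm (\<phi>n n s - \<phi> s) \<le> 2 * B + 2 * (L * B)"
      using norm_triangle_ineq4[of "\<phi>n n s" "\<phi> s"] B(1)[of n s] B(2)[of s] B0 by linarith
    show "r n s \<le> 2 * B + 2 * (L * B)"
      using norm_triangle_ineq4[of "forcing (\<Phi>n n) \<phi> s" "forcing \<Phi> \<phi> s"] B0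
        forcing_bound[of \<Phi> \<phi> s B, OF \<Phi> B(2)] forcing_bound[of "\<Phi>n n" \<phi> s B, OF \<Phi>n B(2)] unfolding r_def by linarith
    show "0 \<le> r n s" by (simp add: r_def)
    show "(\<lambda>n. r n s) \<longlonglongrightarrow> 0" if "s \<le> 0"
      using lim[OF that] that unfolding r_def forcing_def by (auto intro: tendsto_norm_zero LIM_zero)
    have "norm (forcing (\<Phi>n n) (\<phi>n n) s - forcing \<Phi> \<phi> s)
         \<le> norm (forcing (\<Phi>n n) (\<phi>n n) s - forcing (\<Phi>n n) \<phi> s) + r n s"
      unfolding r_def by (rule norm_diff_triangle_le) auto
    also have "\<dots> \<le> L * norm (\<phi>n n s - \<phi> s) + r n s"
      using forcing_lipschitz[OF \<Phi>n[of n], of "\<phi>n n" s \<phi>] by simp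
    finally show "norm (forcing (\<Phi>n n) (\<phi>n n) s - forcing \<Phi> \<phi> s)
        \<le> (if s \<le> 0 then L * norm (\<phi>n n s - \<phi> s) + r n s else 0)"
      by (cases "s \<le> 0") (simp, simp add: forcing_def)
    show "\<phi>n n t - \<phi> t = gconv (\<lambda>s. forcing (\<Phi>n n) (\<phi>n n) s - forcing \<Phi> \<phi> s) t" if "t \<le> 0" for t
      using lp_sol_eq[OF sn that] lp_sol_eq[OF s that] by (simp add: gconv_diff forcing_mb \<Phi> \<Phi>n bc)
  qed
  have "(\<lambda>n. \<phi>n n (min t 0)) \<longlonglongrightarrow> \<phi> (min t 0)"
    by (rule LIM_zero_cancel) (use main[of "min t 0"] in simp)
  moreover have "\<phi> (min t 0) = \<phi> t" "\<phi>n n (min t 0) = \<phi>n n t" for n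
    using lp_sol_const[OF s, of t] lp_sol_const[OF sn, of t] by (cases "t \<le> 0"; simp)+
  ultimately show ?thesis by simp
qed

text \<open>The scaled defect of the linear approximation satisfies the same convolution inequality.
  Its inhomogeneity is the linearization error at the true increment \<open>w\<close>; replacing
  \<open>w\<close> by \<open>\<eta>\<close> costs only the Lipschitz constant of
  \<open>\<Psi>\<close> times the defect itself.\<close>

lemma lp_sol_deriv_tendsto:
  assumes \<Phi>: "admissible \<Phi>" and \<Psi>: "admissible \<Psi>" and s: "lp_sol \<Phi> \<xi> \<phi>"
    and sh: "\<And>n. lp_sol \<Phi> (\<xi> + h n) (\<phi>h n)" and s\<Psi>: "\<And>n. lp_sol \<Psi> (h n) (\<eta> n)"
    and h: "\<And>n. h n \<noteq> 0"
    and lim: "\<And>s. s \<le> 0 \<Longrightarrow>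
       (\<lambda>n. norm (\<Phi> s (\<phi>h n s) - \<Phi> s (\<phi> s) - \<Psi> s (\<phi>h n s - \<phi> s)) / norm (h n)) \<longlonglongrightarrow> 0"
    and t: "t \<le> 0"
  shows "(\<lambda>n. norm (\<phi>h n t - \<phi> t - \<eta> n t) / norm (h n)) \<longlonglongrightarrow> 0"
proof -
  define B where "B = 1 / (1 - \<mu>)"
  note bc = lp_sol_bcont[OF sh] lp_sol_bcont[OF s] lp_sol_bcont[OF s\<Psi>]
  define c where "c n = inverse (norm (h n))" for n
  define w where "w n s = \<phi>h n s - \<phi> s" for n s
  have bcw: "bcont (w n)" for n unfolding w_def[abs_def] by (intro bcont_diff bc)
  define d where "d n s = c n *\<^sub>R (w n s - \<eta> n s)" for n s
  define R where "R n s = forcing \<Phi> (\<phi>h n) s - forcing \<Phi> \<phi> s - forcing \<Psi> (w n) s" for n s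
  define f where "f n s = forcing \<Phi> (\<phi>h n) s - forcing \<Phi> \<phi> s - forcing \<Psi> (\<eta> n) s" for n s
  have c: "c n * norm (h n) = 1" "c n > 0" for n using h[of n] by (auto simp: c_def)
  have B0: "0 \<le> B" "0 \<le> L * B" using mu L_pos by (simp_all add: B_def)
  have B: "norm (w n s) \<le> B * norm (h n)" "norm (\<eta> n s) \<le> B * norm (h n)" for n s
    using lp_sol_lipschitz[OF \<Phi> sh s, of n s] lp_sol_bound[OF \<Psi> s\<Psi>, of n s]
    by (auto simp: B_def w_def)
  have f: "f n \<in> borel_measurable borel" "bounded (range (f n))" for n
    unfolding f_def[abs_def] by (intro borel_measurable_diff bounded_minus_comp forcing_mb \<Phi> \<Psi> bc)+
  \<comment> \<open>Clears the factor \<open>norm (h n)\<close>: the estimates are linear in it, and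
    after the division the bounds no longer depend on \<open>n\<close>.\<close>
  have cB: "c n * x \<le> K" if "x \<le> K * norm (h n)" for n x K
    using mult_left_mono[OF that less_imp_le[OF c(2)[of n]]] c(1)[of n] by (simp add: mult.left_commute)
  note [measurable] = forcing_measurable[OF \<Phi> bc(1)] forcing_measurable[OF \<Phi> bc(2)] forcing_measurable[OF \<Psi> bcw]
  have "(\<lambda>n. d n t) \<longlonglongrightarrow> 0"
  proof (rule gconv_inequality_tendsto_0[where r="\<lambda>n s. c n * norm (R n s)" and M="2 * B + 2 * (L * B)"
        and f="\<lambda>n s. c n *\<^sub>R f n s", OF _ _ _ _ _ _ _ _ _ _ t])
    show "d n \<in> borel_measurable borel" for n
      unfolding d_def[abs_def] by (intro borel_measurable_scaleR borel_measurable_const bcont_measurable bcont_diff bcw bc)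
    show "(\<lambda>s. c n * norm (R n s)) \<in> borel_measurable borel" for n unfolding R_def[abs_def] by measurable
    show "(\<lambda>s. c n *\<^sub>R f n s) \<in> borel_measurable borel" "bounded (range (\<lambda>s. c n *\<^sub>R f n s))" for n
      by (intro borel_measurable_scaleR borel_measurable_const bounded_scaleR_comp f)+
    fix n and s :: real
    have "norm (w n s - \<eta> n s) \<le> (2 * B) * norm (h n)"
      using norm_triangle_ineq4[of "w n s" "\<eta> n s"] B[of n s] by simp
    then show "norm (d n s) \<le> 2 * B + 2 * (L * B)"
      using cB[of "norm (w n s - \<eta> n s)" "2 * B" n] c(2)[of n] B0 by (simp add: d_def)
    have "norm (forcing \<Phi> (\<phi>h n) s - forcing \<Phi> \<phi> s) \<le> L * (B * norm (h n))"
      by (rule forcing_lipschitz[OF \<Phi>]) (use B[of n s] in \<open>simp add: w_def\<close>)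
    then have "norm (R n s) \<le> (2 * (L * B)) * norm (h n)"
      unfolding R_def using forcing_bound[of \<Psi> "w n" s "B * norm (h n)", OF \<Psi> B(1)]
        norm_triangle_ineq4[of "forcing \<Phi> (\<phi>h n) s - forcing \<Phi> \<phi> s" "forcing \<Psi> (w n) s"] by linarith
    then show "c n * norm (R n s) \<le> 2 * B + 2 * (L * B)"
      using cB[of "norm (R n s)" "2 * (L * B)" n] B0 by linarith
    show "0 \<le> c n * norm (R n s)" using c(2)[of n] by simp
    show "(\<lambda>n. c n * norm (R n s)) \<longlonglongrightarrow> 0" if "s \<le> 0"
      using lim[OF that] that by (simp add: R_def w_def forcing_def c_def divide_inverse mult.commute)
    have "f n s = R n s + (forcing \<Psi> (w n) s - forcing \<Psi> (\<eta> n) s)" by (simp add: R_def f_def)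
    then have "norm (f n s) \<le> norm (R n s) + L * norm (w n s - \<eta> n s)"
      using norm_triangle_mono[OF order.refl forcing_lipschitz[OF \<Psi> order.refl, of "w n" s "\<eta> n"]] by simp
    from mult_left_mono[OF this less_imp_le[OF c(2)[of n]]]
    have "norm (c n *\<^sub>R f n s) \<le> L * norm (d n s) + c n * norm (R n s)"
      using c(2)[of n] by (simp add: d_def distrib_left mult.left_commute)
    then show "norm (c n *\<^sub>R f n s) \<le> (if s \<le> 0 then L * norm (d n s) + c n * norm (R n s) else 0)"
      by (cases "s \<le> 0") (simp, simp add: f_def forcing_def)
    show "d n t = gconv (\<lambda>s. c n *\<^sub>R f n s) t" if "t \<le> 0" for t
    proof -
      have "w n t - \<eta> n t = gconv (f n) t"
        using lp_sol_eq[OF sh that, of n] lp_sol_eq[OF s that] lp_sol_eq[OF s\<Psi> that, of n] lin_flow_lincomb[of t 1 \<xi> 1 "h n"]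
        by (simp add: f_def[abs_def] gconv_diff forcing_mb bounded_minus_comp \<Phi> \<Psi> bc w_def)
      then show ?thesis using gconv_lincomb[OF f[of n] f[of n], of "c n" 0 t] by (simp add: d_def)
    qed
  qed
  from tendsto_norm_zero[OF this] show ?thesis
    using less_imp_le[OF c(2)] by (simp add: d_def w_def c_def divide_inverse mult.commute)
qed

end

section \<open>Fractional powers\<close>

lemma has_deriv_onD:
  assumes "has_deriv_on X nX Y nY f D x"
  shows "u \<in> X \<Longrightarrow> f u \<in> Y" "u \<in> X \<Longrightarrow> D u \<in> Y"
    and "u \<in> X \<Longrightarrow> v \<in> X \<Longrightarrow> D (a *\<^sub>R u + b *\<^sub>R v) = a *\<^sub>R D u + b *\<^sub>R D v"
    and "\<epsilon> > 0 \<Longrightarrow> \<exists>\<delta>>0. \<forall>h\<in>X. nX h < \<delta> \<longrightarrow> nY (f (x + h) - f x - D h) \<le> \<epsilon> * nX h"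
proof -
  note D = assms[unfolded has_deriv_on_def]
  show "u \<in> X \<Longrightarrow> f u \<in> Y" using conjunct1[OF D] by (rule subsetD[OF _ imageI])
  note D2 = conjunct2[OF D]
  show "u \<in> X \<Longrightarrow> D u \<in> Y" using conjunct1[OF D2] by (rule subsetD[OF _ imageI])
  note D3 = conjunct2[OF D2]
  show "u \<in> X \<Longrightarrow> v \<in> X \<Longrightarrow> D (a *\<^sub>R u + b *\<^sub>R v) = a *\<^sub>R D u + b *\<^sub>R D v"
    using conjunct1[OF D3] by simp
  show "\<epsilon> > 0 \<Longrightarrow> \<exists>\<delta>>0. \<forall>h\<in>X. nX h < \<delta> \<longrightarrow> nY (f (x + h) - f x - D h) \<le> \<epsilon> * nX h"
    using conjunct2[OF conjunct2[OF D3]] by simp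
qed

context inertial_gap
begin

text \<open>The inverse power is bounded because the spectrum stays above \<open>lam 1\<close>, and
  it is an isometry from the whole space onto \<open>domA\<close> with \<open>nA\<close>. The
  analysis is transported along it to the ambient norm, since \<open>A_pow\<close> has its intended
  meaning only on \<open>domA\<close>.\<close>

definition A_inv :: "'a \<Rightarrow> 'a" where
  "A_inv = diag (\<lambda>k. lam k powr (- \<sigma>))"

lemma lam_powr_le: "k \<ge> 1 \<Longrightarrow> \<bar>lam k powr (- \<sigma>)\<bar> \<le> lam 1 powr (- \<sigma>)"
  using lam_mono[of 1 k] lam_1 sigma by (simp add: powr_mono2')

lemma A_inv_coeff: "k \<ge> 1 \<Longrightarrow> A_inv v \<bullet> e k = lam k powr (- \<sigma>) * (v \<bullet> e k)"
  unfolding A_inv_def by (rule diag_coeff_bounded[OF lam_powr_le])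

lemma A_inv_linear: "bounded_linear A_inv"
  unfolding A_inv_def by (rule diag_bounded_linear[OF lam_powr_le])

lemma lam_powr_cancel [simp]: "k \<ge> 1 \<Longrightarrow> lam k powr \<sigma> * (lam k powr (- \<sigma>) * c) = c"
  "k \<ge> 1 \<Longrightarrow> lam k powr (- \<sigma>) * (lam k powr \<sigma> * c) = c"
  using lam_pos[of k] by (simp_all add: powr_minus mult.assoc[symmetric])

abbreviation "domA \<equiv> dom_A_pow e lam \<sigma>"
abbreviation "Apow \<equiv> A_pow e lam \<sigma>"
abbreviation "nA \<equiv> norm_A e lam \<sigma>"

lemma Apow_coeff:
  assumes "u \<in> domA" "k \<ge> 1"
  shows "Apow u \<bullet> e k = lam k powr \<sigma> * (u \<bullet> e k)"
  unfolding A_pow_def spec_fun_eq_diag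
  by (rule diag_coeff_summable) (use assms in \<open>auto simp: dom_A_pow_def\<close>)

lemma A_inv_dom: "A_inv v \<in> domA"
proof -
  have "(\<lambda>k. (v \<bullet> e k)\<^sup>2) summable_on {1..} \<longleftrightarrow>
     (\<lambda>k. (lam k powr \<sigma> * (A_inv v \<bullet> e k))\<^sup>2) summable_on {1..}"
    by (rule summable_on_cong) (simp add: A_inv_coeff)
  then show ?thesis using coeff_square_summable by (simp add: dom_A_pow_def)
qed

lemma Apow_A_inv [simp]: "Apow (A_inv v) = v"
  by (rule coeff_ext) (simp add: Apow_coeff[OF A_inv_dom] A_inv_coeff)

lemma A_inv_Apow [simp]: "u \<in> domA \<Longrightarrow> A_inv (Apow u) = u"
  by (rule coeff_ext) (simp add: Apow_coeff A_inv_coeff)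

lemma nA_A_inv [simp]: "nA (A_inv v) = norm v"
  by (simp add: norm_A_def)

lemma A_inv_add: "A_inv (u + v) = A_inv u + A_inv v"
  and A_inv_diff: "A_inv (u - v) = A_inv u - A_inv v"
  and A_inv_scaleR: "A_inv (c *\<^sub>R v) = c *\<^sub>R A_inv v"
  and A_inv_0: "A_inv 0 = 0"
  using bounded_linear.linear[OF A_inv_linear]
  by (simp_all add: linear_add linear_diff linear_scale linear_0)

lemma
  assumes "u \<in> domA" "v \<in> domA"
  shows dom_lincomb: "a *\<^sub>R u + b *\<^sub>R v \<in> domA"
    and Apow_lincomb: "Apow (a *\<^sub>R u + b *\<^sub>R v) = a *\<^sub>R Apow u + b *\<^sub>R Apow v"
proof -
  have eq: "a *\<^sub>R u + b *\<^sub>R v = A_inv (a *\<^sub>R Apow u + b *\<^sub>R Apow v)"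
    using assms by (simp add: A_inv_add A_inv_scaleR)
  show "a *\<^sub>R u + b *\<^sub>R v \<in> domA" unfolding eq by (rule A_inv_dom)
  show "Apow (a *\<^sub>R u + b *\<^sub>R v) = a *\<^sub>R Apow u + b *\<^sub>R Apow v" unfolding eq by simp
qed

lemma Apow_diff: "u \<in> domA \<Longrightarrow> v \<in> domA \<Longrightarrow> Apow (u - v) = Apow u - Apow v"
  using Apow_lincomb[of u v 1 "- 1"] by simp

lemma Apow_scaleR: "u \<in> domA \<Longrightarrow> Apow (c *\<^sub>R u) = c *\<^sub>R Apow u"
  using Apow_lincomb[of u u c 0] by simp



lemma Apow_add: "u \<in> domA \<Longrightarrow> v \<in> domA \<Longrightarrow> Apow (u + v) = Apow u + Apow v"
  using Apow_lincomb[of u v 1 1] by simp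

section \<open>Spectral subspaces and derivatives between them\<close>

abbreviation "PP \<equiv> proj_P e N"
abbreviation "QQ \<equiv> proj_Q e N"
abbreviation "PD \<equiv> proj_P e N ` dom_A_pow e lam \<sigma>"
abbreviation "QD \<equiv> proj_Q e N ` dom_A_pow e lam \<sigma>"

lemma PP_A_inv: "PP (A_inv v) = A_inv (PP v)"
  by (rule coeff_ext) (simp add: proj_P_coeff A_inv_coeff)

lemma QQ_A_inv: "QQ (A_inv v) = A_inv (QQ v)"
  by (rule coeff_ext) (simp add: proj_Q_coeff A_inv_coeff)

lemma QQ_lincomb: "QQ (a *\<^sub>R u + b *\<^sub>R v) = a *\<^sub>R QQ u + b *\<^sub>R QQ v"
  by (rule coeff_ext) (simp add: proj_Q_coeff inner_add_left)

lemma PP_lincomb: "PP (a *\<^sub>R u + b *\<^sub>R v) = a *\<^sub>R PP u + b *\<^sub>R PP v"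
  by (rule coeff_ext) (simp add: proj_P_coeff inner_add_left)

lemma QQ_diff: "QQ (u - v) = QQ u - QQ v"
  using QQ_lincomb[of 1 u "- 1" v] by simp

lemma norm_QQ: "norm (QQ v) \<le> norm v"
  using norm_le_coeff[of "QQ v" 1 v] by (simp add: proj_Q_coeff)

lemma PP_PP: "PP (PP v) = PP v"
  by (rule coeff_ext) (simp add: proj_P_coeff)

lemma PD_eq: "PD = A_inv ` range PP"
proof -
  have "PP u \<in> A_inv ` range PP" if "u \<in> domA" for u
    using that PP_A_inv[of "Apow u"] by auto
  moreover have "A_inv (PP v) \<in> PD" for v
    using PP_A_inv[of v] A_inv_dom[of v] by (metis image_eqI)
  ultimately show ?thesis by auto
qed

lemma PD_dom: "h \<in> PD \<Longrightarrow> h \<in> domA"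
  by (auto simp: PD_eq A_inv_dom)

lemma PD_lincomb:
  assumes "h \<in> PD" "k \<in> PD"
  shows "a *\<^sub>R h + b *\<^sub>R k \<in> PD"
proof -
  obtain u v where "h = PP u" "k = PP v" "u \<in> domA" "v \<in> domA" using assms by auto
  then show ?thesis using PP_lincomb[of a u b v] dom_lincomb[of u v a b] by (metis image_eqI)
qed

lemma PD_PP_Apow: "h \<in> PD \<Longrightarrow> PP (Apow h) = Apow h"
  by (auto simp: PD_eq PP_PP)

lemma PD_0: "0 \<in> PD"
proof -
  have "PP (A_inv 0) \<in> PD" using A_inv_dom by blast
  from PD_lincomb[OF this this, of 0 0] show ?thesis by simp
qed

lemma A_inv_QQ_QD: "A_inv (QQ v) \<in> QD"
  using QQ_A_inv[of v] A_inv_dom[of v] by (metis image_eqI)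

lemma QD_dom: "h \<in> QD \<Longrightarrow> h \<in> domA"
proof -
  assume "h \<in> QD"
  then obtain u where "h = QQ u" "u \<in> domA" by auto
  then have "h = A_inv (QQ (Apow u))" by (simp flip: QQ_A_inv)
  then show ?thesis by (simp add: A_inv_dom)
qed

text \<open>\<open>deriv_on\<close> is a choice among derivatives, so any claim about its values
  rests on this. Small multiples of \<open>h\<close> stay in \<open>PD\<close>, where both
  approximations apply, and linearity removes the scale.\<close>

lemma has_deriv_on_unique:
  assumes D: "has_deriv_on PD nA QD nA f D x" and D': "has_deriv_on PD nA QD nA f D' x"
    and x: "x \<in> PD" and h: "h \<in> PD"
  shows "D h = D' h"
proof -
  have QDd: "D k \<in> domA" "D' k \<in> domA" "f k \<in> domA" if "k \<in> PD" for k
    by (intro QD_dom has_deriv_onD[OF D] has_deriv_onD[OF D'] that)+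
  have nA_nonneg: "nA u \<ge> 0" for u by (simp add: norm_A_def)
  define w where "w = Apow (D h - D' h)"
  have "norm w \<le> \<epsilon>" if \<epsilon>: "\<epsilon> > 0" for \<epsilon>
  proof -
    define \<epsilon>' where "\<epsilon>' = \<epsilon> / (2 * (nA h + 1))"
    have \<epsilon>': "\<epsilon>' > 0" "2 * \<epsilon>' * nA h \<le> \<epsilon>"
      using \<epsilon> nA_nonneg[of h] by (auto simp: \<epsilon>'_def field_simps)
    obtain \<delta> where \<delta>: "\<delta> > 0" "\<And>k. k \<in> PD \<Longrightarrow> nA k < \<delta> \<Longrightarrow> nA (f (x + k) - f x - D k) \<le> \<epsilon>' * nA k"
      using has_deriv_onD(4)[OF D \<epsilon>'(1)] by blast
    obtain \<delta>' where \<delta>': "\<delta>' > 0" "\<And>k. k \<in> PD \<Longrightarrow> nA k < \<delta>' \<Longrightarrow> nA (f (x + k) - f x - D' k) \<le> \<epsilon>' * nA k"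
      using has_deriv_onD(4)[OF D' \<epsilon>'(1)] by blast
    define m where "m = min \<delta> \<delta>'"
    have m: "m > 0" using \<delta> \<delta>' by (simp add: m_def)
    \<comment> \<open>The 1 in the denominator keeps the scale positive when \<open>nA h\<close> is
      0.\<close>
    define r where "r = m / (2 * (nA h + 1))"
    define k where "k = r *\<^sub>R h"
    have r: "r > 0" using m nA_nonneg[of h] by (simp add: r_def)
    have k: "k \<in> PD" using PD_lincomb[OF h h, of r 0] by (simp add: k_def)
    have nk: "nA k = r * nA h"
      using r by (simp add: norm_A_def k_def Apow_scaleR[OF PD_dom[OF h]])
    have "r * nA h < m"
      using m nA_nonneg[of h] by (simp add: r_def divide_less_eq algebra_simps add_pos_nonneg)
    then have lt: "nA k < \<delta>" "nA k < \<delta>'" using nk by (auto simp: m_def)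
    have lin: "D k = r *\<^sub>R D h" "D' k = r *\<^sub>R D' h"
      using has_deriv_onD(3)[OF D h h, of r 0] has_deriv_onD(3)[OF D' h h, of r 0] by (simp_all add: k_def)
    have xk: "x + k \<in> PD" using PD_lincomb[OF x k, of 1 1] by simp
    let ?a = "Apow (f (x + k)) - Apow (f x)"
    have sub: "Apow (f (x + k) - f x - v) = ?a - Apow v" if "v \<in> domA" for v
      using that QDd(3)[OF xk] QDd(3)[OF x] dom_lincomb[of "f (x + k)" "f x" 1 "- 1"]
      by (simp add: Apow_diff)
    have "norm (?a - Apow (D k)) \<le> \<epsilon>' * nA k" "norm (?a - Apow (D' k)) \<le> \<epsilon>' * nA k"
      using \<delta>(2)[OF k lt(1)] \<delta>'(2)[OF k lt(2)] QDd[OF k] by (simp_all add: norm_A_def sub)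
    moreover have "r *\<^sub>R w = (?a - Apow (D' k)) - (?a - Apow (D k))"
      unfolding lin w_def using QDd[OF h] by (simp add: Apow_diff Apow_scaleR scaleR_diff_right)
    ultimately have "norm (r *\<^sub>R w) \<le> 2 * \<epsilon>' * nA k"
      using norm_triangle_ineq4[of "?a - Apow (D' k)" "?a - Apow (D k)"] by simp
    then have "r * norm w \<le> r * (2 * \<epsilon>' * nA h)" using r by (simp add: nk algebra_simps)
    then have "norm w \<le> 2 * \<epsilon>' * nA h" using r by simp
    then show ?thesis using \<epsilon>' by simp
  qed
  then have "norm w \<le> 0" by (rule field_le_epsilon) simp
  then have "Apow (D h) = Apow (D' h)" using QDd[OF h] by (simp add: w_def Apow_diff)
  then show ?thesis using QDd[OF h] by (metis A_inv_Apow)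
qed

lemma deriv_on_eq:
  assumes "has_deriv_on PD nA QD nA f D x" "x \<in> PD" "h \<in> PD"
  shows "deriv_on PD nA QD nA f x h = D h"
  unfolding deriv_on_def
  by (rule has_deriv_on_unique[OF someI[of "\<lambda>D. has_deriv_on PD nA QD nA f D x", OF assms(1)] assms])

text \<open>The map of the theorem is identified with \<open>graph_map\<close> only on
  \<open>PD\<close>. As \<open>PD\<close> is a subspace, increments taken from one of its points
  never leave it.\<close>

lemma has_deriv_on_cong:
  assumes "has_deriv_on PD nA QD nA f D x" "x \<in> PD" "\<And>u. u \<in> PD \<Longrightarrow> g u = f u"
  shows "has_deriv_on PD nA QD nA g D x"
proof -
  have "x + h \<in> PD" if "h \<in> PD" for h using PD_lincomb[OF assms(2) that, of 1 1] by simp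
  then show ?thesis
    using assms unfolding has_deriv_on_def by (simp add: image_subset_iff)
qed

end

section \<open>The graph map of a driving path\<close>

text \<open>The regularity shared by continuous paths and their compositions with monotone time
  changes. The exceptional times form a null set and do not affect integrals.\<close>

definition nearly_continuous :: "(real \<Rightarrow> 'b::t2_space) \<Rightarrow> bool" where
  "nearly_continuous x \<longleftrightarrow> (\<exists>D. countable D \<and> (\<forall>s. s \<notin> D \<longrightarrow> isCont x s))"

locale lipschitz_gap = inertial_gap +
  fixes F :: "'a \<Rightarrow> 'a"
  assumes F_0: "F 0 = 0"
    and F_Lipschitz: "\<And>u1 u2. u1 \<in> dom_A_pow e lam \<sigma> \<Longrightarrow> u2 \<in> dom_A_pow e lam \<sigma> \<Longrightarrow>
           norm (F u1 - F u2) \<le> L * norm_A e lam \<sigma> (u1 - u2)"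
begin

text \<open>The nonlinearity as seen from the ambient norm, in which it is globally Lipschitz with
  the same \<open>L\<close>.\<close>

definition "Fh v = F (A_inv v)"

lemma Fh_lipschitz: "norm (Fh u - Fh v) \<le> L * norm (u - v)"
  using F_Lipschitz[OF A_inv_dom A_inv_dom, of u v] by (simp add: Fh_def flip: A_inv_diff)

lemma Fh_0 [simp]: "Fh 0 = 0"
  by (simp add: Fh_def A_inv_0 F_0)

lemma Fh_tendsto: "(f \<longlongrightarrow> v) \<F> \<Longrightarrow> ((\<lambda>n. Fh (f n)) \<longlongrightarrow> Fh v) \<F>"
proof (rule LIM_zero_cancel, rule Lim_null_comparison)
  assume "(f \<longlongrightarrow> v) \<F>"
  then have "((\<lambda>n. L * norm (f n - v)) \<longlongrightarrow> L * norm (v - v)) \<F>" by (intro tendsto_intros)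
  then show "((\<lambda>n. L * norm (f n - v)) \<longlongrightarrow> 0) \<F>" by simp
qed (simp add: Fh_lipschitz)

definition Phi :: "(real \<Rightarrow> real) \<Rightarrow> real \<Rightarrow> 'a \<Rightarrow> 'a" where
  "Phi x s v = exp (- (x s - \<beta> * s)) *\<^sub>R Fh (exp (x s - \<beta> * s) *\<^sub>R v)"

lemma admissible_Phi:
  assumes "nearly_continuous x"
  shows "admissible (Phi x)"
proof -
  obtain D where D: "countable D" "\<And>s. s \<notin> D \<Longrightarrow> isCont x s" using assms by (auto simp: nearly_continuous_def)
  have "norm (Phi x s u - Phi x s v) \<le> L * norm (u - v)" for s u v
  proof -
    let ?c = "exp (x s - \<beta> * s)"
    have "norm (Phi x s u - Phi x s v) = exp (- (x s - \<beta> * s)) * norm (Fh (?c *\<^sub>R u) - Fh (?c *\<^sub>R v))"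
      unfolding Phi_def by (simp flip: scaleR_diff_right)
    also have "\<dots> \<le> exp (- (x s - \<beta> * s)) * (L * norm (?c *\<^sub>R u - ?c *\<^sub>R v))"
      by (intro mult_left_mono Fh_lipschitz) simp
    also have "norm (?c *\<^sub>R u - ?c *\<^sub>R v) = ?c * norm (u - v)"
      by (simp flip: scaleR_diff_right)
    also have "exp (- (x s - \<beta> * s)) * (L * (?c * norm (u - v))) = L * norm (u - v)"
      by (simp flip: exp_add)
    finally show ?thesis .
  qed
  moreover have "isCont (\<lambda>s. Phi x s u) s" if "s \<notin> D" for s u
    using D(2)[OF that] unfolding isCont_def Phi_def by (intro tendsto_intros Fh_tendsto)
  ultimately show ?thesis
    using D(1) unfolding admissible_def by (auto simp: Phi_def)
qed

definition "orbit x \<xi> = (THE \<phi>. lp_sol (Phi x) \<xi> \<phi>)"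

lemma orbit_eqI: "nearly_continuous x \<Longrightarrow> lp_sol (Phi x) \<xi> \<phi> \<Longrightarrow> orbit x \<xi> = \<phi>"
  unfolding orbit_def by (rule the_equality) (auto intro: lp_sol_unique[OF admissible_Phi])

lemma orbit: "nearly_continuous x \<Longrightarrow> lp_sol (Phi x) \<xi> (orbit x \<xi>)"
  using lp_sol_exists[OF admissible_Phi] orbit_eqI by metis

text \<open>The manifold in the substituted coordinates. It is meaningful for every nearly
  continuous path, in particular for limits of good paths, which need not be tempered. The factors
  \<open>exp (zeta x)\<close> are absent because they cancel the prefactor of the substitution at
  time 0.\<close>

definition "graph_map x \<xi> = A_inv (QQ (orbit x (Apow \<xi>) 0))"

lemma orbit_tendsto:
  assumes "\<And>n. nearly_continuous (xn n)" "nearly_continuous x" "\<And>s. s \<le> 0 \<Longrightarrow> (\<lambda>n. xn n s) \<longlonglongrightarrow> x s"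
  shows "(\<lambda>n. orbit (xn n) \<xi> t) \<longlonglongrightarrow> orbit x \<xi> t"
  by (rule lp_sol_tendsto[OF admissible_Phi admissible_Phi orbit orbit])
     (use assms in \<open>auto simp: Phi_def intro!: tendsto_intros Fh_tendsto\<close>)

lemma nA_QQ_diff: "nA (A_inv (QQ u) - A_inv (QQ v)) \<le> norm (u - v)"
  using norm_QQ[of "u - v"] by (simp add: QQ_diff flip: A_inv_diff)

lemma graph_map_tendsto:
  assumes "\<And>n. nearly_continuous (xn n)" "nearly_continuous x" "\<And>s. s \<le> 0 \<Longrightarrow> (\<lambda>n. xn n s) \<longlonglongrightarrow> x s"
  shows "(\<lambda>n. nA (graph_map (xn n) \<xi> - graph_map x \<xi>)) \<longlonglongrightarrow> 0"
proof (rule Lim_null_comparison)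
  show "\<forall>\<^sub>F n in sequentially. norm (nA (graph_map (xn n) \<xi> - graph_map x \<xi>))
      \<le> norm (orbit (xn n) (Apow \<xi>) 0 - orbit x (Apow \<xi>) 0)"
    using nA_QQ_diff by (auto simp: graph_map_def norm_A_def)
  show "(\<lambda>n. norm (orbit (xn n) (Apow \<xi>) 0 - orbit x (Apow \<xi>) 0)) \<longlonglongrightarrow> 0"
    using orbit_tendsto[OF assms, where t=0] by (intro tendsto_norm_zero LIM_zero)
qed

end

text \<open>\<open>Dh\<close> is the derivative of the transported nonlinearity. Continuity in the
  strong sense, for each fixed \<open>h\<close>, is enough because the final operator norm is taken
  over the finite-dimensional \<open>PD\<close>. The bound by \<open>L\<close> gives the linearized
  equation the same contraction factor.\<close>

locale C1_gap = lipschitz_gap +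
  fixes Dh :: "'a \<Rightarrow> 'a \<Rightarrow> 'a"
  assumes Dh_lincomb: "\<And>v a b h k. Dh v (a *\<^sub>R h + b *\<^sub>R k) = a *\<^sub>R Dh v h + b *\<^sub>R Dh v k"
    and Dh_norm: "\<And>v h. norm (Dh v h) \<le> L * norm h"
    and Dh_deriv: "\<And>v \<epsilon>. \<epsilon> > 0 \<Longrightarrow> \<exists>\<delta>>0. \<forall>h. norm h < \<delta> \<longrightarrow> norm (Fh (v + h) - Fh v - Dh v h) \<le> \<epsilon> * norm h"
    and Dh_seq: "\<And>f v h. f \<longlonglongrightarrow> v \<Longrightarrow> (\<lambda>n. Dh (f n) h) \<longlonglongrightarrow> Dh v h"
begin

lemma Dh_diff: "Dh v (h - k) = Dh v h - Dh v k"
  using Dh_lincomb[of v 1 h "- 1" k] by simp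

text \<open>Derivative of \<open>Phi x s\<close> along the curve \<open>\<phi>\<close>. The two
  scalar factors cancel by linearity, so only the base point still depends on the path
  \<open>x\<close>.\<close>

definition Psi :: "(real \<Rightarrow> real) \<Rightarrow> (real \<Rightarrow> 'a) \<Rightarrow> real \<Rightarrow> 'a \<Rightarrow> 'a" where
  "Psi x \<phi> s v = Dh (exp (x s - \<beta> * s) *\<^sub>R \<phi> s) v"

lemma admissible_Psi:
  assumes "nearly_continuous x" "bcont \<phi>"
  shows "admissible (Psi x \<phi>)"
proof -
  obtain D where D: "countable D" "\<And>s. s \<notin> D \<Longrightarrow> isCont x s" using assms by (auto simp: nearly_continuous_def)
  have \<phi>: "isCont \<phi> s" for s using assms by (simp add: bcont_def continuous_on_eq_continuous_at)
  have "isCont (\<lambda>s. Psi x \<phi> s u) s" if "s \<notin> D" for s u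
    unfolding continuous_at_sequentially comp_def
  proof (intro allI impI)
    fix X assume X: "X \<longlonglongrightarrow> s"
    show "(\<lambda>n. Psi x \<phi> (X n) u) \<longlonglongrightarrow> Psi x \<phi> s u"
      unfolding Psi_def
      by (intro Dh_seq tendsto_intros isCont_tendsto_compose[OF D(2)[OF that] X]
           isCont_tendsto_compose[OF \<phi> X] X)
  qed
  moreover have "Psi x \<phi> s 0 = 0" for s using Dh_lincomb[of _ 0 0 0 0] by (simp add: Psi_def)
  moreover have "norm (Psi x \<phi> s u - Psi x \<phi> s v) \<le> L * norm (u - v)" for s u v
    unfolding Psi_def using Dh_norm by (simp flip: Dh_diff)
  ultimately show ?thesis using D(1) unfolding admissible_def by blast
qed

definition "orbit_deriv x \<xi> h = (THE \<eta>. lp_sol (Psi x (orbit x \<xi>)) h \<eta>)"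

lemma admissible_Psi_orbit: "nearly_continuous x \<Longrightarrow> admissible (Psi x (orbit x \<xi>))"
  by (rule admissible_Psi[OF _ lp_sol_bcont[OF orbit]])

lemma orbit_deriv_eqI: "nearly_continuous x \<Longrightarrow> lp_sol (Psi x (orbit x \<xi>)) h \<eta> \<Longrightarrow> orbit_deriv x \<xi> h = \<eta>"
  unfolding orbit_deriv_def by (rule the_equality) (auto intro: lp_sol_unique[OF admissible_Psi_orbit])

lemma orbit_deriv: "nearly_continuous x \<Longrightarrow> lp_sol (Psi x (orbit x \<xi>)) h (orbit_deriv x \<xi> h)"
  using lp_sol_exists[OF admissible_Psi_orbit] orbit_deriv_eqI by metis

lemma orbit_deriv_lincomb:
  assumes "nearly_continuous x"
  shows "orbit_deriv x \<xi> (a *\<^sub>R h + b *\<^sub>R k) t = a *\<^sub>R orbit_deriv x \<xi> h t + b *\<^sub>R orbit_deriv x \<xi> k t"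
proof -
  have "lp_sol (Psi x (orbit x \<xi>)) (a *\<^sub>R h + b *\<^sub>R k) (\<lambda>t. a *\<^sub>R orbit_deriv x \<xi> h t + b *\<^sub>R orbit_deriv x \<xi> k t)"
    by (rule lp_sol_lincomb[OF admissible_Psi_orbit _ orbit_deriv orbit_deriv]) (use assms in \<open>auto simp: Psi_def Dh_lincomb\<close>)
  from orbit_deriv_eqI[OF assms this] show ?thesis by simp
qed

lemma orbit_deriv_tendsto:
  assumes "\<And>n. nearly_continuous (xn n)" "nearly_continuous x" "\<And>s. s \<le> 0 \<Longrightarrow> (\<lambda>n. xn n s) \<longlonglongrightarrow> x s"
  shows "(\<lambda>n. orbit_deriv (xn n) \<xi> h t) \<longlonglongrightarrow> orbit_deriv x \<xi> h t"
proof (rule lp_sol_tendsto[OF admissible_Psi_orbit admissible_Psi_orbit orbit_deriv orbit_deriv])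
  fix s :: real assume "s \<le> 0"
  then show "(\<lambda>n. Psi (xn n) (orbit (xn n) \<xi>) s (orbit_deriv x \<xi> h s)) \<longlonglongrightarrow> Psi x (orbit x \<xi>) s (orbit_deriv x \<xi> h s)"
    unfolding Psi_def by (intro Dh_seq tendsto_intros assms orbit_tendsto[OF assms]) auto
qed (use assms in auto)

text \<open>At each fixed time \<open>s\<close> the increment, scaled by
  \<open>exp (x s - \<beta> * s)\<close>, eventually enters the neighbourhood supplied by the
  derivative. The scale varies with \<open>s\<close>, so this smallness is pointwise in time, as the
  convolution inequality permits.\<close>

lemma orbit_deriv_remainder:
  assumes x: "nearly_continuous x" and h: "h \<longlonglongrightarrow> 0" "\<And>n. h n \<noteq> 0" and t: "t \<le> 0"
  shows "(\<lambda>n. norm (orbit x (\<xi> + h n) t - orbit x \<xi> t - orbit_deriv x \<xi> (h n) t) / norm (h n)) \<longlonglongrightarrow> 0"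
proof (rule lp_sol_deriv_tendsto[OF admissible_Phi[OF x] admissible_Psi_orbit[OF x] orbit[OF x] orbit[OF x] orbit_deriv[OF x] h(2) _ t])
  fix s :: real
  let ?c = "exp (x s - \<beta> * s)"
  let ?w = "\<lambda>n. orbit x (\<xi> + h n) s - orbit x \<xi> s"
  let ?r = "\<lambda>n. Phi x s (orbit x (\<xi> + h n) s) - Phi x s (orbit x \<xi> s) - Psi x (orbit x \<xi>) s (?w n)"
  define v where "v = ?c *\<^sub>R orbit x \<xi> s"
  have w: "norm (?w n) \<le> norm (h n) / (1 - \<mu>)" for n
    using lp_sol_lipschitz[OF admissible_Phi[OF x] orbit[OF x] orbit[OF x], of "\<xi> + h n" s \<xi>] by simp
  show "(\<lambda>n. norm (?r n) / norm (h n)) \<longlonglongrightarrow> 0"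
  proof (rule LIMSEQ_I)
    fix r :: real assume r: "0 < r"
    \<comment> \<open>The orbit increment is at most \<open>norm (h n) / (1 - \<mu>)\<close>; the
      factor \<open>1 - \<mu>\<close> undoes this, and the 2 makes the final inequality
      strict.\<close>
    define \<epsilon> where "\<epsilon> = r * (1 - \<mu>) / 2"
    have \<epsilon>: "\<epsilon> > 0" using r mu by (simp add: \<epsilon>_def)
    obtain \<delta> where \<delta>: "\<delta> > 0" "\<And>k. norm k < \<delta> \<Longrightarrow> norm (Fh (v + k) - Fh v - Dh v k) \<le> \<epsilon> * norm k"
      using Dh_deriv[OF \<epsilon>, of v] by blast
    have "(\<lambda>n. ?c * (norm (h n) / (1 - \<mu>))) \<longlonglongrightarrow> ?c * (norm (0::'a) / (1 - \<mu>))"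
      using mu by (intro tendsto_intros h(1)) auto
    then have "\<forall>\<^sub>F n in sequentially. ?c * (norm (h n) / (1 - \<mu>)) < \<delta>"
      using \<delta> by (intro order_tendstoD) auto
    then obtain n0 where n0: "\<And>n. n \<ge> n0 \<Longrightarrow> ?c * (norm (h n) / (1 - \<mu>)) < \<delta>"
      by (auto simp: eventually_sequentially)
    have "norm (norm (?r n) / norm (h n) - 0) < r"
      if n: "n \<ge> n0" for n
    proof -
      have nk: "norm (?c *\<^sub>R ?w n) \<le> ?c * (norm (h n) / (1 - \<mu>))"
        unfolding norm_scaleR using w[of n] by (intro mult_mono) auto
      have "exp (- (x s - \<beta> * s)) *\<^sub>R Dh v (?c *\<^sub>R ?w n) = Psi x (orbit x \<xi>) s (?w n)"
        using Dh_lincomb[of v ?c "?w n" 0 0] by (simp add: Psi_def v_def flip: exp_add)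
      then have eq: "Phi x s (orbit x (\<xi> + h n) s) - Phi x s (orbit x \<xi> s) - Psi x (orbit x \<xi>) s (?w n)
          = exp (- (x s - \<beta> * s)) *\<^sub>R (Fh (v + ?c *\<^sub>R ?w n) - Fh v - Dh v (?c *\<^sub>R ?w n))"
        unfolding Phi_def v_def scaleR_diff_right by simp
      have "norm (?r n)
          \<le> exp (- (x s - \<beta> * s)) * (\<epsilon> * norm (?c *\<^sub>R ?w n))"
        unfolding eq norm_scaleR[of "exp (- (x s - \<beta> * s))"] abs_exp_cancel
        by (rule mult_left_mono[OF \<delta>(2)]) (use nk n0[OF n] in linarith, simp)
      also have "\<dots> \<le> exp (- (x s - \<beta> * s)) * (\<epsilon> * (?c * (norm (h n) / (1 - \<mu>))))"
        using nk \<epsilon> by (intro mult_left_mono) auto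
      also have "\<dots> = (exp (- (x s - \<beta> * s)) * ?c) * (\<epsilon> * (norm (h n) / (1 - \<mu>)))"
        by (simp only: mult_ac)
      also have "exp (- (x s - \<beta> * s)) * ?c = 1" by (simp flip: exp_add)
      also have "1 * (\<epsilon> * (norm (h n) / (1 - \<mu>))) = r / 2 * norm (h n)"
        using mu unfolding \<epsilon>_def by (simp add: field_simps)
      finally have "norm (?r n) / norm (h n) \<le> r / 2"
        using h(2)[of n] by (simp add: divide_le_eq)
      then have "norm (?r n) / norm (h n) < r"
        using r by linarith
      then show ?thesis by simp
    qed
    then show "\<exists>n0. \<forall>n\<ge>n0. norm (norm (?r n) / norm (h n) - 0) < r"
      by blast
  qed
qed

definition "graph_deriv x \<xi> h = A_inv (QQ (orbit_deriv x (Apow \<xi>) (Apow h) 0))"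

lemma graph_map_has_deriv:
  assumes x: "nearly_continuous x" and \<xi>: "\<xi> \<in> PD"
  shows "has_deriv_on PD nA QD nA (graph_map x) (graph_deriv x \<xi>) \<xi>"
  unfolding has_deriv_on_def
proof (intro conjI allI ballI impI)
  show "graph_map x ` PD \<subseteq> QD" "graph_deriv x \<xi> ` PD \<subseteq> QD"
    using A_inv_QQ_QD by (auto simp: graph_map_def graph_deriv_def)
  show "graph_deriv x \<xi> (a *\<^sub>R h + b *\<^sub>R k) = a *\<^sub>R graph_deriv x \<xi> h + b *\<^sub>R graph_deriv x \<xi> k"
    if "h \<in> PD" "k \<in> PD" for h k a b
    using that by (simp add: graph_deriv_def Apow_lincomb PD_dom orbit_deriv_lincomb[OF x] QQ_lincomb A_inv_add A_inv_scaleR)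
  show "\<exists>K. \<forall>h\<in>PD. nA (graph_deriv x \<xi> h) \<le> K * nA h"
  proof (intro exI ballI)
    fix h
    have "nA (graph_deriv x \<xi> h) \<le> norm (orbit_deriv x (Apow \<xi>) (Apow h) 0)" by (simp add: graph_deriv_def norm_QQ)
    also have "\<dots> \<le> norm (Apow h) / (1 - \<mu>)" by (rule lp_sol_bound[OF admissible_Psi_orbit[OF x] orbit_deriv[OF x]])
    finally show "nA (graph_deriv x \<xi> h) \<le> (1 / (1 - \<mu>)) * nA h" by (simp add: norm_A_def)
  qed
  fix \<epsilon> :: real assume \<epsilon>: "\<epsilon> > 0"
  let ?R = "\<lambda>v. norm (orbit x (Apow \<xi> + v) 0 - orbit x (Apow \<xi>) 0 - orbit_deriv x (Apow \<xi>) v 0)"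
  have "\<exists>\<delta>>0. \<forall>v. norm v < \<delta> \<longrightarrow> ?R v \<le> \<epsilon> * norm v"
  \<comment> \<open>The remainder estimate is available along sequences. A failure at every radius
    1/(n+1) would provide one, and its members are nonzero because the remainder vanishes at
    0.\<close>
  proof (rule ccontr)
    assume "\<not> ?thesis"
    then have "\<forall>\<delta>>0. \<exists>v. norm v < \<delta> \<and> ?R v > \<epsilon> * norm v" by (metis not_le)
    then have "\<exists>v. norm v < inverse (Suc n) \<and> ?R v > \<epsilon> * norm v" for n :: nat by simp
    then obtain v where v: "\<And>n. norm (v n) < inverse (Suc n)" "\<And>n. ?R (v n) > \<epsilon> * norm (v n)"
      by metis
    have "orbit_deriv x (Apow \<xi>) 0 0 = 0" using orbit_deriv_lincomb[OF x, of "Apow \<xi>" 0 0 0 0 0] by simp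
    then have v0: "v n \<noteq> 0" for n using v(2)[of n] by auto
    have "(\<lambda>n. v n) \<longlonglongrightarrow> 0"
      by (rule Lim_null_comparison[OF always_eventually LIMSEQ_inverse_real_of_nat])
        (intro allI less_imp_le v(1))
    then have "(\<lambda>n. ?R (v n) / norm (v n)) \<longlonglongrightarrow> 0" by (rule orbit_deriv_remainder[OF x _ v0]) simp
    then have "\<forall>\<^sub>F n in sequentially. ?R (v n) / norm (v n) < \<epsilon>" using \<epsilon> by (intro order_tendstoD) auto
    then obtain n where "?R (v n) / norm (v n) < \<epsilon>" by (auto simp: eventually_sequentially)
    then show False using v(2)[of n] v0[of n] by (simp add: divide_less_eq)
  qed
  then obtain \<delta> where \<delta>: "\<delta> > 0" "\<And>v. norm v < \<delta> \<Longrightarrow> ?R v \<le> \<epsilon> * norm v" by blast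
  show "\<exists>\<delta>>0. \<forall>h\<in>PD. nA h < \<delta> \<longrightarrow> nA (graph_map x (\<xi> + h) - graph_map x \<xi> - graph_deriv x \<xi> h) \<le> \<epsilon> * nA h"
  proof (intro exI conjI ballI impI)
    fix h assume h: "h \<in> PD" "nA h < \<delta>"
    have "graph_map x (\<xi> + h) - graph_map x \<xi> - graph_deriv x \<xi> h = A_inv (QQ (orbit x (Apow \<xi> + Apow h) 0 - orbit x (Apow \<xi>) 0 - orbit_deriv x (Apow \<xi>) (Apow h) 0))"
      using h(1) \<xi> by (simp add: graph_map_def graph_deriv_def Apow_add PD_dom QQ_diff A_inv_diff)
    then have "nA (graph_map x (\<xi> + h) - graph_map x \<xi> - graph_deriv x \<xi> h) \<le> ?R (Apow h)"
      by (simp add: norm_QQ)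
    also have "\<dots> \<le> \<epsilon> * nA h" using \<delta>(2)[of "Apow h"] h by (simp add: norm_A_def)
    finally show "nA (graph_map x (\<xi> + h) - graph_map x \<xi> - graph_deriv x \<xi> h) \<le> \<epsilon> * nA h" .
  qed (rule \<delta>(1))
qed

text \<open>A vector of \<open>PD\<close> with norm at most 1 has \<open>N\<close> coefficients of
  modulus at most 1, so linearity reduces the operator norm to finitely many values at basis
  vectors. This is where strong convergence becomes convergence in norm.\<close>

lemma graph_deriv_op_norm_le:
  assumes x: "nearly_continuous x" "nearly_continuous x'"
  shows "op_norm_on PD nA nA (\<lambda>h. graph_deriv x \<xi> h - graph_deriv x' \<xi> h)
    \<le> (\<Sum>k=1..N. norm (orbit_deriv x (Apow \<xi>) (e k) 0 - orbit_deriv x' (Apow \<xi>) (e k) 0))"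
  unfolding op_norm_on_def
proof (rule cSUP_least)
  have "nA 0 = 0" using nA_A_inv[of 0] by (simp add: A_inv_0)
  then have "0 \<in> {h \<in> PD. nA h \<le> 1}" using PD_0 by simp
  then show "{h \<in> PD. nA h \<le> 1} \<noteq> {}" by blast
  fix h assume "h \<in> {h \<in> PD. nA h \<le> 1}"
  then have h: "h \<in> PD" "norm (Apow h) \<le> 1" by (auto simp: norm_A_def)
  define v where "v = Apow h"
  have v: "v = (\<Sum>k=1..N. (v \<bullet> e k) *\<^sub>R e k)"
    using PD_PP_Apow[OF h(1)] by (simp add: v_def proj_P_def)
  have dsum: "orbit_deriv y \<xi>' (\<Sum>k\<in>A. c k *\<^sub>R e k) 0 = (\<Sum>k\<in>A. c k *\<^sub>R orbit_deriv y \<xi>' (e k) 0)"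
    if y: "nearly_continuous y" and "finite A" for y \<xi>' c and A :: "nat set"
    using \<open>finite A\<close>
  proof (induction A rule: finite_induct)
    case empty
    show ?case using orbit_deriv_lincomb[OF y, of \<xi>' 0 0 0 0 0] by simp
  next
    case (insert j B)
    then show ?case using orbit_deriv_lincomb[OF y, of \<xi>' "c j" "e j" 1 "\<Sum>k\<in>B. c k *\<^sub>R e k" 0] by simp
  qed
  have "nA (graph_deriv x \<xi> h - graph_deriv x' \<xi> h) \<le> norm (orbit_deriv x (Apow \<xi>) v 0 - orbit_deriv x' (Apow \<xi>) v 0)"
    using nA_QQ_diff by (simp add: graph_deriv_def v_def)
  also have "orbit_deriv x (Apow \<xi>) v 0 - orbit_deriv x' (Apow \<xi>) v 0
     = (\<Sum>k=1..N. (v \<bullet> e k) *\<^sub>R (orbit_deriv x (Apow \<xi>) (e k) 0 - orbit_deriv x' (Apow \<xi>) (e k) 0))"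
    by (subst (1 2) v) (simp add: dsum x sum_subtractf scaleR_diff_right)
  also have "norm \<dots> \<le> (\<Sum>k=1..N. norm (orbit_deriv x (Apow \<xi>) (e k) 0 - orbit_deriv x' (Apow \<xi>) (e k) 0))"
  proof (rule sum_norm_le)
    fix k assume k: "k \<in> {1..N}"
    have "\<bar>v \<bullet> e k\<bar> \<le> norm v * norm (e k)" by (rule Cauchy_Schwarz_ineq2)
    also have "norm (e k) = 1" using k orthonormal[of k k] by (simp add: norm_eq_sqrt_inner)
    finally have "\<bar>v \<bullet> e k\<bar> \<le> 1" using h(2) by (simp add: v_def)
    then show "norm ((v \<bullet> e k) *\<^sub>R (orbit_deriv x (Apow \<xi>) (e k) 0 - orbit_deriv x' (Apow \<xi>) (e k) 0))
       \<le> norm (orbit_deriv x (Apow \<xi>) (e k) 0 - orbit_deriv x' (Apow \<xi>) (e k) 0)"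
      by (simp add: mult_left_le_one_le)
  qed
  finally show "nA (graph_deriv x \<xi> h - graph_deriv x' \<xi> h)
    \<le> (\<Sum>k=1..N. norm (orbit_deriv x (Apow \<xi>) (e k) 0 - orbit_deriv x' (Apow \<xi>) (e k) 0))" .
qed

end

section \<open>The stationary Ornstein-Uhlenbeck path\<close>

lemma exp_integral_lessThan_0:
  fixes a :: real
  assumes "a > 0"
  shows "set_integrable lborel {..<0} (\<lambda>s. exp (a * s))"
    and "(LBINT s:{..<0}. exp (a * s)) = 1 / a"
proof -
  have z: "(\<lambda>s. exp (a * s) / a) \<midarrow>0\<rightarrow> 1 / a"
    using assms by (intro tendsto_eq_intros) auto
  have "filterlim (\<lambda>s::real. a * s) at_bot at_bot"
    using assms by (intro filterlim_tendsto_pos_mult_at_bot[OF tendsto_const] filterlim_ident)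
  then have "((\<lambda>s. exp (a * s)) \<longlongrightarrow> 0) at_bot"
    by (rule filterlim_compose[OF exp_at_bot])
  then have l: "((\<lambda>s. exp (a * s) / a) \<longlongrightarrow> 0 / a) at_bot"
    using assms by (intro tendsto_intros) auto
  have e: "einterval (- \<infinity>) 0 = {..<0::real}" by (simp add: zero_ereal_def)
  note F = interval_integral_FTC_nonneg[of "- \<infinity>" 0 "\<lambda>s. exp (a * s) / a" "\<lambda>s. exp (a * s)" 0 "1 / a"]
  have "set_integrable lborel (einterval (- \<infinity>) 0) (\<lambda>s. exp (a * s))"
       "(LBINT s=-\<infinity>..0. exp (a * s)) = 1 / a - 0"
    using l z assms
    by (intro F; auto simp: zero_ereal_def ereal_tendsto_simps filterlim_at_split
          intro!: derivative_eq_intros)+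
  then show "set_integrable lborel {..<0} (\<lambda>s. exp (a * s))"
    "(LBINT s:{..<0}. exp (a * s)) = 1 / a"
    by (simp_all add: e interval_lebesgue_integral_def)
qed

text \<open>The properties of a good path that are used: temperedness enters only through the
  weighted integrability, which makes the average below finite.\<close>

definition driving_path :: "(real \<Rightarrow> real) \<Rightarrow> bool" where
  "driving_path x \<longleftrightarrow> x 0 = 0 \<and> nearly_continuous x \<and> integrable lborel (\<lambda>s. indicator {..0} s * (exp s * x s))"

text \<open>The inner cut at 0 restricts to the past, the only part of the path in use. For
  \<open>t \<le> 0\<close> this is the integral of \<open>exp s * x s\<close> up to
  \<open>t\<close>.\<close>

definition exp_primitive :: "(real \<Rightarrow> real) \<Rightarrow> real \<Rightarrow> real" where
  "exp_primitive x t = (LBINT s. indicator {..t} s * (indicator {..0} s * (exp s * x s)))"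

text \<open>For \<open>t \<le> 0\<close> this is the average y(t), in a form that shows continuity
  in \<open>t\<close> even where the path jumps.\<close>

definition exp_avg :: "(real \<Rightarrow> real) \<Rightarrow> real \<Rightarrow> real" where
  "exp_avg x t = exp (- t) * exp_primitive x t"

lemma exp_primitive_integrable:
  assumes "driving_path x" "A \<in> sets borel"
  shows "integrable lborel (\<lambda>s. indicator A s * (indicator {..0} s * (exp s * x s)))"
  using integrable_mult_indicator[of A lborel "\<lambda>s. indicator {..0} s * (exp s * x s)"] assms
  by (simp add: driving_path_def)

lemma nearly_continuous_measurable:
  fixes x :: "real \<Rightarrow> real"
  assumes "nearly_continuous x"
  shows "x \<in> borel_measurable borel"
proof -
  obtain D where D: "countable D" "\<And>s. s \<notin> D \<Longrightarrow> isCont x s" using assms by (auto simp: nearly_continuous_def)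
  then show ?thesis
    by (intro borel_measurable_continuous_countable_exceptions[OF D(1)] continuous_at_imp_continuous_on) auto
qed

lemma isCont_exp_primitive:
  assumes x: "driving_path x"
  shows "isCont (exp_primitive x) t"
  unfolding continuous_at_sequentially comp_def
proof (intro allI impI)
  fix X assume X: "X \<longlonglongrightarrow> t"
  show "(\<lambda>n. exp_primitive x (X n)) \<longlonglongrightarrow> exp_primitive x t"
    unfolding exp_primitive_def
  proof (rule integral_dominated_convergence[where w="\<lambda>s. norm (indicator {..0} s * (exp s * x s))"])
    show "integrable lborel (\<lambda>s. norm (indicator {..0} s * (exp s * x s)))"
      using x by (intro integrable_norm) (simp add: driving_path_def)
    show "AE s in lborel. (\<lambda>n. indicator {..X n} s * (indicator {..0} s * (exp s * x s)))
       \<longlonglongrightarrow> indicator {..t} s * (indicator {..0} s * (exp s * x s))"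
      using AE_lborel_singleton[of t]
    proof eventually_elim
      case (elim s)
      have "\<forall>\<^sub>F n in sequentially. indicator {..X n} s = (indicator {..t} s :: real)"
      proof (cases "s < t")
        case True
        then have "\<forall>\<^sub>F n in sequentially. s < X n" using X by (intro order_tendstoD)
        then show ?thesis by eventually_elim (use True in auto)
      next
        case False
        then have "\<forall>\<^sub>F n in sequentially. X n < s" using X elim by (intro order_tendstoD) auto
        then show ?thesis by eventually_elim (use False elim in auto)
      qed
      then have "(\<lambda>n. indicator {..X n} s :: real) \<longlonglongrightarrow> indicator {..t} s" by (rule tendsto_eventually)
      then show ?case by (intro tendsto_intros)
    qed
    show "AE s in lborel. norm (indicator {..X n} s * (indicator {..0} s * (exp s * x s)))
        \<le> norm (indicator {..0} s * (exp s * x s))" for n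
      by (auto simp: indicator_def)
  qed (rule borel_measurable_integrable[OF exp_primitive_integrable[OF x]], simp)+
qed

lemma continuous_exp_avg: "driving_path x \<Longrightarrow> continuous_on A (exp_avg x)"
  unfolding exp_avg_def[abs_def] using isCont_exp_primitive
  by (intro continuous_intros continuous_at_imp_continuous_on) auto

lemma exp_primitive_diff:
  assumes x: "driving_path x" and ab: "a \<le> b"
  shows "(LBINT s. indicator {a..b} s * (indicator {..0} s * (exp s * x s))) = exp_primitive x b - exp_primitive x a"
proof -
  have "exp_primitive x b - exp_primitive x a = (LBINT s. indicator {..b} s * (indicator {..0} s * (exp s * x s))
      - indicator {..a} s * (indicator {..0} s * (exp s * x s)))"
    unfolding exp_primitive_def by (subst Bochner_Integration.integral_diff) (auto intro!: exp_primitive_integrable x)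
  also have "\<dots> = (LBINT s. indicator {a..b} s * (indicator {..0} s * (exp s * x s)))"
  proof (rule integral_cong_AE)
    show "AE s in lborel. indicator {..b} s * (indicator {..0} s * (exp s * x s))
      - indicator {..a} s * (indicator {..0} s * (exp s * x s))
      = indicator {a..b} s * (indicator {..0} s * (exp s * x s))"
      using AE_lborel_singleton[of a] by eventually_elim (use ab in \<open>auto simp: indicator_def\<close>)
  qed (use x nearly_continuous_measurable[of x] in \<open>auto simp: driving_path_def\<close>)
  finally show ?thesis by simp
qed

text \<open>The weight \<open>exp s\<close> has mass 1 on the negative half-line, so the constant
  \<open>x t\<close> subtracted by the shift comes out unchanged. The rest is the translation
  \<open>u = t + s\<close>.\<close>

lemma zeta_shift:
  assumes x: "driving_path x" and t: "t \<le> 0"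
  shows "zeta (shift t x) = x t - exp_avg x t"
proof -
  let ?g = "\<lambda>u. exp (- t) * (indicator {..<t} u * (indicator {..0} u * (exp u * x u)))"
  have g: "?g (t + 1 * s) = indicator {..<0} s * (exp s * x (t + s))" for s
    using t by (auto simp: indicator_def simp flip: exp_add)
  have ig: "integrable lborel ?g" using exp_primitive_integrable[OF x, of "{..<t}"] by simp
  have i1: "integrable lborel (\<lambda>s. indicator {..<0} s * (exp s * x (t + s)))"
    using lborel_integrable_real_affine[OF ig, of 1 t] unfolding g by simp
  have "(LBINT s. indicator {..<0} s * (exp s * x (t + s))) = (LBINT u. ?g u)"
    using lborel_integral_real_affine[of 1 ?g t] unfolding g by simp
  also have "\<dots> = exp (- t) * (LBINT u. indicator {..<t} u * (indicator {..0} u * (exp u * x u)))"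
    by (rule integral_mult_right_zero)
  also have "(LBINT u. indicator {..<t} u * (indicator {..0} u * (exp u * x u))) = exp_primitive x t"
    unfolding exp_primitive_def
  proof (rule integral_cong_AE)
    show "AE s in lborel. indicator {..<t} s * (indicator {..0} s * (exp s * x s))
      = indicator {..t} s * (indicator {..0} s * (exp s * x s))"
      using AE_lborel_singleton[of t] by eventually_elim (auto simp: indicator_def)
  qed (use x nearly_continuous_measurable[of x] in \<open>auto simp: driving_path_def\<close>)
  finally have 1: "(LBINT s. indicator {..<0} s * (exp s * x (t + s))) = exp_avg x t" by (simp add: exp_avg_def)
  have i2: "integrable lborel (\<lambda>s. indicator {..<0} s * exp s :: real)"
    and 2: "(LBINT s. indicator {..<0} s * exp s) = (1::real)"
    using exp_integral_lessThan_0[of 1] by (simp_all add: set_integrable_def set_lebesgue_integral_def)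
  have "zeta (shift t x) = - (LBINT s. indicator {..<0} s * (exp s * x (t + s)) - (indicator {..<0} s * exp s) * x t)"
    by (simp add: zeta_def shift_def interval_lebesgue_integral_def zero_ereal_def
          set_lebesgue_integral_def algebra_simps)
  also have "\<dots> = - (exp_avg x t - x t)"
    using i1 i2 by (subst Bochner_Integration.integral_diff) (simp_all add: 1 2)
  finally show ?thesis by simp
qed

lemma zeta_driving_path: "driving_path x \<Longrightarrow> zeta x = - exp_avg x 0"
  using zeta_shift[of x 0] by (simp add: shift_def[abs_def] driving_path_def)

lemma exp_minus_integral_Icc:
  fixes a b :: real
  assumes "a \<le> b"
  shows "(LBINT r. indicator {a..b} r * exp (- r)) = exp (- a) - exp (- b)"
    and "integrable lborel (\<lambda>r. indicator {a..b} r * exp (- r))"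
proof -
  have "(LBINT r. indicator {a..b} r *\<^sub>R exp (- r)) = - exp (- b) - (- exp (- a))"
    by (rule integral_FTC_atLeastAtMost[OF assms, where F="\<lambda>r. - exp (- r)"])
       (auto intro!: derivative_eq_intros continuous_intros simp flip: has_real_derivative_iff_has_vector_derivative)
  then show "(LBINT r. indicator {a..b} r * exp (- r)) = exp (- a) - exp (- b)" by simp
  have "integrable lborel (\<lambda>r. indicator {a..b} r *\<^sub>R exp (- r))"
    by (intro borel_integrable_compact continuous_intros) auto
  then show "integrable lborel (\<lambda>r. indicator {a..b} r * exp (- r))" by simp
qed

text \<open>The integrated form of $y' = x - y$.\<close>

lemma exp_avg_integral:
  assumes x: "driving_path x" and ab: "a \<le> b" "b \<le> 0"
  shows "(LBINT r:{a..b}. x r - exp_avg x r) = exp_avg x b - exp_avg x a"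
proof -
  define f where "f s = indicator {..0} s * (exp s * x s)" for s
  define I :: "real \<Rightarrow> real" where "I = indicator {a..b}"
  have xm [measurable]: "x \<in> borel_measurable borel"
    using x nearly_continuous_measurable by (auto simp: driving_path_def)
  have f [measurable]: "f \<in> borel_measurable borel" "integrable lborel f"
    using x unfolding f_def[abs_def] by (auto simp: driving_path_def)
  have I [measurable]: "I \<in> borel_measurable borel" by (simp add: I_def)
  have yJm [measurable]: "exp_primitive x \<in> borel_measurable borel"
    using isCont_exp_primitive[OF x] by (intro borel_measurable_continuous_onI continuous_at_imp_continuous_on) auto
  have intA: "integrable lborel (\<lambda>s. indicator A s * f s)" if "A \<in> sets borel" for A
    using exp_primitive_integrable[OF x that] by (simp add: f_def)
  \<comment> \<open>Since the path may jump, y need not be differentiable everywhere. Instead of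
    differentiating, one integrates over the triangle a \<le> s \<le> r \<le> b in both
    orders.\<close>
  define h where "h r s = I r * exp (- r) * (I s * f s) * indicator {s..} r" for r s
  have h_le: "norm (h r s) \<le> I r * exp (- r) * norm (f s)" for r s
    by (auto simp: h_def I_def indicator_def abs_mult)
  have ind: "indicator {s..} r = (if s \<le> r then 1 else 0 :: real)" for r s :: real by auto
  have hm: "(\<lambda>p. h (fst p) (snd p)) \<in> borel_measurable (lborel \<Otimes>\<^sub>M lborel)"
    unfolding h_def ind by measurable
  have hi: "integrable lborel (h r)" for r
  proof (rule Bochner_Integration.integrable_bound)
    show "integrable lborel (\<lambda>s. I r * exp (- r) * norm (f s))"
      using f(2) by (intro integrable_mult_right integrable_norm)
    show "h r \<in> borel_measurable lborel" unfolding h_def[abs_def] ind by measurable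
    show "AE s in lborel. norm (h r s) \<le> norm (I r * exp (- r) * norm (f s))"
      using h_le[of r] by (auto simp: I_def)
  qed
  have int: "integrable (lborel \<Otimes>\<^sub>M lborel) (\<lambda>p. h (fst p) (snd p))"
  proof (rule lborel_pair.Fubini_integrable[OF hm])
    show "AE r in lborel. integrable lborel (\<lambda>s. h (fst (r, s)) (snd (r, s)))" using hi by simp
    show "integrable lborel (\<lambda>r. LBINT s. norm (h (fst (r, s)) (snd (r, s))))"
    proof (rule Bochner_Integration.integrable_bound)
      show "integrable lborel (\<lambda>r. I r * exp (- r) * (LBINT s. norm (f s)))"
        unfolding I_def by (intro integrable_mult_left exp_minus_integral_Icc ab)
      show "(\<lambda>r. LBINT s. norm (h (fst (r, s)) (snd (r, s)))) \<in> borel_measurable lborel"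
        by (intro lborel.borel_measurable_lebesgue_integral)
           (use hm in \<open>simp add: case_prod_beta\<close>)
      show "AE r in lborel. norm (LBINT s. norm (h (fst (r, s)) (snd (r, s))))
         \<le> norm (I r * exp (- r) * (LBINT s. norm (f s)))"
      proof (intro AE_I2)
        fix r
        have "(LBINT s. norm (h r s)) \<le> (LBINT s. I r * exp (- r) * norm (f s))"
          using f(2) by (intro integral_mono integrable_norm hi h_le integrable_mult_right)
        also have "\<dots> = I r * exp (- r) * (LBINT s. norm (f s))" by simp
        finally show "norm (LBINT s. norm (h (fst (r, s)) (snd (r, s))))
         \<le> norm (I r * exp (- r) * (LBINT s. norm (f s)))" by simp
      qed
    qed
  qed
  have Fub: "(LBINT s. (LBINT r. h r s)) = (LBINT r. (LBINT s. h r s))"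
    using lborel_pair.Fubini_integral[of h] int by (simp add: case_prod_beta')
  have inner1: "(LBINT r. h r s) = I s * x s - exp (- b) * (I s * f s)" for s
  proof (cases "s \<in> {a..b}")
    case True
    have "(LBINT r. h r s) = (LBINT r. f s * (indicator {s..b} r * exp (- r)))"
      by (rule Bochner_Integration.integral_cong) (use True in \<open>auto simp: h_def I_def indicator_def\<close>)
    also have "\<dots> = f s * (exp (- s) - exp (- b))"
      using True by (simp add: exp_minus_integral_Icc)
    also have "f s * (exp (- s) - exp (- b)) = x s - exp (- b) * f s"
      using True ab(2) by (simp add: f_def algebra_simps flip: exp_add)
    finally show ?thesis using True by (simp add: I_def)
  qed (simp add: h_def I_def)
  have inner2: "(LBINT s. h r s) = I r * exp (- r) * (exp_primitive x r - exp_primitive x a)" for r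
  proof (cases "r \<in> {a..b}")
    case True
    have "(LBINT s. h r s) = (LBINT s. exp (- r) * (indicator {a..r} s * f s))"
      by (rule Bochner_Integration.integral_cong) (use True in \<open>auto simp: h_def I_def indicator_def\<close>)
    also have "\<dots> = exp (- r) * (exp_primitive x r - exp_primitive x a)"
      using exp_primitive_diff[OF x, of a r] True by (simp add: f_def)
    finally show ?thesis using True by (simp add: I_def)
  qed (simp add: h_def I_def)
  have If: "integrable lborel (\<lambda>s. I s * f s)" unfolding I_def by (rule intA) simp
  have Ix: "integrable lborel (\<lambda>s. I s * x s)"
  proof (rule Bochner_Integration.integrable_bound)
    show "integrable lborel (\<lambda>s. exp (- a) * (I s * f s))" using If by simp
    show "AE s in lborel. norm (I s * x s) \<le> norm (exp (- a) * (I s * f s))"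
    proof (intro AE_I2)
      fix s
      have "\<bar>x s\<bar> \<le> exp (- a) * (exp s * \<bar>x s\<bar>)" if "a \<le> s"
        using mult_right_mono[of 1 "exp (s - a)" "\<bar>x s\<bar>"] that by (simp add: exp_diff exp_minus field_simps)
      then show "norm (I s * x s) \<le> norm (exp (- a) * (I s * f s))"
        using ab by (auto simp: I_def f_def indicator_def abs_mult)
    qed
  qed measurable
  have Iy: "integrable lborel (\<lambda>r. I r * (exp (- r) * exp_primitive x r))"
  proof -
    have "integrable lborel (\<lambda>r. indicator {a..b} r *\<^sub>R (exp (- r) * exp_primitive x r))"
      using isCont_exp_primitive[OF x] by (intro borel_integrable_compact continuous_intros continuous_at_imp_continuous_on) auto
    then show ?thesis by (simp add: I_def)
  qed
  note Ie = exp_minus_integral_Icc[OF ab(1), folded I_def]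
  have "(LBINT s. I s * x s) - exp (- b) * (exp_primitive x b - exp_primitive x a)
     = (LBINT s. I s * x s - exp (- b) * (I s * f s))"
    using If Ix exp_primitive_diff[OF x ab(1)] by (simp add: I_def f_def)
  also have "\<dots> = (LBINT r. I r * (exp (- r) * exp_primitive x r) - exp_primitive x a * (I r * exp (- r)))"
    using Fub unfolding inner1 inner2 by (simp add: algebra_simps)
  also have "\<dots> = (LBINT r. I r * (exp (- r) * exp_primitive x r)) - exp_primitive x a * (exp (- a) - exp (- b))"
    using Iy Ie by simp
  finally have "(LBINT s. I s * x s) - (LBINT r. I r * (exp (- r) * exp_primitive x r))
     = exp (- b) * exp_primitive x b - exp (- a) * exp_primitive x a"
    by (simp add: algebra_simps)
  moreover have "(LBINT r:{a..b}. x r - exp_avg x r) = (LBINT s. I s * x s) - (LBINT r. I r * (exp (- r) * exp_primitive x r))"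
    using Ix Iy by (simp add: set_lebesgue_integral_def I_def exp_avg_def right_diff_distrib)
  ultimately show ?thesis by (simp add: exp_avg_def)
qed

text \<open>The random exponent of the linear flow splits into one factor at each endpoint, which is
  what the substitution exploits. Both orders of the endpoints occur, because the integral over the
  low modes runs backwards.\<close>

lemma zeta_int_eq:
  assumes x: "driving_path x" and "a \<le> 0" "b \<le> 0"
  shows "zeta_int x a b = exp_avg x b - exp_avg x a"
proof -
  have *: "zeta_int x a b = exp_avg x b - exp_avg x a" if "a \<le> b" "b \<le> 0" for a b
  proof -
    have "zeta_int x a b = (LBINT r:{a..b}. zeta (shift r x))"
      unfolding zeta_int_def by (rule interval_integral_Icc[OF that(1)])
    also have "\<dots> = (LBINT r:{a..b}. x r - exp_avg x r)"
      by (rule set_lebesgue_integral_cong) (use that zeta_shift[OF x] in auto)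
    finally show ?thesis using exp_avg_integral[OF x that] by simp
  qed
  show ?thesis
  proof (cases "a \<le> b")
    case False
    have "zeta_int x a b = - zeta_int x b a"
      unfolding zeta_int_def by (rule interval_integral_endpoints_reverse)
    with *[of b a] False assms show ?thesis by simp
  qed (use * assms in simp)
qed

text \<open>Sublinear growth at minus infinity and boundedness on compact intervals give a linear
  majorant of the path, which \<open>exp s\<close> makes integrable.\<close>

lemma driving_pathI:
  assumes "x 0 = 0" "nearly_continuous x" "((\<lambda>t. x t / t) \<longlongrightarrow> 0) at_bot"
    and bdd: "\<And>T. bounded (x ` {T..0})"
  shows "driving_path x"
proof -
  have "\<forall>\<^sub>F t in at_bot. dist (x t / t) 0 < 1"
    by (rule tendstoD[OF assms(3)]) simp
  then obtain T where T: "\<And>t. t \<le> T \<Longrightarrow> \<bar>x t / t\<bar> < 1"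
    by (auto simp: eventually_at_bot_linorder)
  obtain B where B: "\<forall>t\<in>{T..0}. \<bar>x t\<bar> \<le> B" using bdd[of T] by (auto simp: bounded_iff)
  have x: "\<bar>x t\<bar> \<le> \<bar>B\<bar> + \<bar>t\<bar>" if "t \<le> 0" for t
  proof (cases "t \<le> T")
    case True
    with T[OF True] assms(1) have "\<bar>x t\<bar> \<le> \<bar>t\<bar>" by (cases "t = 0") (auto simp: divide_less_eq)
    then show ?thesis by linarith
  next
    case False
    then have "\<bar>x t\<bar> \<le> B" using B that by simp
    then show ?thesis by linarith
  qed
  have "integrable lborel (\<lambda>s. indicator {..0} s * (exp s * x s))"
  proof (rule Bochner_Integration.integrable_bound)
    have "set_integrable lborel {..<0} (\<lambda>s::real. exp (1 / 2 * s))" by (rule exp_integral_lessThan_0) simp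
    then show "integrable lborel (\<lambda>s. (\<bar>B\<bar> + 2) * (indicator {..<0} s * exp (1 / 2 * s)))"
      by (simp add: set_integrable_def)
    show "(\<lambda>s. indicator {..0} s * (exp s * x s)) \<in> borel_measurable lborel"
      using nearly_continuous_measurable[OF assms(2)] by measurable
    show "AE s in lborel. norm (indicator {..0} s * (exp s * x s))
        \<le> norm ((\<bar>B\<bar> + 2) * (indicator {..<0} s * exp (1 / 2 * s)))"
      using AE_lborel_singleton[of 0]
    proof eventually_elim
      case (elim s)
      show ?case
      proof (cases "s < 0")
        case True
        \<comment> \<open>Half of the exponential weight is spent on the factor
          \<open>\<bar>s\<bar>\<close>, leaving \<open>exp (1 / 2 * s)\<close> for
          integrability.\<close>
        have "\<bar>s\<bar> \<le> 2 * exp (- (1 / 2 * s))" using exp_ge_add_one_self[of "- (1 / 2 * s)"] True by linarith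
        then have "exp s * \<bar>s\<bar> \<le> exp s * (2 * exp (- (1 / 2 * s)))" by (intro mult_left_mono) auto
        also have "\<dots> = 2 * exp (1 / 2 * s)" by (simp flip: exp_add)
        finally have 1: "exp s * \<bar>s\<bar> \<le> 2 * exp (1 / 2 * s)" .
        have "exp s * \<bar>B\<bar> \<le> exp (1 / 2 * s) * \<bar>B\<bar>" using True by (intro mult_right_mono) auto
        moreover have "exp s * \<bar>x s\<bar> \<le> exp s * (\<bar>B\<bar> + \<bar>s\<bar>)"
          using True by (intro mult_left_mono x) auto
        ultimately have "exp s * \<bar>x s\<bar> \<le> (\<bar>B\<bar> + 2) * exp (1 / 2 * s)"
          using 1 by (simp add: algebra_simps)
        then show ?thesis using True by (simp add: abs_mult)
      qed (use elim in simp)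
    qed
  qed
  with assms show ?thesis by (simp add: driving_path_def)
qed

text \<open>The path space prescribes only the limit over nonzero times; the value at 0 follows by
  right continuity.\<close>

lemma subordinator_path_0:
  assumes "l \<in> subordinator_paths"
  shows "l 0 = 0"
proof (rule tendsto_unique)
  show "(l \<longlongrightarrow> l 0) (at_right 0)" using assms by (simp add: subordinator_paths_def)
  have "(l \<longlongrightarrow> 0) (at 0)" using assms by (simp add: subordinator_paths_def)
  then show "(l \<longlongrightarrow> 0) (at_right 0)" by (rule tendsto_within_subset) simp
qed simp

lemma good_paths_driving:
  assumes "(w, l) \<in> good_paths"
  shows "driving_path w" "driving_path (w \<circ> l)"
proof -
  have w: "continuous_on UNIV w" "w 0 = 0" and l: "l \<in> subordinator_paths"
    and tw: "tempered_path w" "tempered_path (w \<circ> l)"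
    using assms by (auto simp: good_paths_def wiener_paths_def)
  have wc: "isCont w s" for s using w by (simp add: continuous_on_eq_continuous_at)
  have l_mono: "mono l" using l by (simp add: subordinator_paths_def)
  note l0 = subordinator_path_0[OF l]
  have wb: "bounded (w ` {a..b})" for a b
    by (intro compact_imp_bounded compact_continuous_image continuous_on_subset[OF w(1)]) auto
  show "driving_path w"
  proof (rule driving_pathI)
    show "nearly_continuous w" unfolding nearly_continuous_def using wc by (intro exI[of _ "{}"]) auto
    show "((\<lambda>t. w t / t) \<longlongrightarrow> 0) at_bot" using tw(1) by (simp add: tempered_path_def)
  qed (use w wb in auto)
  show "driving_path (w \<circ> l)"
  proof (rule driving_pathI)
    show "nearly_continuous (w \<circ> l)" unfolding nearly_continuous_def
    proof (intro exI conjI allI impI)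
      show "countable {a. \<not> isCont l a}" by (rule mono_ctble_discont[OF l_mono])
      fix s assume "s \<notin> {a. \<not> isCont l a}"
      then show "isCont (w \<circ> l) s" using wc by (intro continuous_at_compose) auto
    qed
    show "((\<lambda>t. (w \<circ> l) t / t) \<longlongrightarrow> 0) at_bot" using tw(2) by (simp add: tempered_path_def)
    show "bounded ((w \<circ> l) ` {T..0})" for T
      by (rule bounded_subset[OF wb[of "l T" "l 0"]]) (use l_mono in \<open>auto simp: mono_def\<close>)
  qed (use w l0 in auto)
qed

section \<open>Orbits and solutions of the Lyapunov-Perron equation\<close>

lemma LBINT_minf:
  fixes f :: "real \<Rightarrow> 'b::{banach, second_countable_topology}"
  shows "(LBINT s=-\<infinity>..ereal t. f s) = (LBINT s. indicator {..<t} s *\<^sub>R f s)"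
  by (simp add: interval_lebesgue_integral_def set_lebesgue_integral_def)

lemma LBINT_Ioo:
  fixes f :: "real \<Rightarrow> 'b::{banach, second_countable_topology}"
  assumes "a \<le> b"
  shows "(LBINT s=ereal a..ereal b. f s) = (LBINT s. indicator {a<..<b} s *\<^sub>R f s)"
  using assms by (simp add: interval_lebesgue_integral_def set_lebesgue_integral_def)

context lipschitz_gap
begin

lemma exp_A_scaleR_PP_coeff:
  assumes "k \<ge> 1"
  shows "exp_A e lam \<tau> (c *\<^sub>R PP v) \<bullet> e k = (if k \<le> N then exp (- (lam k * \<tau>)) * (c * (v \<bullet> e k)) else 0)"
proof -
  have "exp_A e lam \<tau> (c *\<^sub>R PP v) \<bullet> e k = exp (- lam k * \<tau>) * ((c *\<^sub>R PP v) \<bullet> e k)"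
    unfolding exp_A_def spec_fun_eq_diag
  \<comment> \<open>The sign of \<open>\<tau>\<close> is arbitrary, so the multiplier may grow with
    the index; on a vector in the range of \<open>PP\<close> only indices up to \<open>N\<close>
    count.\<close>
  proof (rule diag_coeff_summable[OF diag_summable[where B="exp (lam N * \<bar>\<tau>\<bar>)"] assms])
    fix j :: nat assume j: "j \<ge> 1"
    show "\<bar>exp (- lam j * \<tau>) * ((c *\<^sub>R PP v) \<bullet> e j)\<bar> \<le> exp (lam N * \<bar>\<tau>\<bar>) * \<bar>(c *\<^sub>R PP v) \<bullet> e j\<bar>"
    proof (cases "j \<le> N")
      case True
      have "- lam j * \<tau> \<le> \<bar>lam j * \<tau>\<bar>" by simp
      also have "\<dots> = lam j * \<bar>\<tau>\<bar>" using lam_pos[OF j] by (simp add: abs_mult)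
      also have "\<dots> \<le> lam N * \<bar>\<tau>\<bar>" using lam_mono[OF j True] by (intro mult_right_mono) auto
      finally show ?thesis unfolding abs_mult by (intro mult_right_mono) auto
    qed (use j in \<open>simp add: proj_P_coeff\<close>)
  qed
  then show ?thesis using assms by (simp add: proj_P_coeff)
qed

lemma exp_A_scaleR_QQ_coeff:
  assumes "k \<ge> 1" "\<tau> \<ge> 0"
  shows "exp_A e lam \<tau> (c *\<^sub>R QQ v) \<bullet> e k = (if k \<le> N then 0 else exp (- (lam k * \<tau>)) * (c * (v \<bullet> e k)))"
proof -
  have "exp_A e lam \<tau> (c *\<^sub>R QQ v) \<bullet> e k = exp (- lam k * \<tau>) * ((c *\<^sub>R QQ v) \<bullet> e k)"
    unfolding exp_A_def spec_fun_eq_diag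
  proof (rule diag_coeff_bounded[OF _ assms(1), where B=1])
    fix j :: nat assume "j \<ge> 1"
    then show "\<bar>exp (- lam j * \<tau>)\<bar> \<le> 1" using lam_pos[of j] assms(2) by (simp add: mult_nonneg_nonneg)
  qed
  then show ?thesis using assms by (simp add: proj_Q_coeff)
qed

lemma PP_scaleR: "PP (c *\<^sub>R v) = c *\<^sub>R PP v"
  using PP_lincomb[of c v 0 v] by simp

lemma QQ_scaleR: "QQ (c *\<^sub>R v) = c *\<^sub>R QQ v"
  using QQ_lincomb[of c v 0 v] by simp

text \<open>The factor with x - y inside the nonlinearity meets the factor with y - \<beta> s of the
  substitution: the average y cancels inside \<open>F\<close>, and only the value of the path at
  time \<open>s\<close> survives there.\<close>

lemma G_map_shift:
  assumes x: "driving_path x" and s: "s \<le> 0"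
  shows "G_map F (shift s x) (exp (exp_avg x s - \<beta> * s) *\<^sub>R A_inv v) = exp (exp_avg x s - \<beta> * s) *\<^sub>R Phi x s v"
proof -
  have "exp (x s - exp_avg x s) *\<^sub>R exp (exp_avg x s - \<beta> * s) *\<^sub>R A_inv v = A_inv (exp (x s - \<beta> * s) *\<^sub>R v)"
    by (simp add: A_inv_scaleR flip: exp_add)
  then show ?thesis
    by (simp add: G_map_def zeta_shift[OF x s] Phi_def Fh_def flip: exp_add)
qed

text \<open>Formulated for an arbitrary bounded continuous \<open>\<phi>\<close> and not only for a
  solution, so that it translates the fixed point equation in both directions.\<close>

lemma orbit_rhs:
  assumes x: "driving_path x" and \<phi>: "bcont \<phi>" and \<xi>: "\<xi> \<in> PD" and t: "t \<le> 0"
    and u: "\<And>s. s \<le> 0 \<Longrightarrow> u s = exp (exp_avg x s - \<beta> * s) *\<^sub>R A_inv (\<phi> s)"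
  shows "exp (zeta_int x 0 t) *\<^sub>R exp_A e lam t (exp (- zeta x) *\<^sub>R \<xi>)
        + (LBINT s=0..ereal t. exp (zeta_int x s t) *\<^sub>R
             exp_A e lam (t - s) (PP (G_map F (shift s x) (u s))))
        + (LBINT s=-\<infinity>..ereal t. exp (zeta_int x s t) *\<^sub>R
             exp_A e lam (t - s) (QQ (G_map F (shift s x) (u s))))
     = exp (exp_avg x t - \<beta> * t) *\<^sub>R A_inv (lin_flow t (Apow \<xi>) + gconv (forcing (Phi x) \<phi>) t)"
proof -
  have nx: "nearly_continuous x" using x by (simp add: driving_path_def)
  define g where "g = forcing (Phi x) \<phi>"
  define c where "c = exp (exp_avg x t - \<beta> * t)"
  note g = forcing_mb[OF admissible_Phi[OF nx] \<phi>, folded g_def]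
  define k where "k s = green (t - s) (g s)" for s
  have k_eq: "k s = green (t + (- 1) * s) (g (t - (t + (- 1) * s)))" for s by (simp add: k_def)
  have ik: "integrable lborel k"
    unfolding k_eq[abs_def]
    by (rule lborel_integrable_real_affine[OF gconv_integrable[OF g]]) simp
  have gconv_k: "gconv g t = (LBINT s. k s)"
    unfolding gconv_def k_eq using lborel_integral_real_affine[of "- 1" "\<lambda>\<tau>. green \<tau> (g (t - \<tau>))" t] by simp
  have inA: "integrable lborel (\<lambda>s. indicator A s *\<^sub>R k s)" if "A \<in> sets borel" for A
    using integrable_mult_indicator[of A lborel k] ik that by simp
  \<comment> \<open>The integral from 0 to \<open>t\<close> runs backwards for
    \<open>t \<le> 0\<close>. The minus sign here is the one built into \<open>green_symb\<close>,
    and reversing the endpoints in \<open>I2\<close> removes it.\<close>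
  have f2: "exp (zeta_int x s t) *\<^sub>R exp_A e lam (t - s) (PP (G_map F (shift s x) (u s))) = - (c *\<^sub>R A_inv (k s))"
    if s: "t < s" "s < 0" for s
  proof (rule coeff_ext)
    fix j :: nat assume j: "j \<ge> 1"
    have gs: "g s = Phi x s (\<phi> s)" using s by (simp add: g_def forcing_def)
    have "(exp (zeta_int x s t) *\<^sub>R exp_A e lam (t - s) (PP (G_map F (shift s x) (u s)))) \<bullet> e j
       = (if j \<le> N then exp (exp_avg x t - exp_avg x s) * (exp (- (lam j * (t - s))) * (exp (exp_avg x s - \<beta> * s) * (g s \<bullet> e j))) else 0)"
      using s t j by (simp add: u G_map_shift[OF x] PP_scaleR exp_A_scaleR_PP_coeff zeta_int_eq[OF x] gs)
    also have "\<dots> = (if j \<le> N then c * (exp (- ((lam j - \<beta>) * (t - s))) * (g s \<bullet> e j)) else 0)"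
      unfolding c_def mult.assoc[symmetric] exp_add[symmetric] by (simp add: algebra_simps)
    also have "\<dots> = (- (c *\<^sub>R A_inv (k s))) \<bullet> e j"
      using s j by (simp add: k_def A_inv_coeff green_coeff green_symb_def mult.assoc)
    finally show "(exp (zeta_int x s t) *\<^sub>R exp_A e lam (t - s) (PP (G_map F (shift s x) (u s)))) \<bullet> e j
      = (- (c *\<^sub>R A_inv (k s))) \<bullet> e j" .
  qed
  have f3: "exp (zeta_int x s t) *\<^sub>R exp_A e lam (t - s) (QQ (G_map F (shift s x) (u s))) = c *\<^sub>R A_inv (k s)"
    if s: "s < t" for s
  proof (rule coeff_ext)
    fix j :: nat assume j: "j \<ge> 1"
    have gs: "g s = Phi x s (\<phi> s)" using s t by (simp add: g_def forcing_def)
    have "(exp (zeta_int x s t) *\<^sub>R exp_A e lam (t - s) (QQ (G_map F (shift s x) (u s)))) \<bullet> e j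
       = (if j \<le> N then 0 else exp (exp_avg x t - exp_avg x s) * (exp (- (lam j * (t - s))) * (exp (exp_avg x s - \<beta> * s) * (g s \<bullet> e j))))"
      using s t j by (simp add: u G_map_shift[OF x] QQ_scaleR exp_A_scaleR_QQ_coeff zeta_int_eq[OF x] gs)
    also have "\<dots> = (if j \<le> N then 0 else c * (exp (- ((lam j - \<beta>) * (t - s))) * (g s \<bullet> e j)))"
      unfolding c_def mult.assoc[symmetric] exp_add[symmetric] by (simp add: algebra_simps)
    also have "\<dots> = (c *\<^sub>R A_inv (k s)) \<bullet> e j"
      using s j by (simp add: k_def A_inv_coeff green_coeff green_symb_def mult.assoc)
    finally show "(exp (zeta_int x s t) *\<^sub>R exp_A e lam (t - s) (QQ (G_map F (shift s x) (u s)))) \<bullet> e j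
      = (c *\<^sub>R A_inv (k s)) \<bullet> e j" .
  qed
  have bl: "bounded_linear (\<lambda>v. c *\<^sub>R A_inv v)"
    by (rule bounded_linear_scaleR_right[THEN bounded_linear_compose, OF A_inv_linear])
  have I3: "(LBINT s=-\<infinity>..ereal t. exp (zeta_int x s t) *\<^sub>R exp_A e lam (t - s) (QQ (G_map F (shift s x) (u s))))
     = c *\<^sub>R A_inv (LBINT s. indicator {..<t} s *\<^sub>R k s)"
  proof -
    have "(LBINT s=-\<infinity>..ereal t. exp (zeta_int x s t) *\<^sub>R exp_A e lam (t - s) (QQ (G_map F (shift s x) (u s))))
       = (LBINT s. c *\<^sub>R A_inv (indicator {..<t} s *\<^sub>R k s))"
      unfolding LBINT_minf
      by (intro Bochner_Integration.integral_cong refl) (auto simp: f3 A_inv_0 indicator_def)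
    also have "\<dots> = c *\<^sub>R A_inv (LBINT s. indicator {..<t} s *\<^sub>R k s)"
      by (rule integral_bounded_linear[OF bl inA]) simp
    finally show ?thesis .
  qed
  have I2: "(LBINT s=0..ereal t. exp (zeta_int x s t) *\<^sub>R exp_A e lam (t - s) (PP (G_map F (shift s x) (u s))))
     = c *\<^sub>R A_inv (LBINT s. indicator {t<..<0} s *\<^sub>R k s)"
  proof -
    have "(LBINT s=0..ereal t. exp (zeta_int x s t) *\<^sub>R exp_A e lam (t - s) (PP (G_map F (shift s x) (u s))))
       = - (LBINT s=ereal t..ereal 0. exp (zeta_int x s t) *\<^sub>R exp_A e lam (t - s) (PP (G_map F (shift s x) (u s))))"
      unfolding zero_ereal_def by (rule interval_integral_endpoints_reverse)
    also have "(LBINT s=ereal t..ereal 0. exp (zeta_int x s t) *\<^sub>R exp_A e lam (t - s) (PP (G_map F (shift s x) (u s))))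
       = (LBINT s. - (c *\<^sub>R A_inv (indicator {t<..<0} s *\<^sub>R k s)))"
      unfolding LBINT_Ioo[OF t]
      by (intro Bochner_Integration.integral_cong refl) (auto simp: f2 A_inv_0 indicator_def)
    also have "- \<dots> = (LBINT s. c *\<^sub>R A_inv (indicator {t<..<0} s *\<^sub>R k s))"
      by simp
    also have "\<dots> = c *\<^sub>R A_inv (LBINT s. indicator {t<..<0} s *\<^sub>R k s)"
      by (rule integral_bounded_linear[OF bl inA]) simp
    finally show ?thesis .
  qed
  have "(LBINT s. indicator {t<..<0} s *\<^sub>R k s) + (LBINT s. indicator {..<t} s *\<^sub>R k s)
     = (LBINT s. indicator {t<..<0} s *\<^sub>R k s + indicator {..<t} s *\<^sub>R k s)"
    by (rule Bochner_Integration.integral_add[symmetric]) (auto intro: inA)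
  also have "\<dots> = (LBINT s. k s)"
  proof (rule integral_cong_AE)
    \<comment> \<open>The cut in \<open>forcing\<close> ends the future integral at 0, so the ranges
      below \<open>t\<close> and between \<open>t\<close> and 0 exhaust the convolution up to two
      points.\<close>
    have k0: "k s = 0" if "s > 0" for s
      using that bounded_linear.linear[OF green_linear] by (simp add: k_def g_def forcing_def linear_0)
    show "AE s in lborel. indicator {t<..<0} s *\<^sub>R k s + indicator {..<t} s *\<^sub>R k s = k s"
      using AE_lborel_singleton[of 0] AE_lborel_singleton[of t]
      by eventually_elim (use t k0 in \<open>auto simp: indicator_def not_less\<close>)
    show "(\<lambda>s. indicator {t<..<0} s *\<^sub>R k s + indicator {..<t} s *\<^sub>R k s) \<in> borel_measurable lborel"
      by (intro borel_measurable_integrable Bochner_Integration.integrable_add inA) auto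
  qed (use ik in simp)
  finally have K: "(LBINT s. indicator {t<..<0} s *\<^sub>R k s) + (LBINT s. indicator {..<t} s *\<^sub>R k s) = gconv g t"
    by (simp add: gconv_k)
  \<comment> \<open>The factor \<open>exp (- zeta x)\<close> on the initial value is exp(y(0)), and
    it cancels the contribution of the endpoint 0 to \<open>zeta_int x 0 t\<close>.\<close>
  have I1: "exp (zeta_int x 0 t) *\<^sub>R exp_A e lam t (exp (- zeta x) *\<^sub>R \<xi>) = c *\<^sub>R A_inv (lin_flow t (Apow \<xi>))"
  proof (rule coeff_ext)
    fix j :: nat assume j: "j \<ge> 1"
    obtain v where v: "\<xi> = PP v" using \<xi> by auto
    have vj: "v \<bullet> e j = \<xi> \<bullet> e j" if "j \<le> N" using that j by (simp add: v proj_P_coeff)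
    have "(exp (zeta_int x 0 t) *\<^sub>R exp_A e lam t (exp (- zeta x) *\<^sub>R \<xi>)) \<bullet> e j
       = (if j \<le> N then exp (exp_avg x t - exp_avg x 0) * (exp (- (lam j * t)) * (exp (exp_avg x 0) * (\<xi> \<bullet> e j))) else 0)"
      unfolding v using vj j t x by (simp add: exp_A_scaleR_PP_coeff zeta_int_eq zeta_driving_path v)
    also have "\<dots> = (if j \<le> N then c * (exp (- ((lam j - \<beta>) * t)) * (\<xi> \<bullet> e j)) else 0)"
      unfolding c_def mult.assoc[symmetric] exp_add[symmetric] by (simp add: algebra_simps)
    also have "\<dots> = (c *\<^sub>R A_inv (lin_flow t (Apow \<xi>))) \<bullet> e j"
      using j by (simp add: A_inv_coeff lin_flow_coeff Apow_coeff[OF PD_dom[OF \<xi>]] mult.left_commute[of _ "exp _"])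
    finally show "(exp (zeta_int x 0 t) *\<^sub>R exp_A e lam t (exp (- zeta x) *\<^sub>R \<xi>)) \<bullet> e j
      = (c *\<^sub>R A_inv (lin_flow t (Apow \<xi>))) \<bullet> e j" .
  qed
  show ?thesis
    unfolding I1 I2 I3 c_def[symmetric] g_def[symmetric] K[symmetric]
    by (simp add: A_inv_add scaleR_add_right add.assoc)
qed

text \<open>This provides an orbit, without which the choice in \<open>ubar\<close> would carry no
  information. Up to the constant \<open>exp (exp_avg x 0)\<close> the weighted norm of the orbit is
  the supremum norm of \<open>\<phi>\<close> over \<open>t \<le> 0\<close>.\<close>

lemma lp_sol_imp_manifold_orbit:
  assumes x: "driving_path x" and \<xi>: "\<xi> \<in> PD" and \<phi>: "lp_sol (Phi x) (Apow \<xi>) \<phi>"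
  shows "manifold_orbit e lam \<sigma> F N \<beta> x (exp (- zeta x) *\<^sub>R \<xi>) (\<lambda>t. exp (exp_avg x t - \<beta> * t) *\<^sub>R A_inv (\<phi> t))"
    (is "manifold_orbit _ _ _ _ _ _ _ _ ?u")
proof -
  note bc = lp_sol_bcont[OF \<phi>]
  obtain B where B: "\<And>s. norm (\<phi> s) \<le> B" using bc by (auto simp: bounded_iff bcont_def)
  have u_A: "?u t = A_inv (exp (exp_avg x t - \<beta> * t) *\<^sub>R \<phi> t)" for t by (simp add: A_inv_scaleR)
  have "continuous_on {..0} (\<lambda>t. exp (exp_avg x t - \<beta> * t) *\<^sub>R \<phi> t)"
    using bc continuous_exp_avg[OF x, of "{..0}"] unfolding bcont_def
    by (intro continuous_intros) (auto intro: continuous_on_subset)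
  then have lim: "((\<lambda>s. exp (exp_avg x s - \<beta> * s) *\<^sub>R \<phi> s) \<longlongrightarrow> exp (exp_avg x t - \<beta> * t) *\<^sub>R \<phi> t) (at t within {..0})"
    if "t \<le> 0" for t
    using that by (auto simp: continuous_on)
  have w: "?u \<in> weighted_space e lam \<sigma> \<beta> x"
    unfolding weighted_space_def
  proof (intro CollectI conjI allI impI)
    show "?u t \<in> domA" for t unfolding u_A by (rule A_inv_dom)
    show "((\<lambda>s. nA (?u s - ?u t)) \<longlongrightarrow> 0) (at t within {..0})" if "t \<le> 0" for t
      unfolding u_A A_inv_diff[symmetric] nA_A_inv by (intro tendsto_norm_zero LIM_zero lim that)
    show "bdd_above ((\<lambda>t. exp (\<beta> * t - zeta_int x 0 t) * nA (?u t)) ` {..0})"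
    proof (rule bdd_aboveI2)
      fix t :: real assume t: "t \<in> {..0}"
      have "exp (\<beta> * t - zeta_int x 0 t) * nA (?u t) = exp (\<beta> * t - (exp_avg x t - exp_avg x 0)) * exp (exp_avg x t - \<beta> * t) * norm (\<phi> t)"
        using t unfolding u_A nA_A_inv by (simp add: zeta_int_eq[OF x])
      also have "\<dots> = exp (exp_avg x 0) * norm (\<phi> t)" by (simp flip: exp_add)
      also have "\<dots> \<le> exp (exp_avg x 0) * B" using B by simp
      finally show "exp (\<beta> * t - zeta_int x 0 t) * nA (?u t) \<le> exp (exp_avg x 0) * B" .
    qed
  qed
  show ?thesis
    unfolding manifold_orbit_def
  proof (intro conjI allI impI w)
    fix t :: real assume t: "t \<le> 0"
    show "?u t =
        exp (zeta_int x 0 t) *\<^sub>R exp_A e lam t (exp (- zeta x) *\<^sub>R \<xi>)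
        + (LBINT s=0..ereal t. exp (zeta_int x s t) *\<^sub>R
             exp_A e lam (t - s) (proj_P e N (G_map F (shift s x) (?u s))))
        + (LBINT s=-\<infinity>..ereal t. exp (zeta_int x s t) *\<^sub>R
             exp_A e lam (t - s) (proj_Q e N (G_map F (shift s x) (?u s))))"
      using orbit_rhs[OF x bc \<xi> t, of ?u] lp_sol_eq[OF \<phi> t] by simp
  qed
qed

text \<open>The converse is needed because \<open>ubar\<close> may be any orbit: each one is led
  back to the unique solution. Orbits are constrained only at times \<open>t \<le> 0\<close>, hence
  the continuation by \<open>min t 0\<close> in \<open>\<phi>\<close>.\<close>

lemma manifold_orbit_imp_lp_sol:
  assumes x: "driving_path x" and \<xi>: "\<xi> \<in> PD"
    and orb: "manifold_orbit e lam \<sigma> F N \<beta> x (exp (- zeta x) *\<^sub>R \<xi>) u"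
  shows "\<exists>\<phi>. lp_sol (Phi x) (Apow \<xi>) \<phi> \<and> u 0 = exp (exp_avg x 0) *\<^sub>R A_inv (\<phi> 0)"
proof -
  have w: "\<And>t. t \<le> 0 \<Longrightarrow> u t \<in> domA"
      "\<And>t. t \<le> 0 \<Longrightarrow> ((\<lambda>s. nA (u s - u t)) \<longlongrightarrow> 0) (at t within {..0})"
      "bdd_above ((\<lambda>t. exp (\<beta> * t - zeta_int x 0 t) * nA (u t)) ` {..0})"
    using conjunct1[OF orb[unfolded manifold_orbit_def]] by (simp_all add: weighted_space_def)
  have eq: "u t = exp (zeta_int x 0 t) *\<^sub>R exp_A e lam t (exp (- zeta x) *\<^sub>R \<xi>)
        + (LBINT s=0..ereal t. exp (zeta_int x s t) *\<^sub>R
             exp_A e lam (t - s) (proj_P e N (G_map F (shift s x) (u s))))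
        + (LBINT s=-\<infinity>..ereal t. exp (zeta_int x s t) *\<^sub>R
             exp_A e lam (t - s) (proj_Q e N (G_map F (shift s x) (u s))))" if "t \<le> 0" for t
    using orb that unfolding manifold_orbit_def by blast
  define \<phi> where "\<phi> t = exp (\<beta> * min t 0 - exp_avg x (min t 0)) *\<^sub>R Apow (u (min t 0))" for t
  have \<phi>_neg: "\<phi> t = exp (\<beta> * t - exp_avg x t) *\<^sub>R Apow (u t)" if "t \<le> 0" for t
    using that by (simp add: \<phi>_def min_absorb1)
  have u: "u s = exp (exp_avg x s - \<beta> * s) *\<^sub>R A_inv (\<phi> s)" if "s \<le> 0" for s
    using that w(1)[OF that] by (simp add: \<phi>_neg A_inv_scaleR flip: exp_add)
  have Apow_cont: "continuous_on {..0} (\<lambda>t. Apow (u t))"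
    unfolding continuous_on_def
  proof (intro ballI)
    fix t :: real assume t: "t \<in> {..0}"
    show "((\<lambda>s. Apow (u s)) \<longlongrightarrow> Apow (u t)) (at t within {..0})"
    proof (rule LIM_zero_cancel, rule tendsto_norm_zero_cancel)
      have "\<forall>\<^sub>F s in at t within {..0}. nA (u s - u t) = norm (Apow (u s) - Apow (u t))"
        unfolding eventually_at_filter norm_A_def using t w(1) by (auto simp: Apow_diff)
      moreover have "((\<lambda>s. nA (u s - u t)) \<longlongrightarrow> 0) (at t within {..0})" using w(2) t by auto
      ultimately show "((\<lambda>s. norm (Apow (u s) - Apow (u t))) \<longlongrightarrow> 0) (at t within {..0})"
        by (rule Lim_transform_eventually[rotated])
    qed
  qed
  have "continuous_on {..0} (\<lambda>t. exp (\<beta> * t - exp_avg x t) *\<^sub>R Apow (u t))"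
    by (intro continuous_intros Apow_cont continuous_exp_avg[OF x])
  then have cont: "continuous_on UNIV \<phi>"
    unfolding \<phi>_def[abs_def] by (rule continuous_on_compose2) (auto intro: continuous_intros)
  obtain B where B: "\<And>t. t \<le> 0 \<Longrightarrow> exp (\<beta> * t - zeta_int x 0 t) * nA (u t) \<le> B"
    using w(3) by (auto simp: bdd_above_def)
  have "norm (\<phi> t) \<le> exp (- exp_avg x 0) * B" for t
  proof -
    let ?m = "min t 0"
    have "norm (\<phi> t) = exp (- exp_avg x 0) * (exp (\<beta> * ?m - zeta_int x 0 ?m) * nA (u ?m))"
      unfolding mult.assoc[symmetric] exp_add[symmetric]
      by (simp add: \<phi>_def norm_A_def zeta_int_eq[OF x])
    also have "\<dots> \<le> exp (- exp_avg x 0) * B" by (intro mult_left_mono B) auto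
    finally show ?thesis .
  qed
  then have bc: "bcont \<phi>" using cont by (auto simp: bcont_def bounded_iff)
  have neg: "\<phi> t = lin_flow t (Apow \<xi>) + gconv (forcing (Phi x) \<phi>) t" if t: "t \<le> 0" for t
  proof -
    have "u t = exp (exp_avg x t - \<beta> * t) *\<^sub>R A_inv (lin_flow t (Apow \<xi>) + gconv (forcing (Phi x) \<phi>) t)"
      using orbit_rhs[OF x bc \<xi> t u] eq[OF t] by simp
    then have "Apow (u t) = exp (exp_avg x t - \<beta> * t) *\<^sub>R (lin_flow t (Apow \<xi>) + gconv (forcing (Phi x) \<phi>) t)"
      by (simp add: Apow_scaleR A_inv_dom)
    then show ?thesis using t by (simp add: \<phi>_neg flip: exp_add)
  qed
  have "\<phi> t = \<phi> (min t 0)" for t by (simp add: \<phi>_def)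
  then have "\<phi> t = lin_flow (min t 0) (Apow \<xi>) + gconv (forcing (Phi x) \<phi>) (min t 0)" for t
    using neg[of "min t 0"] by simp
  then have "lp_sol (Phi x) (Apow \<xi>) \<phi>" using bc by (simp add: lp_sol_def)
  moreover have "u 0 = exp (exp_avg x 0) *\<^sub>R A_inv (\<phi> 0)" using u[of 0] by simp
  ultimately show ?thesis by blast
qed

lemma manifold_map_eq:
  assumes x: "driving_path x" and \<xi>: "\<xi> \<in> PD"
  shows "manifold_map e lam \<sigma> F N \<beta> x \<xi> = graph_map x \<xi>"
proof -
  have nx: "nearly_continuous x" using x by (simp add: driving_path_def)
  let ?u = "ubar e lam \<sigma> F N \<beta> x (exp (- zeta x) *\<^sub>R \<xi>)"
  have "\<exists>u. manifold_orbit e lam \<sigma> F N \<beta> x (exp (- zeta x) *\<^sub>R \<xi>) u"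
    using lp_sol_imp_manifold_orbit[OF x \<xi> orbit[OF nx]] by blast
  then have "manifold_orbit e lam \<sigma> F N \<beta> x (exp (- zeta x) *\<^sub>R \<xi>) ?u"
    unfolding ubar_def by (rule someI_ex)
  then obtain \<phi> where \<phi>: "lp_sol (Phi x) (Apow \<xi>) \<phi>" "?u 0 = exp (exp_avg x 0) *\<^sub>R A_inv (\<phi> 0)"
    using manifold_orbit_imp_lp_sol[OF x \<xi>] by blast
  then have "\<phi> = orbit x (Apow \<xi>)" using orbit_eqI[OF nx] by simp
  then show ?thesis
    using \<phi>(2) unfolding manifold_map_def psi_def graph_map_def
    by (simp add: zeta_driving_path[OF x] QQ_scaleR QQ_A_inv flip: exp_add)
qed

end

lemma (in C1_gap) deriv_manifold_map_eq:
  assumes x: "driving_path x" and \<xi>: "\<xi> \<in> PD" and h: "h \<in> PD"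
  shows "deriv_manifold_map e lam \<sigma> F N \<beta> x \<xi> h = graph_deriv x \<xi> h"
proof -
  have nx: "nearly_continuous x" using x by (simp add: driving_path_def)
  have "has_deriv_on PD nA QD nA (manifold_map e lam \<sigma> F N \<beta> x) (graph_deriv x \<xi>) \<xi>"
    by (rule has_deriv_on_cong[OF graph_map_has_deriv[OF nx \<xi>] \<xi> manifold_map_eq[OF x]])
  then show ?thesis
    unfolding deriv_manifold_map_def by (rule deriv_on_eq[OF _ \<xi> h])
qed

section \<open>Stable subordinators as \<open>\<alpha>\<close> tends to \<open>2\<close>\<close>

lemma integral_powr_0_1:
  fixes p :: real
  assumes "p > -1"
  shows "has_bochner_integral lborel (\<lambda>x. indicator {0..1} x * x powr p) (1 / (p + 1))"
proof (rule has_bochner_integral_nn_integral)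
  have "((\<lambda>x. x powr p) has_integral (1 powr (p + 1) / (p + 1))) {0..1}"
    by (rule has_integral_powr_from_0) (use assms in auto)
  from nn_integral_has_integral_lebesgue[OF _ this]
  show "(\<integral>\<^sup>+x. ennreal (indicator {0..1} x * x powr p) \<partial>lborel) = ennreal (1 / (p + 1))" by simp
qed (use assms in auto)

lemma integral_powr_1_inf:
  fixes p :: real
  assumes "p < -1"
  shows "has_bochner_integral lborel (\<lambda>x. indicator {1..} x * x powr p) (- 1 / (p + 1))"
proof (rule has_bochner_integral_nn_integral)
  have "((\<lambda>x. x powr p) has_integral - (1 powr (p + 1)) / (p + 1)) {1..}"
    by (rule has_integral_powr_to_inf) (use assms in auto)
  from nn_integral_has_integral_lebesgue[OF _ this]
  show "(\<integral>\<^sup>+x. ennreal (indicator {1..} x * x powr p) \<partial>lborel) = ennreal (- 1 / (p + 1))" by simp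
qed (use assms in \<open>auto simp: divide_nonpos_neg\<close>)

text \<open>The first two bounds come from 1 + y \<le> exp y. The quadratic loss is harmless:
  integrated over the jumps below 1 it is \<open>C\<close> times a factor that stays bounded as
  \<alpha> tends to 2.\<close>

lemma one_minus_exp_bounds:
  fixes y :: real
  assumes "y \<ge> 0"
  shows "y - y\<^sup>2 \<le> 1 - exp (- y)" "1 - exp (- y) \<le> y" "1 - exp (- y) \<le> 1" "0 \<le> 1 - exp (- y)"
proof -
  have "1 + y \<le> exp y" by (rule exp_ge_add_one_self)
  then have "exp (- y) \<le> 1 / (1 + y)" using assms by (simp add: exp_minus field_simps)
  also have "1 / (1 + y) \<le> 1 - y + y\<^sup>2"
  proof -
    have "(1 - y + y\<^sup>2) * (1 + y) = 1 + y ^ 3" by (simp add: algebra_simps power2_eq_square power3_eq_cube)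
    also have "\<dots> \<ge> 1" using assms by simp
    finally show ?thesis using assms by (simp add: divide_le_eq)
  qed
  finally show "y - y\<^sup>2 \<le> 1 - exp (- y)" by simp
  show "1 - exp (- y) \<le> y" using exp_ge_add_one_self[of "- y"] by linarith
qed (use assms in auto)

text \<open>With \<open>a = \<alpha> / 2\<close> tending to 1, the jumps below 1 have mean rate
  \<open>c / (1 - a)\<close>, which tends to 1 by the normalization of \<open>C\<close>, while every
  other term is \<open>c\<close> times a bounded factor. Thus the small jumps accumulate to a drift
  of speed 1.\<close>

lemma laplace_exponent_bounds:
  fixes q c a :: real
  assumes "q \<ge> 0" "c > 0" "0 < a" "a < 1"
  defines "J \<equiv> (LBINT x:{0<..}. (1 - exp (- q * x)) * (c * x powr (- 1 - a)))"
  shows "c * q / (1 - a) - c * q\<^sup>2 / (2 - a) \<le> J" "J \<le> c * q / (1 - a) + c / a"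
proof -
  define f where "f x = indicator {0<..} x * ((1 - exp (- q * x)) * (c * x powr (- 1 - a)))" for x
  define U where "U x = c * q * (indicator {0..1} x * x powr (- a)) + c * (indicator {1..} x * x powr (- 1 - a))" for x
  define W where "W x = c * q * (indicator {0..1} x * x powr (- a)) - c * q\<^sup>2 * (indicator {0..1} x * x powr (1 - a))" for x
  have J: "J = (LBINT x. f x)"
    unfolding J_def set_lebesgue_integral_def f_def by simp
  have hU: "has_bochner_integral lborel U (c * q * (1 / (- a + 1)) + c * (- 1 / (- 1 - a + 1)))"
    unfolding U_def[abs_def]
    by (intro has_bochner_integral_add has_bochner_integral_mult_right integral_powr_0_1 integral_powr_1_inf) (use assms in auto)
  have hW: "has_bochner_integral lborel W (c * q * (1 / (- a + 1)) - c * q\<^sup>2 * (1 / (1 - a + 1)))"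
    unfolding W_def[abs_def]
    by (intro has_bochner_integral_diff has_bochner_integral_mult_right integral_powr_0_1) (use assms in auto)
  have f0: "0 \<le> f x" for x
    using one_minus_exp_bounds(4)[of "q * x"] assms by (auto simp: f_def indicator_def)
  have fU: "f x \<le> U x" for x
  proof -
    consider "x \<le> 0" | "0 < x" "x \<le> 1" | "1 < x" by linarith
    then show ?thesis
    proof cases
      case 1 then show ?thesis using assms by (auto simp: f_def U_def indicator_def)
    next
      case 2
      have "(1 - exp (- (q * x))) * (c * x powr (- 1 - a)) \<le> (q * x) * (c * x powr (- 1 - a))"
        using one_minus_exp_bounds(2)[of "q * x"] assms 2 by (intro mult_right_mono) auto
      also have "\<dots> = c * q * (x powr 1 * x powr (- 1 - a))" using 2 by simp
      also have "x powr 1 * x powr (- 1 - a) = x powr (- a)" by (subst powr_add[symmetric]) simp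
      finally have "f x \<le> c * q * x powr (- a)" using 2 by (simp add: f_def)
      moreover have "0 \<le> c * (indicator {1..} x * x powr (- 1 - a))" using assms by simp
      ultimately show ?thesis using 2 by (simp add: U_def)
    next
      case 3
      have "(1 - exp (- (q * x))) * (c * x powr (- 1 - a)) \<le> 1 * (c * x powr (- 1 - a))"
        using one_minus_exp_bounds(3)[of "q * x"] assms 3 by (intro mult_right_mono) auto
      then show ?thesis using 3 by (simp add: f_def U_def)
    qed
  qed
  have Wf: "W x \<le> f x" for x
  proof -
    consider "x \<le> 0" | "0 < x" "x \<le> 1" | "1 < x" by linarith
    then show ?thesis
    proof cases
      case 1 then show ?thesis using assms by (auto simp: f_def W_def indicator_def)
    next
      case 2
      have "(q * x - (q * x)\<^sup>2) * (c * x powr (- 1 - a)) \<le> (1 - exp (- (q * x))) * (c * x powr (- 1 - a))"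
        using one_minus_exp_bounds(1)[of "q * x"] assms 2 by (intro mult_right_mono) auto
      moreover have "(q * x - (q * x)\<^sup>2) * (c * x powr (- 1 - a))
         = c * q * (x powr 1 * x powr (- 1 - a)) - c * q\<^sup>2 * (x powr 2 * x powr (- 1 - a))"
        using 2 by (simp add: algebra_simps powr_numeral)
      moreover have "x powr 1 * x powr (- 1 - a) = x powr (- a)" "x powr 2 * x powr (- 1 - a) = x powr (1 - a)"
        by (subst powr_add[symmetric], simp)+
      ultimately show ?thesis using 2 by (simp add: f_def W_def)
    next
      case 3 then show ?thesis using f0[of x] by (simp add: W_def)
    qed
  qed
  have fm: "f \<in> borel_measurable lborel" unfolding f_def[abs_def] by measurable
  have fi: "integrable lborel f"
  proof (rule Bochner_Integration.integrable_bound[OF _ fm])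
    show "integrable lborel U" using hU by (simp add: has_bochner_integral_iff)
    show "AE x in lborel. norm (f x) \<le> norm (U x)"
      using f0 fU by (auto intro!: AE_I2 order_trans[OF fU abs_ge_self])
  qed
  have "(LBINT x. W x) \<le> J"
    unfolding J by (rule integral_mono[OF integrable.intros[OF hW] fi Wf])
  moreover have "J \<le> (LBINT x. U x)"
    unfolding J by (rule integral_mono[OF fi integrable.intros[OF hU] fU])
  ultimately show "c * q / (1 - a) - c * q\<^sup>2 / (2 - a) \<le> J" "J \<le> c * q / (1 - a) + c / a"
    using hU hW by (auto simp: has_bochner_integral_iff)
qed

lemma at_left_2_between: "\<forall>\<^sub>F \<alpha>::real in at_left 2. 1 < \<alpha> \<and> \<alpha> < 2"
  by (rule eventually_at_leftI[of 1]) auto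

lemma laplace_exponent_tendsto:
  assumes C_pos: "\<And>\<alpha>. 1 < \<alpha> \<Longrightarrow> \<alpha> < 2 \<Longrightarrow> C \<alpha> > 0"
    and C_lim: "((\<lambda>\<alpha>. 2 * C \<alpha> / (2 - \<alpha>)) \<longlongrightarrow> 1) (at_left (2::real))"
    and q: "q \<ge> (0::real)"
  shows "((\<lambda>\<alpha>. LBINT x:{0<..}. (1 - exp (- q * x)) * (C \<alpha> * x powr (- 1 - \<alpha> / 2))) \<longlongrightarrow> q) (at_left 2)"
proof (rule tendsto_sandwich)
  have id: "((\<lambda>\<alpha>::real. \<alpha>) \<longlongrightarrow> 2) (at_left 2)" by (simp add: tendsto_ident_at)
  \<comment> \<open>\<open>C \<alpha>\<close> is the normalized quotient times a vanishing factor,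
    so it tends to 0 and removes the error terms of both bounds.\<close>
  have "((\<lambda>\<alpha>. 2 * C \<alpha> / (2 - \<alpha>) * ((2 - \<alpha>) / 2)) \<longlongrightarrow> 1 * ((2 - 2) / 2)) (at_left 2)"
    by (intro tendsto_intros C_lim id) auto
  then have "((\<lambda>\<alpha>. 2 * C \<alpha> / (2 - \<alpha>) * ((2 - \<alpha>) / 2)) \<longlongrightarrow> 0) (at_left 2)" by simp
  then have C0: "(C \<longlongrightarrow> 0) (at_left 2)"
    by (rule Lim_transform_eventually) (use at_left_2_between in \<open>eventually_elim, simp add: field_simps\<close>)
  have eq: "C \<alpha> * q / (1 - \<alpha> / 2) = q * (2 * C \<alpha> / (2 - \<alpha>))" if "\<alpha> < 2" for \<alpha>
    using that by (simp add: field_simps)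
  have main: "((\<lambda>\<alpha>. q * (2 * C \<alpha> / (2 - \<alpha>))) \<longlongrightarrow> q * 1) (at_left 2)"
    by (intro tendsto_intros C_lim)
  show "((\<lambda>\<alpha>. q * (2 * C \<alpha> / (2 - \<alpha>)) - C \<alpha> * q\<^sup>2 / (2 - \<alpha> / 2)) \<longlongrightarrow> q) (at_left 2)"
    using tendsto_diff[OF main tendsto_divide[OF tendsto_mult[OF C0 tendsto_const[of "q\<^sup>2"]]
        tendsto_diff[OF tendsto_const[of 2] tendsto_divide[OF id tendsto_const[of 2]]]]] by simp
  show "((\<lambda>\<alpha>. q * (2 * C \<alpha> / (2 - \<alpha>)) + C \<alpha> / (\<alpha> / 2)) \<longlongrightarrow> q) (at_left 2)"
    using tendsto_add[OF main tendsto_divide[OF C0 tendsto_divide[OF id tendsto_const[of 2]]]] by simp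
  show "\<forall>\<^sub>F \<alpha> in at_left 2. q * (2 * C \<alpha> / (2 - \<alpha>)) - C \<alpha> * q\<^sup>2 / (2 - \<alpha> / 2)
      \<le> (LBINT x:{0<..}. (1 - exp (- q * x)) * (C \<alpha> * x powr (- 1 - \<alpha> / 2)))"
    using at_left_2_between
  proof eventually_elim
    case (elim \<alpha>)
    then show ?case using laplace_exponent_bounds(1)[OF q C_pos, of \<alpha> "\<alpha> / 2"] by (simp only: eq) simp
  qed
  show "\<forall>\<^sub>F \<alpha> in at_left 2. (LBINT x:{0<..}. (1 - exp (- q * x)) * (C \<alpha> * x powr (- 1 - \<alpha> / 2)))
      \<le> q * (2 * C \<alpha> / (2 - \<alpha>)) + C \<alpha> / (\<alpha> / 2)"
    using at_left_2_between
  proof eventually_elim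
    case (elim \<alpha>)
    then show ?case using laplace_exponent_bounds(2)[OF q C_pos, of \<alpha> "\<alpha> / 2"] by (simp only: eq) simp
  qed
qed

section \<open>Convergence of the subordinators to the identity in probability\<close>

lemma path_space:
  assumes "sets M = sets (path_algebra X)"
  shows "space M = X" "(\<lambda>x. x t) \<in> borel_measurable M"
proof -
  show "space M = X"
    using sets_eq_imp_space_eq[OF assms] by (simp add: path_algebra_def space_restrict_space space_PiM)
  have "(\<lambda>x. x t) \<in> borel_measurable (path_algebra X)"
    unfolding path_algebra_def by (intro measurable_restrict_space1 measurable_component_singleton) simp
  then show "(\<lambda>x. x t) \<in> borel_measurable M"
    by (subst measurable_cong_sets[OF assms refl])
qed

text \<open>Chebyshev's inequality for \<open>exp (- X)\<close>, whose first two moments are values of the Laplace transform.\<close>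

lemma prob_deviation_le:
  assumes "prob_space M" and X [measurable]: "X \<in> borel_measurable M" and X0: "\<And>p. p \<in> space M \<Longrightarrow> 0 \<le> X p"
    and d: "0 < \<delta>"
  shows "measure M {p\<in>space M. \<bar>X p - d\<bar> > \<delta>} \<le>
     ((\<integral>p. exp (- 2 * X p) \<partial>M) - 2 * exp (- d) * (\<integral>p. exp (- 1 * X p) \<partial>M) + exp (- 2 * d))
       / (exp (- d) * (1 - exp (- \<delta>)))\<^sup>2"
proof -
  interpret prob_space M by fact
  \<comment> \<open>The distance of \<open>exp (- X)\<close> from \<open>exp (- d)\<close> when
    \<open>X\<close> exceeds \<open>d\<close> by exactly \<open>\<delta>\<close>. A downward
    deviation moves it at least as far, by \<open>two\<close>.\<close>
  define \<kappa> where "\<kappa> = exp (- d) * (1 - exp (- \<delta>))"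
  have \<kappa>: "\<kappa> > 0" using d by (simp add: \<kappa>_def)
  have i: "integrable M (\<lambda>p. exp (- k * X p))" if "k \<ge> 0" for k
    by (rule integrable_const_bound[where B=1]) (use that X0 in \<open>auto intro!: AE_I2\<close>)
  have sq: "(exp (- X p) - exp (- d))\<^sup>2 = exp (- 2 * X p) - 2 * exp (- d) * exp (- 1 * X p) + exp (- 2 * d)" for p
  proof -
    have "exp (- 2 * y) = (exp (- y))\<^sup>2" for y :: real by (simp add: power2_eq_square flip: exp_add)
    then show ?thesis by (simp only: power2_diff) (simp only: mult_ac mult_minus1)
  qed
  have isq: "integrable M (\<lambda>p. (exp (- X p) - exp (- d))\<^sup>2)"
    unfolding sq using i[of 2] i[of 1] by simp
  have two: "1 - exp (- \<delta>) \<le> exp \<delta> - 1"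
    using one_minus_exp_bounds(2)[of \<delta>] exp_ge_add_one_self[of \<delta>] d by linarith
  have dev: "\<kappa>\<^sup>2 \<le> (exp (- X p) - exp (- d))\<^sup>2" if "\<bar>X p - d\<bar> > \<delta>" for p
  proof -
    have "\<kappa> \<le> \<bar>exp (- X p) - exp (- d)\<bar>"
    proof (cases "X p > d")
      case True
      then have "- X p \<le> - d + - \<delta>" using that by linarith
      then have "exp (- X p) \<le> exp (- d) * exp (- \<delta>)" by (simp flip: exp_add)
      then show ?thesis by (simp add: \<kappa>_def algebra_simps)
    next
      case False
      then have "- d + \<delta> \<le> - X p" using that by linarith
      then have "exp (- d) * exp \<delta> \<le> exp (- X p)" by (simp flip: exp_add)
      moreover have "exp (- d) * (1 - exp (- \<delta>)) \<le> exp (- d) * (exp \<delta> - 1)"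
        using two by (intro mult_left_mono) auto
      ultimately show ?thesis by (simp add: \<kappa>_def algebra_simps)
    qed
    then show ?thesis using \<kappa> by (simp add: abs_le_square_iff[symmetric])
  qed
  have "measure M {p\<in>space M. \<bar>X p - d\<bar> > \<delta>} \<le> measure M {p\<in>space M. \<kappa>\<^sup>2 \<le> (exp (- X p) - exp (- d))\<^sup>2}"
    using dev by (intro finite_measure_mono) auto
  also have "\<dots> \<le> (\<integral>p. (exp (- X p) - exp (- d))\<^sup>2 \<partial>M) / \<kappa>\<^sup>2"
    using \<kappa> by (intro integral_Markov_inequality_measure[OF isq, of "{}"]) auto
  also have "(\<integral>p. (exp (- X p) - exp (- d))\<^sup>2 \<partial>M) =
     (\<integral>p. exp (- 2 * X p) \<partial>M) - 2 * exp (- d) * (\<integral>p. exp (- 1 * X p) \<partial>M) + exp (- 2 * d)"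
    unfolding sq using i[of 2] i[of 1] by (simp add: prob_space)
  finally show ?thesis unfolding \<kappa>_def .
qed

text \<open>In the limit the first two moments of \<open>exp (- X)\<close>, for the increment
  \<open>X\<close>, become those of a constant, so the mean square distance from
  \<open>exp (- (t - s))\<close> vanishes.\<close>

lemma increment_deviation_tendsto_0:
  assumes C_pos: "\<And>\<alpha>. 1 < \<alpha> \<Longrightarrow> \<alpha> < 2 \<Longrightarrow> C \<alpha> > 0"
    and C_lim: "((\<lambda>\<alpha>. 2 * C \<alpha> / (2 - \<alpha>)) \<longlongrightarrow> 1) (at_left (2::real))"
    and sub: "\<And>\<alpha>. 1 < \<alpha> \<Longrightarrow> \<alpha> < 2 \<Longrightarrow> stable_subordinator_law \<alpha> (C \<alpha>) (muS \<alpha>)"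
    and st: "s < t" and \<delta>: "0 < \<delta>"
  shows "((\<lambda>\<alpha>. measure (muS \<alpha>) {l\<in>space (muS \<alpha>). \<bar>(l t - l s) - (t - s)\<bar> > \<delta>}) \<longlongrightarrow> 0) (at_left 2)"
proof (rule tendsto_sandwich[OF _ _ tendsto_const])
  let ?d = "t - s"
  let ?J = "\<lambda>\<alpha> q. LBINT x:{0<..}. (1 - exp (- q * x)) * (C \<alpha> * x powr (- 1 - \<alpha> / 2))"
  let ?R = "\<lambda>\<alpha>. (exp (- ?d * ?J \<alpha> 2) - 2 * exp (- ?d) * exp (- ?d * ?J \<alpha> 1) + exp (- 2 * ?d))
       / (exp (- ?d) * (1 - exp (- \<delta>)))\<^sup>2"
  have "(?R \<longlongrightarrow> (exp (- ?d * 2) - 2 * exp (- ?d) * exp (- ?d * 1) + exp (- 2 * ?d))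
       / (exp (- ?d) * (1 - exp (- \<delta>)))\<^sup>2) (at_left 2)"
    by (intro tendsto_intros laplace_exponent_tendsto[OF C_pos C_lim]) (use \<delta> in auto)
  moreover have "exp (- ?d * 2) - 2 * exp (- ?d) * exp (- ?d * 1) + exp (- 2 * ?d) = 0"
    by (simp add: mult.commute flip: exp_add)
  ultimately show "(?R \<longlongrightarrow> 0) (at_left 2)" by simp
  show "\<forall>\<^sub>F \<alpha> in at_left 2. 0 \<le> measure (muS \<alpha>) {l\<in>space (muS \<alpha>). \<bar>(l t - l s) - (t - s)\<bar> > \<delta>}"
    by simp
  show "\<forall>\<^sub>F \<alpha> in at_left 2. measure (muS \<alpha>) {l\<in>space (muS \<alpha>). \<bar>(l t - l s) - (t - s)\<bar> > \<delta>} \<le> ?R \<alpha>"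
    using at_left_2_between
  proof eventually_elim
    case (elim \<alpha>)
    then have S: "stable_subordinator_law \<alpha> (C \<alpha>) (muS \<alpha>)" using sub by simp
    have ps: "prob_space (muS \<alpha>)" and sets: "sets (muS \<alpha>) = sets (path_algebra subordinator_paths)"
      using S by (auto simp: stable_subordinator_law_def)
    have L: "(LINT l|muS \<alpha>. exp (- q * (l t - l s))) = exp (- ?d * ?J \<alpha> q)" if "q \<ge> 0" for q
      using S st that by (simp add: stable_subordinator_law_def)
    note [measurable] = path_space(2)[OF sets]
    have "measure (muS \<alpha>) {l\<in>space (muS \<alpha>). \<bar>(l t - l s) - ?d\<bar> > \<delta>} \<le>
       ((\<integral>l. exp (- 2 * (l t - l s)) \<partial>muS \<alpha>) - 2 * exp (- ?d) * (\<integral>l. exp (- 1 * (l t - l s)) \<partial>muS \<alpha>) + exp (- 2 * ?d))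
       / (exp (- ?d) * (1 - exp (- \<delta>)))\<^sup>2"
    proof (rule prob_deviation_le[OF ps _ _ \<delta>])
      show "(\<lambda>l. l t - l s) \<in> borel_measurable (muS \<alpha>)" by measurable
      fix l assume "l \<in> space (muS \<alpha>)"
      then have "mono l" using path_space(1)[OF sets] by (simp add: subordinator_paths_def)
      then show "0 \<le> l t - l s" using st by (simp add: monoD)
    qed
    then show ?case using L[of 2] L[of 1] by simp
  qed
qed

lemma subordinator_deviation_tendsto_0:
  assumes C_pos: "\<And>\<alpha>. 1 < \<alpha> \<Longrightarrow> \<alpha> < 2 \<Longrightarrow> C \<alpha> > 0"
    and C_lim: "((\<lambda>\<alpha>. 2 * C \<alpha> / (2 - \<alpha>)) \<longlongrightarrow> 1) (at_left (2::real))"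
    and sub: "\<And>\<alpha>. 1 < \<alpha> \<Longrightarrow> \<alpha> < 2 \<Longrightarrow> stable_subordinator_law \<alpha> (C \<alpha>) (muS \<alpha>)"
    and \<delta>: "0 < \<delta>"
  shows "((\<lambda>\<alpha>. measure (muS \<alpha>) {l\<in>space (muS \<alpha>). \<bar>l t - t\<bar> > \<delta>}) \<longlongrightarrow> 0) (at_left 2)"
proof -
  have l0: "\<forall>\<^sub>F \<alpha> in at_left 2. \<forall>l\<in>space (muS \<alpha>). l 0 = 0"
    using at_left_2_between
  proof eventually_elim
    case (elim \<alpha>)
    then have "sets (muS \<alpha>) = sets (path_algebra subordinator_paths)"
      using sub[of \<alpha>] by (simp add: stable_subordinator_law_def)
    then show ?case using path_space(1) subordinator_path_0 by metis
  qed
  consider "t = 0" | "t < 0" | "t > 0" by linarith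
  then show ?thesis
  proof cases
    case 1
    have "\<forall>\<^sub>F \<alpha> in at_left 2. measure (muS \<alpha>) {l\<in>space (muS \<alpha>). \<bar>l t - t\<bar> > \<delta>} = 0"
      using l0
    proof eventually_elim
      case (elim \<alpha>)
      then have "{l\<in>space (muS \<alpha>). \<bar>l t - t\<bar> > \<delta>} = {}" using 1 \<delta> by auto
      then show ?case by (simp only: measure_empty)
    qed
    then show ?thesis by (rule tendsto_eventually)
  next
    case 2
    show ?thesis
    proof (rule Lim_transform_eventually[OF increment_deviation_tendsto_0[OF C_pos C_lim sub 2 \<delta>]])
      show "\<forall>\<^sub>F \<alpha> in at_left 2. measure (muS \<alpha>) {l\<in>space (muS \<alpha>). \<bar>(l 0 - l t) - (0 - t)\<bar> > \<delta>}
         = measure (muS \<alpha>) {l\<in>space (muS \<alpha>). \<bar>l t - t\<bar> > \<delta>}"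
        using l0 by eventually_elim (auto intro!: arg_cong[where f="measure _"])
    qed auto
  next
    case 3
    show ?thesis
    proof (rule Lim_transform_eventually[OF increment_deviation_tendsto_0[OF C_pos C_lim sub 3 \<delta>]])
      show "\<forall>\<^sub>F \<alpha> in at_left 2. measure (muS \<alpha>) {l\<in>space (muS \<alpha>). \<bar>(l t - l 0) - (t - 0)\<bar> > \<delta>}
         = measure (muS \<alpha>) {l\<in>space (muS \<alpha>). \<bar>l t - t\<bar> > \<delta>}"
        using l0 by eventually_elim (auto intro!: arg_cong[where f="measure _"])
    qed auto
  qed
qed

section \<open>Tightness and convergence in probability\<close>

text \<open>Times are rational so that the event is a countable intersection of coordinate events.
  The index \<open>m\<close> is both window and accuracy, \<open>n\<close> both bound and modulus,
  so a single sequence of values \<open>n\<close> describes a relatively compact set of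
  paths.\<close>

definition path_modulus :: "nat \<Rightarrow> nat \<Rightarrow> (real \<Rightarrow> real) \<Rightarrow> bool" where
  "path_modulus m n w \<longleftrightarrow> (\<forall>s\<in>\<rat>. \<forall>r\<in>\<rat>. \<bar>s\<bar> \<le> real m \<longrightarrow> \<bar>r\<bar> \<le> real m \<longrightarrow>
     \<bar>w s\<bar> \<le> real n \<and> (\<bar>s - r\<bar> < 1 / (real n + 1) \<longrightarrow> \<bar>w s - w r\<bar> \<le> 1 / (real m + 1)))"

lemma path_modulus_mono:
  assumes "path_modulus m n w" "n \<le> n'"
  shows "path_modulus m n' w"
proof -
  have "1 / (real n' + 1) \<le> 1 / (real n + 1)" using assms(2) by (simp add: frac_le)
  then show ?thesis
    using assms unfolding path_modulus_def by (smt (verit) of_nat_le_iff)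
qed

lemma path_modulus_exists:
  assumes w: "continuous_on UNIV w"
  shows "\<exists>n. path_modulus m n w"
proof -
  let ?K = "{- real m..real m}"
  have c: "continuous_on ?K w" using w by (rule continuous_on_subset) simp
  then have "uniformly_continuous_on ?K w" by (rule compact_uniformly_continuous) simp
  then obtain \<delta> where \<delta>: "\<delta> > 0"
    "\<And>s r. s \<in> ?K \<Longrightarrow> r \<in> ?K \<Longrightarrow> dist r s < \<delta> \<Longrightarrow> dist (w r) (w s) < 1 / (real m + 1)"
    unfolding uniformly_continuous_on_def by (metis add_pos_nonneg of_nat_0_le_iff zero_less_divide_1_iff zero_less_one add.commute)
  have "bounded (w ` ?K)" by (intro compact_imp_bounded compact_continuous_image c) simp
  then obtain B where B: "\<forall>s\<in>?K. \<bar>w s\<bar> \<le> B" by (auto simp: bounded_iff)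
  obtain n :: nat where n: "max B (1 / \<delta>) < real n" using reals_Archimedean2 by blast
  have "1 / (real n + 1) \<le> \<delta>"
  proof -
    have "1 / \<delta> \<le> real n + 1" using n by simp
    then show ?thesis using \<delta>(1) by (simp add: field_simps)
  qed
  then have "path_modulus m n w"
    unfolding path_modulus_def
  proof (intro ballI impI conjI)
    fix s r :: real assume sr: "\<bar>s\<bar> \<le> real m" "\<bar>r\<bar> \<le> real m"
    then have K: "s \<in> ?K" "r \<in> ?K" by auto
    show "\<bar>w s\<bar> \<le> real n" using B K(1) n by fastforce
    assume "\<bar>s - r\<bar> < 1 / (real n + 1)"
    with \<open>1 / (real n + 1) \<le> \<delta>\<close> have "dist s r < \<delta>" by (simp add: dist_real_def)
    from \<delta>(2)[OF K(2) K(1) this] show "\<bar>w s - w r\<bar> \<le> 1 / (real m + 1)" by (simp add: dist_real_def)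
  qed
  then show ?thesis ..
qed

lemma path_modulus_measurable:
  assumes sets: "sets M = sets (path_algebra X)"
  shows "{w \<in> space M. path_modulus m n w} \<in> sets M"
proof -
  note [measurable] = path_space(2)[OF sets]
  show ?thesis
    unfolding path_modulus_def
    by (intro sets.sets_Collect_countable_All'[OF _ countable_rat]) measurable
qed

text \<open>Each continuous path admits some \<open>n\<close> for every \<open>m\<close>, so the
  exceptional events decrease to the empty set and continuity from above applies. The allowances
  \<open>c * (1 / 2) ^ Suc m\<close> sum to \<open>c\<close>.\<close>

lemma wiener_tight:
  assumes W: "wiener_measure M" and c: "c > 0"
  shows "\<exists>N. {w \<in> space M. \<not> (\<forall>m. path_modulus m (N m) w)} \<in> sets M \<and>
     measure M {w \<in> space M. \<not> (\<forall>m. path_modulus m (N m) w)} \<le> c"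
proof -
  have sets: "sets M = sets (path_algebra wiener_paths)" and "prob_space M"
    using W by (auto simp: wiener_measure_def)
  interpret prob_space M by fact
  define A where "A m n = {w \<in> space M. \<not> path_modulus m n w}" for m n
  have A: "A m n \<in> events" for m n
    unfolding A_def using sets.sets_Collect_neg[OF path_modulus_measurable[OF sets]] by simp
  have "\<exists>n. measure M (A m n) < c * (1 / 2) ^ Suc m" for m
  proof -
    have "(\<lambda>n. measure M (A m n)) \<longlonglongrightarrow> measure M (\<Inter>n. A m n)"
    proof (rule finite_Lim_measure_decseq)
      show "decseq (A m)" unfolding decseq_def A_def using path_modulus_mono by blast
    qed (use A in auto)
    moreover have "(\<Inter>n. A m n) = {}"
    proof -
      have "\<exists>n. path_modulus m n w" if "w \<in> space M" for w
        using that path_modulus_exists path_space(1)[OF sets] by (simp add: wiener_paths_def)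
      then show ?thesis unfolding A_def by blast
    qed
    ultimately have "(\<lambda>n. measure M (A m n)) \<longlonglongrightarrow> 0" by simp
    then have "\<forall>\<^sub>F n in sequentially. measure M (A m n) < c * (1 / 2) ^ Suc m"
      using c by (intro order_tendstoD) auto
    then show ?thesis by (auto simp: eventually_sequentially)
  qed
  then obtain N where N: "\<And>m. measure M (A m (N m)) < c * (1 / 2) ^ Suc m" by metis
  have eq: "{w \<in> space M. \<not> (\<forall>m. path_modulus m (N m) w)} = (\<Union>m. A m (N m))"
    by (auto simp: A_def)
  have s: "(\<lambda>m. c * (1 / 2) ^ Suc m) sums (c * 1)" by (intro sums_mult power_half_series)
  have sA: "summable (\<lambda>m. measure M (A m (N m)))"
    by (rule summable_comparison_test'[OF sums_summable[OF s], of 0]) (use N less_imp_le in auto)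
  have "measure M (\<Union>m. A m (N m)) \<le> (\<Sum>m. measure M (A m (N m)))"
    by (rule finite_measure_subadditive_countably) (use A sA in auto)
  also have "\<dots> \<le> (\<Sum>m. c * (1 / 2) ^ Suc m)"
    by (rule suminf_le[OF less_imp_le[OF N] sA sums_summable[OF s]])
  also have "\<dots> = c" using sums_unique[OF s] by simp
  finally have le: "measure M (\<Union>m. A m (N m)) \<le> c" .
  show ?thesis
  proof (intro exI conjI)
    show "{w \<in> space M. \<not> (\<forall>m. path_modulus m (N m) w)} \<in> events"
      unfolding eq using A by (intro sets.countable_UN) auto
    show "measure M {w \<in> space M. \<not> (\<forall>m. path_modulus m (N m) w)} \<le> c"
      unfolding eq by (rule le)
  qed
qed

section \<open>Compactness of equicontinuous families and limits of monotone functions\<close>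

lemma rational_sequence: "\<exists>f. (\<forall>n. f n \<in> \<rat>) \<and> f \<longlonglongrightarrow> (x::real)"
  using closure_sequential[of x \<rat>] by (simp add: Rats_closure_real)

text \<open>The conditions on \<open>s\<close> and \<open>r\<close> are strict, so they persist at
  nearby rationals, and the weak inequality passes to the limit.\<close>

lemma path_modulus_real:
  assumes w: "continuous_on UNIV w" and U: "path_modulus m n w"
    and sr: "\<bar>s\<bar> < real m" "\<bar>r\<bar> < real m" "\<bar>s - r\<bar> < 1 / (real n + 1)"
  shows "\<bar>w s - w r\<bar> \<le> 1 / (real m + 1)"
proof -
  obtain f g where f: "\<And>k. f k \<in> \<rat>" "f \<longlonglongrightarrow> s" and g: "\<And>k. g k \<in> \<rat>" "g \<longlonglongrightarrow> r"
    using rational_sequence by meson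
  have wc: "isCont w x" for x using w by (simp add: continuous_on_eq_continuous_at)
  have lim: "(\<lambda>k. \<bar>w (f k) - w (g k)\<bar>) \<longlonglongrightarrow> \<bar>w s - w r\<bar>"
    by (intro tendsto_intros isCont_tendsto_compose[OF wc] f g)
  have "\<forall>\<^sub>F k in sequentially. \<bar>f k\<bar> < real m" "\<forall>\<^sub>F k in sequentially. \<bar>g k\<bar> < real m"
    "\<forall>\<^sub>F k in sequentially. \<bar>f k - g k\<bar> < 1 / (real n + 1)"
    by (rule order_tendstoD(2)[OF tendsto_rabs[OF f(2)] sr(1)]
             order_tendstoD(2)[OF tendsto_rabs[OF g(2)] sr(2)]
             order_tendstoD(2)[OF tendsto_rabs[OF tendsto_diff[OF f(2) g(2)]] sr(3)])+
  then have "\<forall>\<^sub>F k in sequentially. \<bar>w (f k) - w (g k)\<bar> \<le> 1 / (real m + 1)"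
    by eventually_elim (use U f(1) g(1) in \<open>simp add: path_modulus_def\<close>)
  then show ?thesis using lim by (intro tendsto_upperbound) auto
qed

lemma modulus_index:
  fixes t \<epsilon> :: real
  assumes "\<epsilon> > 0"
  shows "\<exists>m::nat. \<bar>t\<bar> < real m \<and> 1 / (real m + 1) < \<epsilon>"
proof -
  obtain m :: nat where m: "max \<bar>t\<bar> (1 / \<epsilon>) < real m" using reals_Archimedean2 by blast
  then have "1 / \<epsilon> < real m + 1" by simp
  then have "1 / (real m + 1) < \<epsilon>" using assms by (simp add: field_simps)
  with m show ?thesis by auto
qed

text \<open>Arzela-Ascoli with a diagonal sequence over the rationals. Convergence is stated along
  moving arguments \<open>s n\<close>, since a time-changed path is evaluated at
  \<open>l n t\<close> and not at \<open>t\<close>.\<close>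

lemma equicontinuous_subsequence:
  fixes w :: "nat \<Rightarrow> real \<Rightarrow> real"
  assumes w: "\<And>n. continuous_on UNIV (w n)" and U: "\<And>n m. path_modulus m (N m) (w n)"
  shows "\<exists>k w'. strict_mono k \<and> (\<forall>t. isCont w' t) \<and>
     (\<forall>t s. s \<longlonglongrightarrow> t \<longrightarrow> (\<lambda>n. w (k n) (s n)) \<longlonglongrightarrow> w' t)"
proof -
  define q where "q = from_nat_into (\<rat> :: real set)"
  have q: "range q = \<rat>" unfolding q_def by (rule range_from_nat_into) (auto simp: countable_rat intro: Rats_0)
  interpret sub: subseqs "\<lambda>n k. convergent (\<lambda>i. w (k i) (q n))"
  proof
    fix n and s :: "nat \<Rightarrow> nat"
    obtain m :: nat where m: "\<bar>q n\<bar> < real m" using reals_Archimedean2 by blast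
    have qn: "q n \<in> \<rat>" using q by blast
    have "\<bar>w (s i) (q n)\<bar> \<le> real (N m)" for i
      using U[of m "s i"] qn m unfolding path_modulus_def by (meson less_imp_le)
    then have "bounded (range (\<lambda>i. w (s i) (q n)))" by (auto simp: bounded_iff)
    then obtain l r where "strict_mono r" "((\<lambda>i. w (s i) (q n)) \<circ> r) \<longlonglongrightarrow> l"
      using bounded_imp_convergent_subsequence by blast
    then show "\<exists>r'. strict_mono r' \<and> convergent (\<lambda>i. w ((s \<circ> r') i) (q n))"
      by (auto simp: o_def convergent_def)
  qed
  define k where "k = sub.diagseq"
  have k: "strict_mono k" unfolding k_def by (rule sub.subseq_diagseq)
  have conv_q: "convergent (\<lambda>i. w (k i) (q n))" for n
  proof -
    \<comment> \<open>From the index \<open>Suc n\<close> on, the diagonal sequence is a subsequence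
      of the one selected for the rational \<open>q n\<close>.\<close>
    have "convergent (\<lambda>i. w ((k \<circ> (+) (Suc n)) i) (q n))"
      unfolding k_def
    proof (rule sub.diagseq_holds)
      fix r s :: "nat \<Rightarrow> nat" and n
      assume "strict_mono r" "convergent (\<lambda>i. w (s i) (q n))"
      then show "convergent (\<lambda>i. w ((s \<circ> r) i) (q n))"
        using convergent_subseq_convergent[of "\<lambda>i. w (s i) (q n)" r] by (simp add: o_def)
    qed
    then have "convergent (\<lambda>i. w (k (i + Suc n)) (q n))" by (simp add: o_def add.commute)
    then show ?thesis using convergent_ignore_initial_segment[of "\<lambda>i. w (k i) (q n)" "Suc n"] by simp
  qed
  have mod: "\<bar>w n s - w n r\<bar> \<le> 1 / (real m + 1)"
    if "\<bar>s\<bar> < real m" "\<bar>r\<bar> < real m" "\<bar>s - r\<bar> < 1 / (real (N m) + 1)" for n m s r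
    by (rule path_modulus_real[OF w U that])
  have near: "\<exists>\<delta>>0. \<forall>s. \<bar>s - t\<bar> < \<delta> \<longrightarrow> (\<forall>n. \<bar>w n s - w n t\<bar> < \<epsilon>)" if \<epsilon>: "\<epsilon> > 0" for t \<epsilon>
  proof -
    obtain m :: nat where m: "\<bar>t\<bar> < real m" "1 / (real m + 1) < \<epsilon>" using modulus_index[OF \<epsilon>] by blast
    define \<delta> where "\<delta> = min (real m - \<bar>t\<bar>) (1 / (real (N m) + 1))"
    have "\<delta> > 0" using m by (simp add: \<delta>_def)
    moreover have "\<bar>w n s - w n t\<bar> < \<epsilon>" if "\<bar>s - t\<bar> < \<delta>" for n s
    proof -
      have "\<bar>s\<bar> < real m" "\<bar>s - t\<bar> < 1 / (real (N m) + 1)" using that by (auto simp: \<delta>_def)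
      from mod[OF this(1) m(1) this(2), of n] m(2) show ?thesis by linarith
    qed
    ultimately show ?thesis by blast
  qed
  have "convergent (\<lambda>i. w (k i) t)" for t
  proof (rule real_Cauchy_convergent, rule metric_CauchyI)
    fix \<epsilon> :: real assume \<epsilon>: "\<epsilon> > 0"
    obtain \<delta> where \<delta>: "\<delta> > 0" "\<And>s n. \<bar>s - t\<bar> < \<delta> \<Longrightarrow> \<bar>w n s - w n t\<bar> < \<epsilon> / 3"
      using near[of "\<epsilon> / 3" t] \<epsilon> by auto
    obtain x where x: "x \<in> \<rat>" "t < x" "x < t + \<delta>" using Rats_dense_in_real[of t "t + \<delta>"] \<delta> by auto
    then obtain n where "x = q n" using q by blast
    then have "Cauchy (\<lambda>i. w (k i) x)" using conv_q convergent_Cauchy by auto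
    then obtain n0 where n0: "\<And>i j. i \<ge> n0 \<Longrightarrow> j \<ge> n0 \<Longrightarrow> dist (w (k i) x) (w (k j) x) < \<epsilon> / 3"
      using metric_CauchyD[of "\<lambda>i. w (k i) x" "\<epsilon> / 3"] \<epsilon> by auto
    have "dist (w (k i) t) (w (k j) t) < \<epsilon>" if "i \<ge> n0" "j \<ge> n0" for i j
    proof -
      have "\<bar>w (k i) x - w (k i) t\<bar> < \<epsilon> / 3" "\<bar>w (k j) x - w (k j) t\<bar> < \<epsilon> / 3"
        using \<delta>(2)[of x] x by auto
      then show ?thesis using n0[OF that] unfolding dist_real_def by linarith
    qed
    then show "\<exists>n0. \<forall>i\<ge>n0. \<forall>j\<ge>n0. dist (w (k i) t) (w (k j) t) < \<epsilon>" by blast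
  qed
  then obtain w' where w': "\<And>t. (\<lambda>i. w (k i) t) \<longlonglongrightarrow> w' t" unfolding convergent_def by metis
  have near': "\<exists>\<delta>>0. \<forall>s. \<bar>s - t\<bar> < \<delta> \<longrightarrow> \<bar>w' s - w' t\<bar> < \<epsilon>" if \<epsilon>: "\<epsilon> > 0" for t \<epsilon>
  proof -
    obtain \<delta> where \<delta>: "\<delta> > 0" "\<And>s n. \<bar>s - t\<bar> < \<delta> \<Longrightarrow> \<bar>w n s - w n t\<bar> < \<epsilon> / 2"
      using near[of "\<epsilon> / 2" t] \<epsilon> by auto
    have "\<bar>w' s - w' t\<bar> < \<epsilon>" if s: "\<bar>s - t\<bar> < \<delta>" for s
    proof -
      have "(\<lambda>i. \<bar>w (k i) s - w (k i) t\<bar>) \<longlonglongrightarrow> \<bar>w' s - w' t\<bar>" by (intro tendsto_intros w')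
      then have "\<bar>w' s - w' t\<bar> \<le> \<epsilon> / 2"
        by (rule tendsto_upperbound) (use \<delta>(2)[OF s] less_imp_le in \<open>auto intro!: always_eventually\<close>)
      then show ?thesis using \<epsilon> by linarith
    qed
    with \<delta>(1) show ?thesis by blast
  qed
  have "isCont w' t" for t
    unfolding continuous_at_eps_delta dist_real_def using near' by blast
  moreover have "(\<lambda>n. w (k n) (s n)) \<longlonglongrightarrow> w' t" if s: "s \<longlonglongrightarrow> t" for s t
  proof (rule Lim_transform[OF w'[of t]])
    show "(\<lambda>n. w (k n) (s n) - w (k n) t) \<longlonglongrightarrow> 0"
    proof (rule LIMSEQ_I)
      fix \<epsilon> :: real assume "\<epsilon> > 0"
      then obtain \<delta> where \<delta>: "\<delta> > 0" "\<And>s n. \<bar>s - t\<bar> < \<delta> \<Longrightarrow> \<bar>w n s - w n t\<bar> < \<epsilon>"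
        using near[of \<epsilon> t] by auto
      obtain n0 where "\<And>n. n \<ge> n0 \<Longrightarrow> norm (s n - t) < \<delta>" using LIMSEQ_D[OF s \<delta>(1)] by blast
      then show "\<exists>n0. \<forall>n\<ge>n0. norm (w (k n) (s n) - w (k n) t - 0) < \<epsilon>"
        using \<delta>(2) by (intro exI[of _ n0]) auto
    qed
  qed
  ultimately show ?thesis using k by blast
qed

text \<open>A rational on either side of \<open>t\<close> traps \<open>l n t\<close> by
  monotonicity, and these rationals may be taken as close to \<open>t\<close> as desired.\<close>

lemma mono_tendsto_identity:
  fixes l :: "nat \<Rightarrow> real \<Rightarrow> real"
  assumes mono: "\<And>n. mono (l n)" and lim: "\<And>x. x \<in> \<rat> \<Longrightarrow> (\<lambda>n. l n x) \<longlonglongrightarrow> x"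
  shows "(\<lambda>n. l n t) \<longlonglongrightarrow> t"
proof (rule order_tendstoI)
  fix a assume "a < t"
  then obtain x where x: "x \<in> \<rat>" "a < x" "x < t" using Rats_dense_in_real by blast
  have "\<forall>\<^sub>F n in sequentially. a < l n x" by (rule order_tendstoD(1)[OF lim[OF x(1)] x(2)])
  then show "\<forall>\<^sub>F n in sequentially. a < l n t"
  proof eventually_elim
    case (elim n)
    then show ?case using monoD[OF mono, of x t n] x by linarith
  qed
next
  fix a assume "t < a"
  then obtain x where x: "x \<in> \<rat>" "t < x" "x < a" using Rats_dense_in_real by blast
  have "\<forall>\<^sub>F n in sequentially. l n x < a" by (rule order_tendstoD(2)[OF lim[OF x(1)] x(3)])
  then show "\<forall>\<^sub>F n in sequentially. l n t < a"
  proof eventually_elim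
    case (elim n)
    then show ?case using monoD[OF mono, of t x n] x by linarith
  qed
qed

text \<open>Nothing is assumed about the measurability of \<open>X\<close>: outside a small measurable event the
  Wiener path ranges over a compact set, where sequential continuity is uniform.\<close>

lemma tends_to_0_in_probI:
  fixes X :: "(real \<Rightarrow> real) \<Rightarrow> (real \<Rightarrow> real) \<Rightarrow> real"
  assumes C_pos: "\<And>\<alpha>. 1 < \<alpha> \<Longrightarrow> \<alpha> < 2 \<Longrightarrow> C \<alpha> > 0"
    and C_lim: "((\<lambda>\<alpha>. 2 * C \<alpha> / (2 - \<alpha>)) \<longlongrightarrow> 1) (at_left 2)"
    and W: "wiener_measure muW"
    and sub: "\<And>\<alpha>. 1 < \<alpha> \<Longrightarrow> \<alpha> < 2 \<Longrightarrow> stable_subordinator_law \<alpha> (C \<alpha>) (muS \<alpha>)"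
    and det: "\<And>\<omega> l w. (\<And>n. (\<omega> n, l n) \<in> good_paths) \<Longrightarrow> (\<And>t. isCont w t) \<Longrightarrow>
        (\<And>t. (\<lambda>n. \<omega> n t) \<longlonglongrightarrow> w t) \<Longrightarrow> (\<And>t. (\<lambda>n. \<omega> n (l n t)) \<longlonglongrightarrow> w t) \<Longrightarrow>
        \<exists>Y. (\<forall>n. X (\<omega> n) (l n) \<le> Y n) \<and> Y \<longlonglongrightarrow> 0"
  shows "tends_to_0_in_prob (\<lambda>\<alpha>. muW \<Otimes>\<^sub>M muS \<alpha>) good_paths (\<lambda>\<alpha> (w, l). X w l)"
  unfolding tends_to_0_in_prob_def
proof (intro allI impI)
  fix \<epsilon> :: real assume \<epsilon>: "\<epsilon> > 0"
  have setsW: "sets muW = sets (path_algebra wiener_paths)" and psW: "prob_space muW"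
    using W by (auto simp: wiener_measure_def)
  define q where "q = from_nat_into (\<rat> :: real set)"
  have q: "range q = \<rat>" unfolding q_def by (rule range_from_nat_into) (auto simp: countable_rat intro: Rats_0)
  show "((\<lambda>\<alpha>. outer_measure_of (muW \<Otimes>\<^sub>M muS \<alpha>) {p \<in> good_paths. (case p of (w, l) \<Rightarrow> X w l) > \<epsilon>}) \<longlongrightarrow> 0) (at_left 2)"
  proof (rule order_tendstoI)
    fix a :: ennreal assume "0 < a"
    then obtain b where b: "0 < b" "b < a" using dense by blast
    then obtain r where r: "b = ennreal r" "r > 0"
      by (cases b) auto
    \<comment> \<open>One half is for the exceptional Wiener paths, the other for the deviations of
      the subordinator.\<close>
    define c where "c = r / 2"
    have c: "c > 0" using r by (simp add: c_def)
    obtain N where N: "{w \<in> space muW. \<not> (\<forall>m. path_modulus m (N m) w)} \<in> sets muW"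
      "measure muW {w \<in> space muW. \<not> (\<forall>m. path_modulus m (N m) w)} \<le> c"
      using wiener_tight[OF W c] by blast
    define E where "E = {w \<in> space muW. \<not> (\<forall>m. path_modulus m (N m) w)}"
    \<comment> \<open>A single \<open>j\<close>, found before any law of the subordinator enters:
      closeness at finitely many rational times already forces \<open>X w l \<le> \<epsilon>\<close>
      off \<open>E\<close>. As \<open>j\<close> does not depend on \<alpha>, only finitely many
      deviation probabilities remain to be controlled.\<close>
    have "\<exists>j. \<forall>w l. (w, l) \<in> good_paths \<longrightarrow> w \<notin> E \<longrightarrow> (\<forall>i\<le>j. \<bar>l (q i) - q i\<bar> \<le> 1 / real (Suc j)) \<longrightarrow> X w l \<le> \<epsilon>"
    proof (rule ccontr)
      assume "\<not> ?thesis"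
      then have "\<forall>j. \<exists>w l. (w, l) \<in> good_paths \<and> w \<notin> E \<and> (\<forall>i\<le>j. \<bar>l (q i) - q i\<bar> \<le> 1 / real (Suc j)) \<and> X w l > \<epsilon>"
        by (meson not_le)
      then obtain \<omega> l where \<omega>: "\<And>j. (\<omega> j, l j) \<in> good_paths" "\<And>j. \<omega> j \<notin> E"
        "\<And>j i. i \<le> j \<Longrightarrow> \<bar>l j (q i) - q i\<bar> \<le> 1 / real (Suc j)" "\<And>j. X (\<omega> j) (l j) > \<epsilon>"
        by metis
      have \<omega>w: "\<omega> j \<in> wiener_paths" and ls: "l j \<in> subordinator_paths" for j
        using \<omega>(1)[of j] by (auto simp: good_paths_def)
      have cont: "continuous_on UNIV (\<omega> j)" for j using \<omega>w by (simp add: wiener_paths_def)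
      have "path_modulus m (N m) (\<omega> j)" for j m
        using \<omega>(2)[of j] \<omega>w[of j] path_space(1)[OF setsW] by (auto simp: E_def)
      then obtain k w where k: "strict_mono k" and w: "\<And>t. isCont w t"
        "\<And>t s. s \<longlonglongrightarrow> t \<Longrightarrow> (\<lambda>n. \<omega> (k n) (s n)) \<longlonglongrightarrow> w t"
        using equicontinuous_subsequence[of \<omega> N, OF cont] by blast
      have lt: "(\<lambda>n. l n t) \<longlonglongrightarrow> t" for t
      proof (rule mono_tendsto_identity)
        show "mono (l n)" for n using ls[of n] by (simp add: subordinator_paths_def)
        fix x :: real assume "x \<in> \<rat>"
        then obtain i where i: "x = q i" using q by blast
        show "(\<lambda>n. l n x) \<longlonglongrightarrow> x"
        proof (rule LIM_zero_cancel, rule Lim_null_comparison[OF _ LIMSEQ_inverse_real_of_nat])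
          show "\<forall>\<^sub>F n in sequentially. norm (l n x - x) \<le> inverse (real (Suc n))"
            using eventually_ge_at_top[of i] by eventually_elim (use \<omega>(3) i in \<open>simp add: inverse_eq_divide\<close>)
        qed
      qed
      have "(\<lambda>n. l (k n) t) \<longlonglongrightarrow> t" for t
        using LIMSEQ_subseq_LIMSEQ[OF lt k] by (simp add: o_def)
      then have "\<exists>Y. (\<forall>n. X (\<omega> (k n)) (l (k n)) \<le> Y n) \<and> Y \<longlonglongrightarrow> 0"
        using \<omega>(1) w by (intro det[where w=w]) auto
      then obtain Y where Y: "\<And>n. X (\<omega> (k n)) (l (k n)) \<le> Y n" "Y \<longlonglongrightarrow> 0" by blast
      have "\<forall>\<^sub>F n in sequentially. Y n < \<epsilon>" by (rule order_tendstoD(2)[OF Y(2) \<epsilon>])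
      then obtain n where "Y n < \<epsilon>" by (auto simp: eventually_sequentially)
      then show False using Y(1)[of n] \<omega>(4)[of "k n"] by linarith
    qed
    then obtain j where j: "\<And>w l. (w, l) \<in> good_paths \<Longrightarrow> w \<notin> E \<Longrightarrow>
        (\<And>i. i \<le> j \<Longrightarrow> \<bar>l (q i) - q i\<bar> \<le> 1 / real (Suc j)) \<Longrightarrow> X w l \<le> \<epsilon>"
      by blast
    define B where "B \<alpha> i = {l \<in> space (muS \<alpha>). \<bar>l (q i) - q i\<bar> > 1 / real (Suc j)}" for \<alpha> i
    have "((\<lambda>\<alpha>. \<Sum>i\<le>j. measure (muS \<alpha>) (B \<alpha> i)) \<longlongrightarrow> (\<Sum>i\<le>j. 0)) (at_left 2)"
      unfolding B_def
      by (intro tendsto_sum subordinator_deviation_tendsto_0[OF C_pos C_lim sub]) auto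
    then have "\<forall>\<^sub>F \<alpha> in at_left 2. (\<Sum>i\<le>j. measure (muS \<alpha>) (B \<alpha> i)) < c"
      using c by (intro order_tendstoD) auto
    then show "\<forall>\<^sub>F \<alpha> in at_left 2. outer_measure_of (muW \<Otimes>\<^sub>M muS \<alpha>) {p \<in> good_paths. (case p of (w, l) \<Rightarrow> X w l) > \<epsilon>} < a"
      using at_left_2_between
    proof eventually_elim
      case (elim \<alpha>)
      have setsS: "sets (muS \<alpha>) = sets (path_algebra subordinator_paths)" and psS: "prob_space (muS \<alpha>)"
        using sub[of \<alpha>] elim by (auto simp: stable_subordinator_law_def)
      interpret W: prob_space muW by (rule psW)
      interpret S: prob_space "muS \<alpha>" by (rule psS)
      interpret P: pair_prob_space muW "muS \<alpha>" ..
      note [measurable] = path_space(2)[OF setsS]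
      have B: "B \<alpha> i \<in> sets (muS \<alpha>)" for i unfolding B_def by measurable
      have E: "E \<in> sets muW" "measure muW E \<le> c" using N by (simp_all add: E_def)
      let ?R = "E \<times> space (muS \<alpha>)" and ?T = "space muW \<times> (\<Union>i\<le>j. B \<alpha> i)"
      have sub: "{p \<in> good_paths. (case p of (w, l) \<Rightarrow> X w l) > \<epsilon>} \<subseteq> ?R \<union> ?T"
      proof (rule subsetI)
        fix p assume p: "p \<in> {p \<in> good_paths. (case p of (w, l) \<Rightarrow> X w l) > \<epsilon>}"
        obtain w l where wl_eq: "p = (w, l)" by fastforce
        with p have wl: "(w, l) \<in> good_paths" "X w l > \<epsilon>" by auto
        have sp: "w \<in> space muW" "l \<in> space (muS \<alpha>)"
          using wl(1) by (simp_all add: good_paths_def path_space(1)[OF setsW] path_space(1)[OF setsS])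
        have "\<not> (\<forall>i\<le>j. \<bar>l (q i) - q i\<bar> \<le> 1 / real (Suc j))" if "w \<notin> E"
          using j[OF wl(1) that] wl(2) by force
        then show "p \<in> ?R \<union> ?T" using sp by (auto simp: wl_eq B_def not_le)
      qed
      have RT: "?R \<in> sets (muW \<Otimes>\<^sub>M muS \<alpha>)" "?T \<in> sets (muW \<Otimes>\<^sub>M muS \<alpha>)"
        using E(1) B by auto
      have "outer_measure_of (muW \<Otimes>\<^sub>M muS \<alpha>) {p \<in> good_paths. (case p of (w, l) \<Rightarrow> X w l) > \<epsilon>}
          \<le> outer_measure_of (muW \<Otimes>\<^sub>M muS \<alpha>) (?R \<union> ?T)"
        by (rule outer_measure_of_mono[OF sub])
      also have "\<dots> = emeasure (muW \<Otimes>\<^sub>M muS \<alpha>) (?R \<union> ?T)" using RT by simp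
      also have "\<dots> \<le> emeasure (muW \<Otimes>\<^sub>M muS \<alpha>) ?R + emeasure (muW \<Otimes>\<^sub>M muS \<alpha>) ?T"
        by (rule emeasure_subadditive[OF RT])
      also have "emeasure (muW \<Otimes>\<^sub>M muS \<alpha>) ?R = ennreal (measure muW E)"
        using E(1) by (subst S.emeasure_pair_measure_Times) (auto simp: S.emeasure_space_1 W.emeasure_eq_measure)
      also have "emeasure (muW \<Otimes>\<^sub>M muS \<alpha>) ?T = ennreal (measure (muS \<alpha>) (\<Union>i\<le>j. B \<alpha> i))"
        using B by (subst S.emeasure_pair_measure_Times) (auto simp: W.emeasure_space_1 S.emeasure_eq_measure)
      also have "ennreal (measure muW E) + ennreal (measure (muS \<alpha>) (\<Union>i\<le>j. B \<alpha> i)) \<le> ennreal c + ennreal c"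
      proof (intro add_mono ennreal_leI E(2))
        have "measure (muS \<alpha>) (\<Union>i\<le>j. B \<alpha> i) \<le> (\<Sum>i\<le>j. measure (muS \<alpha>) (B \<alpha> i))"
          by (rule S.finite_measure_subadditive_finite) (use B in auto)
        then show "measure (muS \<alpha>) (\<Union>i\<le>j. B \<alpha> i) \<le> c" using elim by linarith
      qed
      also have "ennreal c + ennreal c = b" using r(2) by (subst ennreal_plus[symmetric]) (simp_all add: r(1) c_def)
      finally show ?case using b(2) by simp
    qed
  qed simp
qed

section \<open>The main theorem\<close>

text \<open>The isometry \<open>A_inv\<close> carries the derivative of \<open>F\<close> to the
  ambient space. Its bound by \<open>L\<close> is inherited from difference quotients of a Lipschitz
  map, and continuity in operator norm implies strong continuity.\<close>

lemma (in lipschitz_gap) C1_gap_exists: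
  assumes "C1_map_on domA nA UNIV norm F"
  shows "\<exists>Dh. C1_gap e lam \<sigma> L \<mu> \<beta> N F Dh"
proof -
  obtain D where D: "\<And>u. u \<in> domA \<Longrightarrow> has_deriv_on domA nA UNIV norm F (D u) u"
    and Dc: "\<And>u \<epsilon>. u \<in> domA \<Longrightarrow> \<epsilon> > 0 \<Longrightarrow> \<exists>\<delta>>0. \<forall>v\<in>domA. nA (v - u) < \<delta> \<longrightarrow>
              op_norm_on domA nA norm (\<lambda>h. D v h - D u h) < \<epsilon>"
    using assms unfolding C1_map_on_def by blast
  define Dh where "Dh v h = D (A_inv v) (A_inv h)" for v h
  have lin: "Dh v (a *\<^sub>R h + b *\<^sub>R k) = a *\<^sub>R Dh v h + b *\<^sub>R Dh v k" for v a b h k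
    unfolding Dh_def A_inv_add A_inv_scaleR by (rule has_deriv_onD(3)[OF D]) (rule A_inv_dom)+
  have der: "\<exists>\<delta>>0. \<forall>h. norm h < \<delta> \<longrightarrow> norm (Fh (v + h) - Fh v - Dh v h) \<le> \<epsilon> * norm h"
    if \<epsilon>: "\<epsilon> > 0" for v \<epsilon>
  proof -
    obtain \<delta> where \<delta>: "\<delta> > 0" "\<And>h. h \<in> domA \<Longrightarrow> nA h < \<delta> \<Longrightarrow>
        norm (F (A_inv v + h) - F (A_inv v) - D (A_inv v) h) \<le> \<epsilon> * nA h"
      using has_deriv_onD(4)[OF D[OF A_inv_dom] \<epsilon>, of v] by blast
    have "norm (Fh (v + h) - Fh v - Dh v h) \<le> \<epsilon> * norm h" if "norm h < \<delta>" for h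
      using \<delta>(2)[OF A_inv_dom, of h] that by (simp add: Fh_def Dh_def A_inv_add)
    with \<delta>(1) show ?thesis by blast
  qed
  have scale: "Dh v (c *\<^sub>R h) = c *\<^sub>R Dh v h" for v c h using lin[of v c h 0 h] by simp
  have bound: "norm (Dh v h) \<le> L * norm h" for v h
  proof (rule field_le_epsilon)
    fix r :: real assume r: "r > 0"
    define \<epsilon> where "\<epsilon> = r / (norm h + 1)"
    have \<epsilon>: "\<epsilon> > 0" using r by (simp add: \<epsilon>_def add_nonneg_pos)
    have "norm h + 1 > 0" by (simp add: add_nonneg_pos)
    then have "\<epsilon> * (norm h + 1) = r" by (simp add: \<epsilon>_def)
    then have \<epsilon>h: "\<epsilon> * norm h \<le> r" using \<epsilon> by (simp add: distrib_left)
    obtain \<delta> where \<delta>: "\<delta> > 0" "\<And>k. norm k < \<delta> \<Longrightarrow> norm (Fh (v + k) - Fh v - Dh v k) \<le> \<epsilon> * norm k"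
      using der[OF \<epsilon>] by blast
    \<comment> \<open>Shrinks \<open>h\<close> into the region of the derivative estimate; the scale
      drops out again by linearity.\<close>
    define c where "c = \<delta> / (2 * (norm h + 1))"
    have c: "c > 0" using \<delta> by (simp add: c_def add_nonneg_pos)
    have "c * norm h < \<delta>" using \<delta>(1) by (simp add: c_def divide_less_eq add_nonneg_pos algebra_simps add_pos_nonneg)
    then have ch: "norm (c *\<^sub>R h) < \<delta>" using c by simp
    have "norm (Dh v (c *\<^sub>R h)) \<le> norm (Fh (v + c *\<^sub>R h) - Fh v) + norm (Fh (v + c *\<^sub>R h) - Fh v - Dh v (c *\<^sub>R h))"
      using norm_triangle_ineq4[of "Fh (v + c *\<^sub>R h) - Fh v" "Fh (v + c *\<^sub>R h) - Fh v - Dh v (c *\<^sub>R h)"] by simp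
    also have "\<dots> \<le> L * norm (c *\<^sub>R h) + \<epsilon> * norm (c *\<^sub>R h)"
      using Fh_lipschitz[of "v + c *\<^sub>R h" v] \<delta>(2)[OF ch] by simp
    finally have "c * norm (Dh v h) \<le> c * (L * norm h + \<epsilon> * norm h)"
      using c by (simp add: scale algebra_simps)
    then have "norm (Dh v h) \<le> L * norm h + \<epsilon> * norm h" using c by simp
    then show "norm (Dh v h) \<le> L * norm h + r" using \<epsilon>h by linarith
  qed
  have op: "norm (Dh v h - Dh u h) \<le> op_norm_on domA nA norm (\<lambda>h. D (A_inv v) h - D (A_inv u) h) * norm h" for u v h
  proof (cases "h = 0")
    case True
    then show ?thesis using scale[of _ 0 h] by simp
  next
    case False
    let ?T = "\<lambda>h. D (A_inv v) h - D (A_inv u) h"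
    \<comment> \<open>\<open>op_norm_on\<close> is a supremum of reals, which dominates the members
      of the set once the set is known to be bounded above.\<close>
    have bdd: "bdd_above ((\<lambda>h. norm (?T h)) ` {h \<in> domA. nA h \<le> 1})"
    proof (rule bdd_aboveI2)
      fix k assume k: "k \<in> {h \<in> domA. nA h \<le> 1}"
      then have k': "k = A_inv (Apow k)" "norm (Apow k) \<le> 1" by (auto simp: norm_A_def)
      have "norm (?T k) \<le> norm (Dh v (Apow k)) + norm (Dh u (Apow k))"
        unfolding Dh_def k'(1)[symmetric] by (rule norm_triangle_ineq4)
      also have "\<dots> \<le> L * norm (Apow k) + L * norm (Apow k)" by (intro add_mono bound)
      also have "\<dots> \<le> L * 1 + L * 1" using k'(2) L_pos by (intro add_mono mult_left_mono) auto
      finally show "norm (?T k) \<le> L * 1 + L * 1" .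
    qed
    define c where "c = inverse (norm h)"
    have "norm (?T (A_inv (c *\<^sub>R h))) \<le> op_norm_on domA nA norm ?T"
      unfolding op_norm_on_def
      by (rule cSUP_upper[OF _ bdd]) (use False A_inv_dom[of "c *\<^sub>R h"] in \<open>simp add: c_def\<close>)
    moreover have "?T (A_inv (c *\<^sub>R h)) = c *\<^sub>R (Dh v h - Dh u h)"
      using scale[of v c h] scale[of u c h] by (simp add: Dh_def scaleR_diff_right)
    ultimately have "norm (c *\<^sub>R (Dh v h - Dh u h)) \<le> op_norm_on domA nA norm ?T" by simp
    moreover have "norm (c *\<^sub>R z) = norm z / norm h" for z :: 'a
      by (simp add: c_def divide_inverse mult.commute)
    ultimately show ?thesis using False by (simp add: pos_divide_le_eq)
  qed
  have seq: "(\<lambda>n. Dh (f n) h) \<longlonglongrightarrow> Dh v h" if f: "f \<longlonglongrightarrow> v" for f v h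
  proof (rule LIMSEQ_I)
    fix r :: real assume r: "r > 0"
    define \<epsilon> where "\<epsilon> = r / (norm h + 1)"
    have \<epsilon>: "\<epsilon> > 0" using r by (simp add: \<epsilon>_def add_nonneg_pos)
    have \<epsilon>h: "\<epsilon> * norm h < r" using r by (simp add: \<epsilon>_def divide_less_eq add_nonneg_pos)
    obtain \<delta> where \<delta>: "\<delta> > 0" "\<And>u. u \<in> domA \<Longrightarrow> nA (u - A_inv v) < \<delta> \<Longrightarrow>
        op_norm_on domA nA norm (\<lambda>h. D u h - D (A_inv v) h) < \<epsilon>"
      using Dc[OF A_inv_dom \<epsilon>, of v] by blast
    obtain n0 where n0: "\<And>n. n \<ge> n0 \<Longrightarrow> norm (f n - v) < \<delta>" using LIMSEQ_D[OF f \<delta>(1)] by blast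
    have "norm (Dh (f n) h - Dh v h) < r" if "n \<ge> n0" for n
    proof -
      have "op_norm_on domA nA norm (\<lambda>h. D (A_inv (f n)) h - D (A_inv v) h) < \<epsilon>"
        using \<delta>(2)[OF A_inv_dom, of "f n"] n0[OF that] by (simp flip: A_inv_diff)
      then have "op_norm_on domA nA norm (\<lambda>h. D (A_inv (f n)) h - D (A_inv v) h) * norm h \<le> \<epsilon> * norm h"
        by (intro mult_right_mono) auto
      then show ?thesis using op[of "f n" h v] \<epsilon>h by linarith
    qed
    then show "\<exists>n0. \<forall>n\<ge>n0. norm (Dh (f n) h - Dh v h) < r" by blast
  qed
  have "C1_gap e lam \<sigma> L \<mu> \<beta> N F Dh"
    by unfold_locales (fact lin bound der seq)+
  then show ?thesis by blast
qed

lemma (in lipschitz_gap) nA_graph_map_triangle: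
  "nA (graph_map x \<xi> - graph_map y \<xi>) \<le> nA (graph_map x \<xi> - graph_map z \<xi>) + nA (graph_map y \<xi> - graph_map z \<xi>)"
  unfolding graph_map_def A_inv_diff[symmetric] nA_A_inv
  using norm_triangle_ineq4[of "QQ (orbit x (Apow \<xi>) 0) - QQ (orbit z (Apow \<xi>) 0)"
      "QQ (orbit y (Apow \<xi>) 0) - QQ (orbit z (Apow \<xi>) 0)"] by simp

theorem theorem4p4:
  fixes e :: "nat \<Rightarrow> 'a::{real_inner, banach, second_countable_topology}"
    and lam :: "nat \<Rightarrow> real"
    and F :: "'a \<Rightarrow> 'a"
    and \<sigma> L \<mu> \<beta> :: real
    and N :: nat
    and C :: "real \<Rightarrow> real"
    and muW :: "(real \<Rightarrow> real) measure"
    and muS :: "real \<Rightarrow> (real \<Rightarrow> real) measure"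
  assumes orthonormal: "\<And>j k. j \<ge> 1 \<Longrightarrow> k \<ge> 1 \<Longrightarrow> e j \<bullet> e k = (if j = k then 1 else 0)"
    and basis: "closure (span (e ` {1..})) = UNIV"
    and lam_pos: "0 < lam 1"
    and lam_mono: "\<And>k. k \<ge> 1 \<Longrightarrow> lam k \<le> lam (Suc k)"
    and lam_lim: "filterlim lam at_top sequentially"
    and sigma: "0 \<le> \<sigma>" "\<sigma> < 1"
    and L_pos: "L > 0"
    and F_0: "F 0 = 0"
    and F_Lipschitz: "\<And>u1 u2. u1 \<in> dom_A_pow e lam \<sigma> \<Longrightarrow> u2 \<in> dom_A_pow e lam \<sigma> \<Longrightarrow>
           norm (F u1 - F u2) \<le> L * norm_A e lam \<sigma> (u1 - u2)"
    and N: "N \<ge> 1" "lam N < lam (N + 1)"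
    and mu: "0 < \<mu>" "\<mu> < 1"
    and gap: "lam (N + 1) - lam N \<ge>
           2 * L / \<mu> * (lam N powr \<sigma>
             + (if \<sigma> = 0 then 1 else \<sigma> powr \<sigma>) * Gamma (1 - \<sigma>) * (lam (N + 1) - lam N) powr \<sigma>
             + lam (N + 1) powr \<sigma>)"
    and beta: "\<beta> = lam N + 2 / \<mu> * L * lam N powr \<sigma>"
    and C_pos: "\<And>\<alpha>. 1 < \<alpha> \<Longrightarrow> \<alpha> < 2 \<Longrightarrow> C \<alpha> > 0"
    and C_lim: "((\<lambda>\<alpha>. 2 * C \<alpha> / (2 - \<alpha>)) \<longlongrightarrow> 1) (at_left 2)"
    and wiener: "wiener_measure muW"
    and subordinator: "\<And>\<alpha>. 1 < \<alpha> \<Longrightarrow> \<alpha> < 2 \<Longrightarrow> stable_subordinator_law \<alpha> (C \<alpha>) (muS \<alpha>)"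
  shows "(\<forall>\<xi> \<in> proj_P e N ` dom_A_pow e lam \<sigma>.
            tends_to_0_in_prob (\<lambda>\<alpha>. muW \<Otimes>\<^sub>M muS \<alpha>) good_paths
              (\<lambda>\<alpha> (w, l). norm_A e lam \<sigma>
                 (manifold_map e lam \<sigma> F N \<beta> (w \<circ> l) \<xi> - manifold_map e lam \<sigma> F N \<beta> w \<xi>))) \<and>
         (C1_map_on (dom_A_pow e lam \<sigma>) (norm_A e lam \<sigma>) UNIV norm F \<longrightarrow>
          (\<forall>\<xi> \<in> proj_P e N ` dom_A_pow e lam \<sigma>.
            tends_to_0_in_prob (\<lambda>\<alpha>. muW \<Otimes>\<^sub>M muS \<alpha>) good_paths
              (\<lambda>\<alpha> (w, l). op_norm_on (proj_P e N ` dom_A_pow e lam \<sigma>) (norm_A e lam \<sigma>) (norm_A e lam \<sigma>)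
                 (\<lambda>h. deriv_manifold_map e lam \<sigma> F N \<beta> (w \<circ> l) \<xi> h
                    - deriv_manifold_map e lam \<sigma> F N \<beta> w \<xi> h))))"
proof (intro conjI impI ballI)
  interpret lipschitz_gap e lam \<sigma> L \<mu> \<beta> N F
    by unfold_locales (fact assms)+
  note prob = tends_to_0_in_probI[OF C_pos C_lim wiener subordinator]
  have nc: "nearly_continuous w" if "\<And>t. isCont w t" for w :: "real \<Rightarrow> real"
    unfolding nearly_continuous_def using that by (intro exI[of _ "{}"]) auto
  have driving_nc: "driving_path x \<Longrightarrow> nearly_continuous x" for x by (simp add: driving_path_def)
  {
    fix \<xi> assume \<xi>: "\<xi> \<in> proj_P e N ` dom_A_pow e lam \<sigma>"
    show "tends_to_0_in_prob (\<lambda>\<alpha>. muW \<Otimes>\<^sub>M muS \<alpha>) good_paths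
              (\<lambda>\<alpha> (w, l). norm_A e lam \<sigma>
                 (manifold_map e lam \<sigma> F N \<beta> (w \<circ> l) \<xi> - manifold_map e lam \<sigma> F N \<beta> w \<xi>))"
    proof (rule prob)
      fix \<omega> l :: "nat \<Rightarrow> real \<Rightarrow> real" and w
      assume good: "\<And>n. (\<omega> n, l n) \<in> good_paths" and w: "\<And>t. isCont w t"
        and lim: "\<And>t. (\<lambda>n. \<omega> n t) \<longlonglongrightarrow> w t" "\<And>t. (\<lambda>n. \<omega> n (l n t)) \<longlonglongrightarrow> w t"
      note d = good_paths_driving[OF good]
      \<comment> \<open>Both maps are compared with the graph map of the limit path
        \<open>w\<close>. Since \<open>w\<close> need not be tempered, the comparison is made
        through \<open>graph_map\<close> and not through \<open>manifold_map\<close>.\<close>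
      let ?Y = "\<lambda>n. nA (graph_map (\<omega> n \<circ> l n) \<xi> - graph_map w \<xi>) + nA (graph_map (\<omega> n) \<xi> - graph_map w \<xi>)"
      have "?Y \<longlonglongrightarrow> 0 + 0"
        using lim by (intro tendsto_add graph_map_tendsto driving_nc d nc w) auto
      then have "?Y \<longlonglongrightarrow> 0" by simp
      moreover have "nA (manifold_map e lam \<sigma> F N \<beta> (\<omega> n \<circ> l n) \<xi> - manifold_map e lam \<sigma> F N \<beta> (\<omega> n) \<xi>) \<le> ?Y n" for n
        unfolding manifold_map_eq[OF d(1) \<xi>] manifold_map_eq[OF d(2) \<xi>] by (rule nA_graph_map_triangle)
      ultimately show "\<exists>Y. (\<forall>n. nA (manifold_map e lam \<sigma> F N \<beta> (\<omega> n \<circ> l n) \<xi> - manifold_map e lam \<sigma> F N \<beta> (\<omega> n) \<xi>) \<le> Y n) \<and> Y \<longlonglongrightarrow> 0"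
        by (intro exI[of _ ?Y] conjI allI)
    qed
  }
  fix \<xi> assume C1: "C1_map_on (dom_A_pow e lam \<sigma>) (norm_A e lam \<sigma>) UNIV norm F"
    and \<xi>: "\<xi> \<in> proj_P e N ` dom_A_pow e lam \<sigma>"
  obtain Dh where "C1_gap e lam \<sigma> L \<mu> \<beta> N F Dh" using C1_gap_exists[OF C1] by blast
  then interpret C1_gap e lam \<sigma> L \<mu> \<beta> N F Dh .
  show "tends_to_0_in_prob (\<lambda>\<alpha>. muW \<Otimes>\<^sub>M muS \<alpha>) good_paths
              (\<lambda>\<alpha> (w, l). op_norm_on (proj_P e N ` dom_A_pow e lam \<sigma>) (norm_A e lam \<sigma>) (norm_A e lam \<sigma>)
                 (\<lambda>h. deriv_manifold_map e lam \<sigma> F N \<beta> (w \<circ> l) \<xi> h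
                    - deriv_manifold_map e lam \<sigma> F N \<beta> w \<xi> h))"
  proof (rule prob)
    fix \<omega> l :: "nat \<Rightarrow> real \<Rightarrow> real" and w
    assume good: "\<And>n. (\<omega> n, l n) \<in> good_paths" and w: "\<And>t. isCont w t"
      and lim: "\<And>t. (\<lambda>n. \<omega> n t) \<longlonglongrightarrow> w t" "\<And>t. (\<lambda>n. \<omega> n (l n t)) \<longlonglongrightarrow> w t"
    note d = good_paths_driving[OF good]
    \<comment> \<open>The two linearized orbits have a common limit, the one along \<open>w\<close>,
      so each of the finitely many summands tends to 0.\<close>
    let ?Y = "\<lambda>n. \<Sum>k=1..N. norm (orbit_deriv (\<omega> n \<circ> l n) (Apow \<xi>) (e k) 0 - orbit_deriv (\<omega> n) (Apow \<xi>) (e k) 0)"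
    have "?Y \<longlonglongrightarrow> (\<Sum>k=1..N. norm (orbit_deriv w (Apow \<xi>) (e k) 0 - orbit_deriv w (Apow \<xi>) (e k) 0))"
      using lim by (intro tendsto_sum tendsto_norm tendsto_diff orbit_deriv_tendsto driving_nc d nc w) auto
    then have "?Y \<longlonglongrightarrow> 0" by simp
    moreover have "op_norm_on PD nA nA (\<lambda>h. deriv_manifold_map e lam \<sigma> F N \<beta> (\<omega> n \<circ> l n) \<xi> h
                    - deriv_manifold_map e lam \<sigma> F N \<beta> (\<omega> n) \<xi> h) \<le> ?Y n" for n
    proof -
      have "op_norm_on PD nA nA (\<lambda>h. deriv_manifold_map e lam \<sigma> F N \<beta> (\<omega> n \<circ> l n) \<xi> h
                    - deriv_manifold_map e lam \<sigma> F N \<beta> (\<omega> n) \<xi> h)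
         = op_norm_on PD nA nA (\<lambda>h. graph_deriv (\<omega> n \<circ> l n) \<xi> h - graph_deriv (\<omega> n) \<xi> h)"
        unfolding op_norm_on_def
        by (rule SUP_cong) (simp_all add: deriv_manifold_map_eq[OF d(1) \<xi>] deriv_manifold_map_eq[OF d(2) \<xi>])
      also have "\<dots> \<le> ?Y n" by (rule graph_deriv_op_norm_le[OF driving_nc[OF d(2)] driving_nc[OF d(1)]])
      finally show ?thesis .
    qed
    ultimately show "\<exists>Y. (\<forall>n. op_norm_on PD nA nA (\<lambda>h. deriv_manifold_map e lam \<sigma> F N \<beta> (\<omega> n \<circ> l n) \<xi> h
                    - deriv_manifold_map e lam \<sigma> F N \<beta> (\<omega> n) \<xi> h) \<le> Y n) \<and> Y \<longlonglongrightarrow> 0"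
      by (intro exI[of _ ?Y] conjI allI)
  qed
qed

end
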